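(* Let $(M,D,g)$ be a Hessian manifold. For every hybrid connection $\nabla$ defined on all of $M$, there exists a globally defined smooth function $\psi : M \to \mathbb{R}^* = \mathbb{R}\setminus\{0\}$ such that $H(\psi)=g$ and such that $\psi$ is a logarithmic potential of $\nabla$, i.e. $$\nabla_u v = D_u v - \frac{d\psi(u)\,v + d\psi(v)\,u}{\psi}$$ for every tangent vector $u$ and every local vector field $v$. Conversely, for every smooth function $\psi:M\to\mathbb{R}^*$ with $H(\psi)=g$, the connection on $M$ having $\psi$ as logarithmic potential is a hybrid connection on $(M,D,g)$.
   Context: All manifolds, connections and metrics are smooth; "metric" means pseudo-Riemannian metric. An affine manifold $(M,D)$ is a manifold with a flat affine connection $D$ (symmetric, i.e. torsion-free, with vanishing curvature); affine charts are charts in which $D$ is the canonical connection of $\mathbb{R}^d$. For a smooth function $f$, the Hessian $H(f)$ is the symmetric $(0,2)$-tensor with matrix $\left(\frac{\partial^2 f}{\partial x_i\partial x_j}\right)$ in any affine chart. A Hessian manifold $(M,D,g)$ consists of a connected real manifold $M$ of dimension $d\ge 2$, a flat affine connection $D$ on $M$, and a pseudo-Riemannian metric $g$ of arbitrary signature which can locally be written $g=H(\psi)$ for some locally defined smooth function $\psi$ (a Hessian potential). A hybrid connection $\nabla$ on $(M,D,g)$ is a symmetric (torsion-free) affine connection such that: (1) the unparameterized geodesics of $\nabla$ and $D$ coincide ($\nabla$ is projectively equivalent to $D$), i.e. the geodesics of $\nabla$ are straight lines in affine charts; (2) $\nabla$ is incompressible: near every point there exists a non-vanishing volume form that is locally preserved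 by the parallel transport of $\nabla$; (3) $\nabla$ is infinitesimally conformal: in any affine chart, the holonomy of $\nabla$ around an arbitrarily small planar rectangle of area $\mathcal{A}$ is of the form $\mathrm{Id}+\mathcal{A}\cdot\mathcal{M}+o(\mathcal{A})$ where $\mathcal{M}$ is an infinitesimal similarity of $g$, i.e. an endomorphism of the tangent space in the Lie algebra of the group of linear similarities (maps multiplying the quadratic form of $g$ by a positive constant): $g(\mathcal{M}v,w)+g(v,\mathcal{M}w)=c\,g(v,w)$ for some constant $c\in\mathbb{R}$. (For the rectangle directed by $e_i,e_j$, $\mathcal{M}$ is the endomorphism $-R(e_i,e_j)$, with $R$ the curvature tensor of $\nabla$.) (4) the Riemann curvature tensor $R$ of $\nabla$ vanishes at no point of $M$. *)

theory Defs
  imports "HOL-Analysis.Analysis"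
begin

section \<open>Smooth maps between normed spaces\<close>

text \<open>The domain \<open>S\<close> is always open below: derivatives are full derivatives \<open>at x\<close>.\<close>

fun Ck_on :: "nat \<Rightarrow> 'a::real_normed_vector set \<Rightarrow> ('a \<Rightarrow> 'b::real_normed_vector) \<Rightarrow> bool" where
  "Ck_on 0 S f \<longleftrightarrow> continuous_on S f"
| "Ck_on (Suc k) S f \<longleftrightarrow>
     (\<forall>x\<in>S. f differentiable (at x)) \<and> (\<forall>v. Ck_on k S (\<lambda>x. frechet_derivative f (at x) v))"

definition smooth_on :: "'a::real_normed_vector set \<Rightarrow> ('a \<Rightarrow> 'b::real_normed_vector) \<Rightarrow> bool" where
  "smooth_on S f \<longleftrightarrow> (\<forall>k. Ck_on k S f)"

section \<open>Smooth manifolds\<close>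

text \<open>The manifold is the whole type \<open>'m\<close>, of dimension \<open>CARD('n)\<close>. A chart is a pair of an open
  domain and a coordinate map; the values of the coordinate map outside the domain are irrelevant.\<close>

type_synonym ('m, 'n) chart = "'m set \<times> ('m \<Rightarrow> real ^ 'n)"

abbreviation dom_of :: "('m, 'n) chart \<Rightarrow> 'm set" where
  "dom_of c \<equiv> fst c"

abbreviation coord :: "('m, 'n) chart \<Rightarrow> 'm \<Rightarrow> real ^ 'n" where
  "coord c \<equiv> snd c"

definition img :: "('m, 'n) chart \<Rightarrow> (real ^ 'n) set" where
  "img c = coord c ` dom_of c"

definition param :: "('m, 'n) chart \<Rightarrow> real ^ 'n \<Rightarrow> 'm" where
  "param c = inv_into (dom_of c) (coord c)"

definition is_chart :: "('m::topological_space, 'n::finite) chart \<Rightarrow> bool" where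
  "is_chart c \<longleftrightarrow> open (dom_of c) \<and> open (img c) \<and>
     homeomorphism (dom_of c) (img c) (coord c) (param c)"

definition transition :: "('m, 'n) chart \<Rightarrow> ('m, 'n) chart \<Rightarrow> real ^ 'n \<Rightarrow> real ^ 'n" where
  "transition c c' = coord c' \<circ> param c"

definition overlap :: "('m, 'n) chart \<Rightarrow> ('m, 'n) chart \<Rightarrow> (real ^ 'n) set" where
  "overlap c c' = coord c ` (dom_of c \<inter> dom_of c')"

definition compatible :: "('m, 'n::finite) chart \<Rightarrow> ('m, 'n) chart \<Rightarrow> bool" where
  "compatible c c' \<longleftrightarrow>
     smooth_on (overlap c c') (transition c c') \<and> smooth_on (overlap c' c) (transition c' c)"

text \<open>A smooth structure is a maximal smooth atlas; the remaining topological requirements on a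
  manifold are imposed by the type class.\<close>

definition smooth_structure ::
  "('m::{t2_space,second_countable_topology}, 'n::finite) chart set \<Rightarrow> bool" where
  "smooth_structure A \<longleftrightarrow>
     (\<forall>c\<in>A. is_chart c) \<and> (\<Union>c\<in>A. dom_of c) = UNIV \<and>
     (\<forall>c\<in>A. \<forall>c'\<in>A. compatible c c') \<and>
     (\<forall>c. is_chart c \<and> (\<forall>c'\<in>A. compatible c c') \<longrightarrow> c \<in> A)"

definition smooth_fun_on ::
  "('m, 'n::finite) chart set \<Rightarrow> 'm set \<Rightarrow> ('m \<Rightarrow> real) \<Rightarrow> bool" where
  "smooth_fun_on A U f \<longleftrightarrow> (\<forall>c\<in>A. smooth_on (coord c ` (dom_of c \<inter> U)) (f \<circ> param c))"

definition differential ::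
  "('m, 'n::finite) chart \<Rightarrow> ('m \<Rightarrow> real) \<Rightarrow> real ^ 'n \<Rightarrow> real ^ 'n \<Rightarrow> real" where
  "differential c f x u = frechet_derivative (f \<circ> param c) (at x) u"

section \<open>Affine connections\<close>

text \<open>A connection is given by its Christoffel symbols in every chart: \<open>G c x u v\<close> is the covariant
  derivative at \<open>x\<close>, along \<open>u\<close>, of the field that is constantly \<open>v\<close> in the chart \<open>c\<close>. Points and
  tangent vectors are represented by their coordinates in the chart. The last clause, with
  \<open>T\<close> a change of charts, is the usual inhomogeneous transformation law
  \<open>D\<^sup>2T(u,v) + G'(DT u, DT v) = DT (G(u,v))\<close>; it says exactly that \<open>cov_deriv\<close> below does not
  depend on the chart.\<close>

type_synonym ('m, 'n) connection =
  "('m, 'n) chart \<Rightarrow> real ^ 'n \<Rightarrow> real ^ 'n \<Rightarrow> real ^ 'n \<Rightarrow> real ^ 'n"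

definition affine_connection ::
  "('m, 'n::finite) chart set \<Rightarrow> ('m, 'n) connection \<Rightarrow> bool" where
  "affine_connection A G \<longleftrightarrow>
     (\<forall>c\<in>A. (\<forall>x\<in>img c. bilinear (G c x)) \<and> (\<forall>u v. smooth_on (img c) (\<lambda>x. G c x u v))) \<and>
     (\<forall>c\<in>A. \<forall>c'\<in>A. \<forall>x\<in>overlap c c'. \<forall>u v.
        let T = transition c c'; DT = (\<lambda>y. frechet_derivative T (at y)) in
        frechet_derivative (\<lambda>y. DT y v) (at x) u + G c' (T x) (DT x u) (DT x v)
          = DT x (G c x u v))"

definition torsion_free ::
  "('m, 'n::finite) chart set \<Rightarrow> ('m, 'n) connection \<Rightarrow> bool" where
  "torsion_free A G \<longleftrightarrow> (\<forall>c\<in>A. \<forall>x\<in>img c. \<forall>u v. G c x u v = G c x v u)"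

definition cov_deriv ::
  "('m, 'n::finite) connection \<Rightarrow> ('m, 'n) chart \<Rightarrow> (real ^ 'n \<Rightarrow> real ^ 'n)
     \<Rightarrow> real ^ 'n \<Rightarrow> real ^ 'n \<Rightarrow> real ^ 'n" where
  "cov_deriv G c v x u = frechet_derivative v (at x) u + G c x u (v x)"

text \<open>\<open>R(u,v)w = \<nabla>\<^sub>u \<nabla>\<^sub>v w - \<nabla>\<^sub>v \<nabla>\<^sub>u w - \<nabla>\<^bsub>[u,v]\<^esub> w\<close>, evaluated on fields \<open>u, v, w\<close> that are constant in
  the chart, so that the bracket vanishes and \<open>\<nabla>\<^sub>v w\<close> is the Christoffel term.\<close>

definition curvature ::
  "('m, 'n::finite) connection \<Rightarrow> ('m, 'n) chart \<Rightarrow> real ^ 'n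
     \<Rightarrow> real ^ 'n \<Rightarrow> real ^ 'n \<Rightarrow> real ^ 'n \<Rightarrow> real ^ 'n" where
  "curvature G c x u v w =
     cov_deriv G c (\<lambda>y. G c y v w) x u - cov_deriv G c (\<lambda>y. G c y u w) x v"

definition flat_affine_connection ::
  "('m, 'n::finite) chart set \<Rightarrow> ('m, 'n) connection \<Rightarrow> bool" where
  "flat_affine_connection A D \<longleftrightarrow> affine_connection A D \<and> torsion_free A D \<and>
     (\<forall>c\<in>A. \<forall>x\<in>img c. \<forall>u v w. curvature D c x u v w = 0)"

definition affine_chart ::
  "('m, 'n::finite) chart set \<Rightarrow> ('m, 'n) connection \<Rightarrow> ('m, 'n) chart \<Rightarrow> bool" where
  "affine_chart A D c \<longleftrightarrow> c \<in> A \<and> (\<forall>x\<in>img c. \<forall>u v. D c x u v = 0)"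

section \<open>Hessian manifolds\<close>

text \<open>\<open>hessian\<close> is the \<open>(0,2)\<close>-tensor \<open>H(f)(u,v) = u(v f) - (D\<^sub>u v) f\<close>, written in an arbitrary
  chart; in an affine chart its matrix is that of the second partial derivatives.\<close>

definition hessian ::
  "('m, 'n::finite) connection \<Rightarrow> ('m, 'n) chart \<Rightarrow> ('m \<Rightarrow> real) \<Rightarrow> real ^ 'n
     \<Rightarrow> real ^ 'n \<Rightarrow> real ^ 'n \<Rightarrow> real" where
  "hessian D c f x u v =
     frechet_derivative (\<lambda>y. differential c f y v) (at x) u - differential c f x (D c x u v)"

lemma hessian_affine_chart:
  assumes "affine_chart A D c" and "x \<in> img c"
    and "(f \<circ> param c) differentiable (at x)"
  shows "hessian D c f x (axis i 1) (axis j 1) =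
    frechet_derivative (\<lambda>y. frechet_derivative (f \<circ> param c) (at y) (axis j 1)) (at x) (axis i 1)"
  using assms linear_frechet_derivative[OF assms(3)]
  by (simp add: hessian_def differential_def affine_chart_def linear_0)

type_synonym ('m, 'n) bilinear_field =
  "('m, 'n) chart \<Rightarrow> real ^ 'n \<Rightarrow> real ^ 'n \<Rightarrow> real ^ 'n \<Rightarrow> real"

definition pseudo_riemannian_metric ::
  "('m, 'n::finite) chart set \<Rightarrow> ('m, 'n) bilinear_field \<Rightarrow> bool" where
  "pseudo_riemannian_metric A g \<longleftrightarrow>
     (\<forall>c\<in>A. (\<forall>x\<in>img c. bilinear (g c x) \<and> (\<forall>u v. g c x u v = g c x v u) \<and>
                (\<forall>u. (\<forall>v. g c x u v = 0) \<longrightarrow> u = 0)) \<and>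
             (\<forall>u v. smooth_on (img c) (\<lambda>x. g c x u v))) \<and>
     (\<forall>c\<in>A. \<forall>c'\<in>A. \<forall>x\<in>overlap c c'. \<forall>u v.
        let T = transition c c'; DT = frechet_derivative T (at x) in
        g c' (T x) (DT u) (DT v) = g c x u v)"

definition hessian_potential_on ::
  "('m, 'n::finite) chart set \<Rightarrow> ('m, 'n) connection \<Rightarrow> ('m, 'n) bilinear_field
     \<Rightarrow> 'm set \<Rightarrow> ('m \<Rightarrow> real) \<Rightarrow> bool" where
  "hessian_potential_on A D g U f \<longleftrightarrow> smooth_fun_on A U f \<and>
     (\<forall>c\<in>A. \<forall>x\<in>coord c ` (dom_of c \<inter> U). \<forall>u v. hessian D c f x u v = g c x u v)"

definition hessian_manifold ::
  "('m::{t2_space,second_countable_topology}, 'n::finite) chart set \<Rightarrow> ('m, 'n) connection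
     \<Rightarrow> ('m, 'n) bilinear_field \<Rightarrow> bool" where
  "hessian_manifold A D g \<longleftrightarrow>
     smooth_structure A \<and> connected (UNIV :: 'm set) \<and> CARD('n) \<ge> 2 \<and>
     flat_affine_connection A D \<and> pseudo_riemannian_metric A g \<and>
     (\<forall>p. \<exists>U f. open U \<and> p \<in> U \<and> hessian_potential_on A D g U f)"

section \<open>Hybrid connections\<close>

text \<open>Covariant derivative of the vector field \<open>X\<close> along the curve \<open>\<sigma>\<close>, in the chart \<open>c\<close>.\<close>

definition cov_along ::
  "('m, 'n::finite) connection \<Rightarrow> ('m, 'n) chart \<Rightarrow> (real \<Rightarrow> real ^ 'n) \<Rightarrow> (real \<Rightarrow> real ^ 'n)
     \<Rightarrow> real \<Rightarrow> real ^ 'n" where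
  "cov_along G c \<sigma> X t =
     vector_derivative X (at t) + G c (\<sigma> t) (vector_derivative \<sigma> (at t)) (X t)"

definition smooth_curve_on ::
  "('m::topological_space, 'n::finite) chart set \<Rightarrow> real set \<Rightarrow> (real \<Rightarrow> 'm) \<Rightarrow> bool" where
  "smooth_curve_on A J \<gamma> \<longleftrightarrow> continuous_on J \<gamma> \<and>
     (\<forall>c\<in>A. smooth_on {t \<in> J. \<gamma> t \<in> dom_of c} (coord c \<circ> \<gamma>))"

text \<open>An unparameterized geodesic is a regular curve whose acceleration is everywhere proportional
  to its velocity, i.e. which becomes a geodesic after a change of parameter.\<close>

definition unparam_geodesic_on ::
  "('m::topological_space, 'n::finite) chart set \<Rightarrow> ('m, 'n) connection \<Rightarrow> real set
     \<Rightarrow> (real \<Rightarrow> 'm) \<Rightarrow> bool" where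
  "unparam_geodesic_on A G J \<gamma> \<longleftrightarrow> smooth_curve_on A J \<gamma> \<and>
     (\<forall>c\<in>A. \<forall>t\<in>J. \<gamma> t \<in> dom_of c \<longrightarrow>
        (let \<sigma> = coord c \<circ> \<gamma>; \<sigma>' = (\<lambda>s. vector_derivative \<sigma> (at s)) in
         \<sigma>' t \<noteq> 0 \<and> (\<exists>k. cov_along G c \<sigma> \<sigma>' t = k *\<^sub>R \<sigma>' t)))"

definition projectively_equivalent ::
  "('m::topological_space, 'n::finite) chart set \<Rightarrow> ('m, 'n) connection \<Rightarrow> ('m, 'n) connection
     \<Rightarrow> bool" where
  "projectively_equivalent A G D \<longleftrightarrow>
     (\<forall>J \<gamma>. open J \<and> is_interval J \<longrightarrow>
        (unparam_geodesic_on A G J \<gamma> \<longleftrightarrow> unparam_geodesic_on A D J \<gamma>))"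

definition parallel_along ::
  "('m, 'n::finite) connection \<Rightarrow> ('m, 'n) chart \<Rightarrow> real set \<Rightarrow> (real \<Rightarrow> real ^ 'n)
     \<Rightarrow> (real \<Rightarrow> real ^ 'n) \<Rightarrow> bool" where
  "parallel_along G c J \<sigma> X \<longleftrightarrow> smooth_on J X \<and> (\<forall>t\<in>J. cov_along G c \<sigma> X t = 0)"

text \<open>In a chart, the volume form \<open>\<rho> dx\<^sub>1 \<and> \<dots> \<and> dx\<^sub>d\<close> takes on vectors \<open>X\<^sub>1, \<dots>, X\<^sub>d\<close> the value
  \<open>\<rho>\<close> times the determinant of the matrix with columns \<open>X\<^sub>j\<close>.\<close>

definition volume_form ::
  "(real ^ 'n \<Rightarrow> real) \<Rightarrow> real ^ 'n \<Rightarrow> ('n::finite \<Rightarrow> real ^ 'n) \<Rightarrow> real" where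
  "volume_form \<rho> x X = \<rho> x * det (\<chi> i j. X j $ i)"

definition incompressible ::
  "('m, 'n::finite) chart set \<Rightarrow> ('m, 'n) connection \<Rightarrow> bool" where
  "incompressible A G \<longleftrightarrow>
     (\<forall>p. \<exists>c\<in>A. \<exists>W \<rho>. p \<in> dom_of c \<and> open W \<and> coord c p \<in> W \<and> W \<subseteq> img c \<and>
        smooth_on W \<rho> \<and> (\<forall>x\<in>W. \<rho> x \<noteq> 0) \<and>
        (\<forall>J \<sigma> X. open J \<and> is_interval J \<and> smooth_on J \<sigma> \<and> \<sigma> ` J \<subseteq> W \<and>
           (\<forall>j. parallel_along G c J \<sigma> (X j)) \<longrightarrow>
           (\<forall>s\<in>J. \<forall>t\<in>J. volume_form \<rho> (\<sigma> s) (\<lambda>j. X j s) = volume_form \<rho> (\<sigma> t) (\<lambda>j. X j t))))"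

definition infinitesimal_similarity ::
  "(real ^ 'n \<Rightarrow> real ^ 'n \<Rightarrow> real) \<Rightarrow> (real ^ 'n::finite \<Rightarrow> real ^ 'n) \<Rightarrow> bool" where
  "infinitesimal_similarity q M \<longleftrightarrow>
     linear M \<and> (\<exists>k::real. \<forall>v w. q (M v) w + q v (M w) = k * q v w)"

text \<open>The holonomy around the small parallelogram with corner \<open>x\<close> and sides \<open>s u, t v\<close> is
  \<open>Id + s t M + o(s t)\<close> with \<open>M = - R(u,v)\<close>; for \<open>u = e\<^sub>i, v = e\<^sub>j\<close> its area is \<open>s t\<close>.\<close>

definition holonomy_generator ::
  "('m, 'n::finite) connection \<Rightarrow> ('m, 'n) chart \<Rightarrow> real ^ 'n \<Rightarrow> real ^ 'n \<Rightarrow> real ^ 'n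
     \<Rightarrow> real ^ 'n \<Rightarrow> real ^ 'n" where
  "holonomy_generator G c x u v = (\<lambda>w. - curvature G c x u v w)"

text \<open>Both sides of the condition are tensorial, so it may be stated in all charts at once instead
  of in the affine ones, and for all directing vectors instead of the coordinate ones.\<close>

definition infinitesimally_conformal ::
  "('m, 'n::finite) chart set \<Rightarrow> ('m, 'n) bilinear_field \<Rightarrow> ('m, 'n) connection \<Rightarrow> bool" where
  "infinitesimally_conformal A g G \<longleftrightarrow>
     (\<forall>c\<in>A. \<forall>x\<in>img c. \<forall>u v. infinitesimal_similarity (g c x) (holonomy_generator G c x u v))"

definition hybrid_connection ::
  "('m::topological_space, 'n::finite) chart set \<Rightarrow> ('m, 'n) connection
     \<Rightarrow> ('m, 'n) bilinear_field \<Rightarrow> ('m, 'n) connection \<Rightarrow> bool" where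
  "hybrid_connection A D g G \<longleftrightarrow>
     affine_connection A G \<and> torsion_free A G \<and>
     projectively_equivalent A G D \<and>
     incompressible A G \<and>
     infinitesimally_conformal A g G \<and>
     (\<forall>c\<in>A. \<forall>x\<in>img c. \<exists>u v w. curvature G c x u v w \<noteq> 0)"

definition logarithmic_potential ::
  "('m, 'n::finite) chart set \<Rightarrow> ('m, 'n) connection \<Rightarrow> ('m, 'n) connection
     \<Rightarrow> ('m \<Rightarrow> real) \<Rightarrow> bool" where
  "logarithmic_potential A D G f \<longleftrightarrow>
     (\<forall>c\<in>A. \<forall>W v. open W \<and> W \<subseteq> img c \<and> smooth_on W v \<longrightarrow>
        (\<forall>x\<in>W. \<forall>u. cov_deriv G c v x u = cov_deriv D c v x u
           - (1 / f (param c x)) *\<^sub>R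
               (differential c f x u *\<^sub>R v x + differential c f x (v x) *\<^sub>R u)))"

end

theory Submission
  imports Defs
begin

text \<open>All computations take place in arbitrary charts, so that the existence of affine charts (Frobenius)
  is not needed. Projective equivalence, tested on \<open>D\<close>-geodesics, gives
  \<open>\<nabla>\<^sub>u v = D\<^sub>u v + a(u) v + a(v) u\<close> with a \<open>1\<close>-form \<open>a\<close>. Taking traces, a parallel volume form and the
  flatness of \<open>D\<close> force \<open>da = 0\<close>, and then \<open>R(u,v)w = P(u,w) v - P(v,w) u\<close> for the symmetric tensor
  \<open>P = Da - a \<otimes> a\<close>. These endomorphisms are trace free, so if they are infinitesimal similarities of
  \<open>g\<close> they are skew, which means \<open>P = l g\<close> for a function \<open>l\<close>, non-vanishing because \<open>R\<close> is. The
  Codazzi equation for \<open>g\<close> and the Ricci identity for \<open>a\<close> yield \<open>dl = l a\<close>. Hence \<open>\<psi> = - 1 / l\<close>, which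
  is globally defined, satisfies \<open>d\<psi> = - \<psi> a\<close> and \<open>H(\<psi>) = - \<psi> P = g\<close>. Conversely \<open>a = - d\<psi> / \<psi>\<close> has
  \<open>P = - g / \<psi>\<close>, and \<open>exp F / \<psi>^(d + 1)\<close> is the density of a parallel volume form, where \<open>F\<close> is a local
  primitive of the closed form \<open>tr D\<close>.\<close>

section \<open>Calculus of smooth maps\<close>

text \<open>The obstacle to a global statement is twofold: local Hessian potentials of
  \<open>g\<close> are unique only up to affine functions, and the closed form a need not be exact
  on M. Both difficulties disappear because P and \<open>g\<close> are tensors with a ratio l that
  is fixed at each point, so nothing is integrated or glued, whatever the topology of M. Sign and
  inverse are forced: a function with d\<psi> = - \<psi> a has H(\<psi>) = - \<psi> P, which equals
  \<open>g\<close> only for \<psi> = - 1 / l. The constant d + 1 arises because the endomorphism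
  sending v to a(u) v + a(v) u has trace (d + 1) a(u). Dimension at least 2 enters where independent
  vectors are compared: in removing dl - l a, and in showing that the curvature of a logarithmic
  connection does not vanish. The price of general charts is that D-geodesics are not straight and
  that tr D is merely closed. Hence an existence theorem for differential equations, which also
  supplies parallel frames, and a Poincare lemma on balls.\<close>

abbreviation dirD :: "('a::real_normed_vector \<Rightarrow> 'b::real_normed_vector) \<Rightarrow> 'a \<Rightarrow> 'a \<Rightarrow> 'b" where
  "dirD f x u \<equiv> frechet_derivative f (at x) u"

lemma dirD_eqI: "(f has_derivative f') (at x) \<Longrightarrow> dirD f x u = f' u"
  by (metis frechet_derivative_at)

text \<open>\<open>frechet_derivative\<close> is a choice from the predicate
  \<open>has_derivative\<close>; functions that agree near x define the same predicate, so the
  choices coincide even where no derivative exists.\<close>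

lemma dirD_cong:
  assumes "open S" "x \<in> S" "\<And>y. y \<in> S \<Longrightarrow> f y = g y"
  shows "dirD f x = dirD g x"
proof -
  have "(f has_derivative f') (at x) \<longleftrightarrow> (g has_derivative f') (at x)" for f'
    using has_derivative_transform_within_open[OF _ assms(1,2)] assms(3) by metis
  then show ?thesis
    by (simp add: frechet_derivative_def)
qed

lemma differentiable_cong_open:
  assumes "open S" "x \<in> S" "\<And>y. y \<in> S \<Longrightarrow> f y = g y" "g differentiable (at x)"
  shows "f differentiable (at x)"
  using assms(3,4) has_derivative_transform_within_open[OF _ assms(1,2)]
  unfolding differentiable_def by metis

lemma Ck_on_subset: "Ck_on k S f \<Longrightarrow> T \<subseteq> S \<Longrightarrow> Ck_on k T f"
  by (induction k arbitrary: f) (auto intro: continuous_on_subset)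

lemma Ck_on_cong:
  assumes "open S" "\<And>x. x \<in> S \<Longrightarrow> f x = g x" "Ck_on k S f"
  shows "Ck_on k S g"
  using assms(2,3)
proof (induction k arbitrary: f g)
  case 0
  then show ?case by (metis Ck_on.simps(1) continuous_on_eq)
next
  case (Suc k)
  have "g differentiable (at x)" if "x \<in> S" for x
    using differentiable_cong_open[OF assms(1) that, of g f] Suc.prems that by auto
  moreover have "Ck_on k S (\<lambda>x. dirD g x v)" for v
    by (rule Suc.IH[of "\<lambda>x. dirD f x v"])
      (use Suc.prems dirD_cong[OF assms(1), of _ f g] in auto)
  ultimately show ?case by auto
qed

lemma Ck_on_Suc_imp: "Ck_on (Suc k) S f \<Longrightarrow> Ck_on k S f"
  by (induction k arbitrary: f)
    (auto intro!: continuous_at_imp_continuous_on differentiable_imp_continuous_within)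

text \<open>Working form of the recursion: an explicit derivative \<open>f'\<close> replaces the
  chosen one, so that closure properties become inductions on k whose step is the usual
  differentiation rule.\<close>

lemma Ck_on_SucI:
  assumes "open S" "\<And>x. x \<in> S \<Longrightarrow> (f has_derivative f' x) (at x)"
    and "\<And>v. Ck_on k S (\<lambda>x. f' x v)"
  shows "Ck_on (Suc k) S f"
proof -
  have "Ck_on k S (\<lambda>x. dirD f x v)" for v
    by (rule Ck_on_cong[OF assms(1) _ assms(3)[of v]]) (simp add: dirD_eqI[OF assms(2)])
  then show ?thesis
    using assms(2) by (auto simp: differentiable_def)
qed

lemma Ck_on_SucD:
  assumes "Ck_on (Suc k) S f"
  shows "\<And>x. x \<in> S \<Longrightarrow> (f has_derivative dirD f x) (at x)" "Ck_on k S (\<lambda>x. dirD f x v)"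
    "Ck_on k S f"
  using assms Ck_on_Suc_imp[OF assms] by (auto simp: frechet_derivative_works)

lemma Ck_on_const: "open S \<Longrightarrow> Ck_on k S (\<lambda>x. a)"
proof (induction k arbitrary: a)
  case (Suc k)
  then show ?case
    by (intro Ck_on_SucI[where f' = "\<lambda>_ _. 0"]) auto
qed auto

lemma Ck_on_bounded_linear:
  assumes "bounded_linear h" "open S" "Ck_on k S f"
  shows "Ck_on k S (\<lambda>x. h (f x))"
  using assms(3)
proof (induction k arbitrary: f)
  case 0
  then show ?case by (simp add: assms(1) bounded_linear.continuous_on)
next
  case (Suc k)
  show ?case
    by (intro Ck_on_SucI[where f' = "\<lambda>x v. h (dirD f x v)"] bounded_linear.has_derivative[OF assms(1)]
        assms Suc.IH Ck_on_SucD[OF Suc.prems])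
qed

lemma Ck_on_add:
  assumes "open S" "Ck_on k S f" "Ck_on k S g"
  shows "Ck_on k S (\<lambda>x. f x + g x)"
  using assms(2,3)
proof (induction k arbitrary: f g)
  case (Suc k)
  show ?case
    by (intro Ck_on_SucI[where f' = "\<lambda>x v. dirD f x v + dirD g x v"] has_derivative_add
        assms(1) Suc.IH Ck_on_SucD[OF Suc.prems(1)] Ck_on_SucD[OF Suc.prems(2)])
qed (auto intro: continuous_on_add)

lemma Ck_on_bilinear:
  assumes "bounded_bilinear mul" "open S" "Ck_on k S f" "Ck_on k S g"
  shows "Ck_on k S (\<lambda>x. mul (f x) (g x))"
  using assms(3,4)
proof (induction k arbitrary: f g)
  case 0
  then show ?case by (simp add: assms(1) bounded_bilinear.continuous_on)
next
  case (Suc k)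
  show ?case
    by (intro Ck_on_SucI[where f' = "\<lambda>x v. mul (f x) (dirD g x v) + mul (dirD f x v) (g x)"]
        bounded_bilinear.FDERIV[OF assms(1)] Ck_on_add
        assms(2) Suc.IH Ck_on_SucD[OF Suc.prems(1)] Ck_on_SucD[OF Suc.prems(2)])
qed

lemma Ck_on_sum:
  assumes "open S" "\<And>i. i \<in> I \<Longrightarrow> Ck_on k S (f i)"
  shows "Ck_on k S (\<lambda>x. \<Sum>i\<in>I. f i x)"
  using assms(2)
  by (induction I rule: infinite_finite_induct) (auto intro!: Ck_on_const Ck_on_add assms(1))

lemma linear_euclidean_expansion:
  fixes f :: "'a::euclidean_space \<Rightarrow> 'b::real_vector"
  assumes "linear f"
  shows "f u = (\<Sum>b\<in>Basis. (u \<bullet> b) *\<^sub>R f b)"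
proof -
  have "f u = f (\<Sum>b\<in>Basis. (u \<bullet> b) *\<^sub>R b)" by (simp add: euclidean_representation)
  also have "\<dots> = (\<Sum>b\<in>Basis. (u \<bullet> b) *\<^sub>R f b)" by (simp add: linear_sum[OF assms] linear_cmul[OF assms])
  finally show ?thesis .
qed

text \<open>The chain rule puts the moving vector \<open>dirD g x v\<close> into the linear slot of
  \<open>dirD f (g x)\<close>, where the induction hypothesis covers constant directions only.
  Expansion in the Euclidean basis leaves sums of products.\<close>

lemma Ck_on_compose:
  fixes g :: "'a::real_normed_vector \<Rightarrow> 'b::euclidean_space"
    and f :: "'b \<Rightarrow> 'c::real_normed_vector"
  assumes "open S" "open T" "g ` S \<subseteq> T" "Ck_on k T f" "Ck_on k S g"
  shows "Ck_on k S (\<lambda>x. f (g x))"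
  using assms(4,5)
proof (induction k arbitrary: f)
  case 0
  then show ?case using assms(3) continuous_on_compose2 by fastforce
next
  case (Suc k)
  note f = Ck_on_SucD[OF Suc.prems(1)] and g = Ck_on_SucD[OF Suc.prems(2)]
  have "dirD f (g x) w = (\<Sum>b\<in>Basis. (w \<bullet> b) *\<^sub>R dirD f (g x) b)" if "x \<in> S" for x w
    using f(1)[of "g x"] that assms(3) by (intro linear_euclidean_expansion has_derivative_linear) auto
  then have "((\<lambda>x. f (g x)) has_derivative (\<lambda>v. \<Sum>b\<in>Basis. (dirD g x v \<bullet> b) *\<^sub>R dirD f (g x) b)) (at x)"
    if "x \<in> S" for x
    using has_derivative_compose[OF g(1)[OF that] f(1)[of "g x"]] that assms(3) by (simp add: image_subset_iff)
  moreover have "Ck_on k S (\<lambda>x. dirD f (g x) b)" for b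
    by (rule Suc.IH[OF f(2) g(3)])
  then have "Ck_on k S (\<lambda>x. \<Sum>b\<in>Basis. (dirD g x v \<bullet> b) *\<^sub>R dirD f (g x) b)" for v
    by (intro Ck_on_sum Ck_on_bilinear[OF bounded_bilinear_scaleR] assms(1)
        Ck_on_bounded_linear[OF bounded_linear_inner_left] g(2))
  ultimately show ?case
    by (rule Ck_on_SucI[OF assms(1)])
qed

lemma smooth_on_subset: "smooth_on S f \<Longrightarrow> T \<subseteq> S \<Longrightarrow> smooth_on T f"
  by (auto simp: smooth_on_def intro: Ck_on_subset)

lemma smooth_on_cong: "open S \<Longrightarrow> (\<And>x. x \<in> S \<Longrightarrow> f x = g x) \<Longrightarrow> smooth_on S f \<Longrightarrow> smooth_on S g"
  unfolding smooth_on_def using Ck_on_cong by blast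

lemma smooth_on_const: "open S \<Longrightarrow> smooth_on S (\<lambda>x. a)"
  by (auto simp: smooth_on_def intro: Ck_on_const)

lemma smooth_on_has_derivative: "smooth_on S f \<Longrightarrow> x \<in> S \<Longrightarrow> (f has_derivative dirD f x) (at x)"
  unfolding smooth_on_def using Ck_on_SucD(1) by blast

lemma smooth_on_differentiable: "smooth_on S f \<Longrightarrow> x \<in> S \<Longrightarrow> f differentiable (at x)"
  using smooth_on_has_derivative differentiable_def by blast

lemma smooth_on_continuous_on: "smooth_on S f \<Longrightarrow> continuous_on S f"
  unfolding smooth_on_def using Ck_on.simps(1) by blast

lemma smooth_on_dirD: "smooth_on S f \<Longrightarrow> smooth_on S (\<lambda>x. dirD f x v)"
  unfolding smooth_on_def using Ck_on_SucD(2) by blast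

lemma smooth_onI_has_derivative:
  assumes "open S" "\<And>x. x \<in> S \<Longrightarrow> (f has_derivative f' x) (at x)"
    and "\<And>v. smooth_on S (\<lambda>x. f' x v)"
  shows "smooth_on S f"
  unfolding smooth_on_def
proof
  fix k
  have "Ck_on (Suc k) S f"
    using assms by (intro Ck_on_SucI[where f' = f']) (auto simp: smooth_on_def)
  then show "Ck_on k S f" by (rule Ck_on_Suc_imp)
qed

lemma smooth_on_bounded_linear:
  "bounded_linear h \<Longrightarrow> open S \<Longrightarrow> smooth_on S f \<Longrightarrow> smooth_on S (\<lambda>x. h (f x))"
  by (auto simp: smooth_on_def intro: Ck_on_bounded_linear)

lemma smooth_on_bilinear:
  "bounded_bilinear mul \<Longrightarrow> open S \<Longrightarrow> smooth_on S f \<Longrightarrow> smooth_on S g \<Longrightarrow>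
    smooth_on S (\<lambda>x. mul (f x) (g x))"
  by (auto simp: smooth_on_def intro: Ck_on_bilinear)

lemmas smooth_on_scaleR = smooth_on_bilinear[OF bounded_bilinear_scaleR]

lemma smooth_on_mult:
  fixes f g :: "'a::real_normed_vector \<Rightarrow> real"
  shows "open S \<Longrightarrow> smooth_on S f \<Longrightarrow> smooth_on S g \<Longrightarrow> smooth_on S (\<lambda>x. f x * g x)"
  by (rule smooth_on_bilinear[OF bounded_bilinear_mult])

lemma smooth_on_add:
  "open S \<Longrightarrow> smooth_on S f \<Longrightarrow> smooth_on S g \<Longrightarrow> smooth_on S (\<lambda>x. f x + g x)"
  by (auto simp: smooth_on_def intro: Ck_on_add)

lemma smooth_on_uminus: "open S \<Longrightarrow> smooth_on S f \<Longrightarrow> smooth_on S (\<lambda>x. - f x)"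
  by (rule smooth_on_bounded_linear) (auto intro: bounded_linear_minus bounded_linear_ident)

lemma smooth_on_diff:
  "open S \<Longrightarrow> smooth_on S f \<Longrightarrow> smooth_on S g \<Longrightarrow> smooth_on S (\<lambda>x. f x - g x)"
  using smooth_on_add[of S f "\<lambda>x. - g x"] smooth_on_uminus[of S g] by simp

lemma smooth_on_sum:
  "open S \<Longrightarrow> (\<And>i. i \<in> I \<Longrightarrow> smooth_on S (f i)) \<Longrightarrow> smooth_on S (\<lambda>x. \<Sum>i\<in>I. f i x)"
  by (auto simp: smooth_on_def intro: Ck_on_sum)

lemma smooth_on_compose:
  fixes g :: "'a::real_normed_vector \<Rightarrow> 'b::euclidean_space"
    and f :: "'b \<Rightarrow> 'c::real_normed_vector"
  shows "open S \<Longrightarrow> open T \<Longrightarrow> g ` S \<subseteq> T \<Longrightarrow> smooth_on T f \<Longrightarrow> smooth_on S g \<Longrightarrow>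
    smooth_on S (\<lambda>x. f (g x))"
  unfolding smooth_on_def using Ck_on_compose by blast

lemma smooth_on_ident: "open S \<Longrightarrow> smooth_on S (\<lambda>x. x)"
  by (rule smooth_onI_has_derivative[where f' = "\<lambda>x v. v"]) (auto intro: smooth_on_const)

text \<open>The derivative of 1/x is a polynomial in 1/x, so the induction on k closes on
  \<open>inverse\<close> itself.\<close>

lemma smooth_on_inverse:
  fixes f :: "'a::real_normed_vector \<Rightarrow> real"
  assumes "open S" "smooth_on S f" "\<And>x. x \<in> S \<Longrightarrow> f x \<noteq> 0"
  shows "smooth_on S (\<lambda>x. inverse (f x))"
proof -
  have o: "open (- {0::real})" by auto
  have "Ck_on k (- {0::real}) inverse" for k
  proof (induction k)
    case (Suc k)
    then show ?case
      by (intro Ck_on_SucI[where f' = "\<lambda>x v. (- 1) * (inverse x * inverse x) * v"] o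
          Ck_on_bilinear[OF bounded_bilinear_mult] Ck_on_const)
        (auto intro!: derivative_eq_intros)
  qed (auto intro!: continuous_intros)
  then show ?thesis
    using assms by (intro smooth_on_compose[OF assms(1) o, of f inverse]) (auto simp: smooth_on_def)
qed

lemma smooth_on_exp:
  fixes f :: "'a::real_normed_vector \<Rightarrow> real"
  assumes "open S" "smooth_on S f"
  shows "smooth_on S (\<lambda>x. exp (f x))"
proof -
  have "Ck_on k (UNIV :: real set) exp" for k
  proof (induction k)
    case (Suc k)
    then show ?case
      by (intro Ck_on_SucI[where f' = "\<lambda>x v. exp x * v"]
          Ck_on_bilinear[OF bounded_bilinear_mult] Ck_on_const)
        (auto intro!: derivative_eq_intros)
  qed (auto intro!: continuous_intros)
  then show ?thesis
    using assms by (intro smooth_on_compose[OF assms(1) open_UNIV, of f exp]) (auto simp: smooth_on_def)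
qed

lemma smooth_on_nth: "open S \<Longrightarrow> smooth_on S f \<Longrightarrow> smooth_on S (\<lambda>x. f x $ i)"
  by (rule smooth_on_bounded_linear[OF bounded_linear_vec_nth])

section \<open>Families of linear maps applied to moving vectors\<close>

text \<open>Smoothness of tensor fields is given on constant vectors; a basis expansion of
  \<open>h x\<close> transfers it to moving arguments.\<close>

lemma smooth_on_linear_family:
  fixes B :: "'x::real_normed_vector \<Rightarrow> 'a::euclidean_space \<Rightarrow> 'b::real_normed_vector"
  assumes "open S" "\<And>x. x \<in> S \<Longrightarrow> linear (B x)" "\<And>u. smooth_on S (\<lambda>x. B x u)" "smooth_on S h"
  shows "smooth_on S (\<lambda>x. B x (h x))"
proof -
  have "smooth_on S (\<lambda>x. \<Sum>b\<in>Basis. (h x \<bullet> b) *\<^sub>R B x b)"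
    by (intro smooth_on_sum smooth_on_scaleR assms smooth_on_bounded_linear[OF bounded_linear_inner_left])
  then show ?thesis
    by (rule smooth_on_cong[OF assms(1), rotated]) (metis assms(2) linear_euclidean_expansion)
qed

text \<open>Product rule for a tensor on a moving vector: one term differentiates \<open>B\<close>
  with the argument frozen at \<open>h x\<close>, the other differentiates the argument.\<close>

lemma has_derivative_linear_family:
  fixes B :: "'x::real_normed_vector \<Rightarrow> 'a::euclidean_space \<Rightarrow> 'b::real_normed_vector"
  assumes "open S" "x \<in> S" "\<And>y. y \<in> S \<Longrightarrow> linear (B y)"
    and "\<And>u. (\<lambda>y. B y u) differentiable (at x)" "(h has_derivative h') (at x)"
  shows "((\<lambda>y. B y (h y)) has_derivative (\<lambda>u. dirD (\<lambda>y. B y (h x)) x u + B x (h' u))) (at x)"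
proof -
  have B: "((\<lambda>y. B y u) has_derivative dirD (\<lambda>y. B y u) x) (at x)" for u
    using assms(4) frechet_derivative_works by blast
  have e: "B y w = (\<Sum>b\<in>Basis. (w \<bullet> b) *\<^sub>R B y b)" if "y \<in> S" for y w
    using linear_euclidean_expansion assms(3) that by blast
  have "((\<lambda>y. \<Sum>b\<in>Basis. (h x \<bullet> b) *\<^sub>R B y b) has_derivative
      (\<lambda>u. \<Sum>b\<in>Basis. (h x \<bullet> b) *\<^sub>R dirD (\<lambda>y. B y b) x u)) (at x)"
    by (intro has_derivative_sum has_derivative_scaleR_right B)
  then have "((\<lambda>y. B y (h x)) has_derivative
      (\<lambda>u. \<Sum>b\<in>Basis. (h x \<bullet> b) *\<^sub>R dirD (\<lambda>y. B y b) x u)) (at x)"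
    by (rule has_derivative_transform_within_open[OF _ assms(1,2)]) (metis e)
  then have d: "dirD (\<lambda>y. B y (h x)) x u = (\<Sum>b\<in>Basis. (h x \<bullet> b) *\<^sub>R dirD (\<lambda>y. B y b) x u)" for u
    by (rule dirD_eqI)
  have "((\<lambda>y. \<Sum>b\<in>Basis. (h y \<bullet> b) *\<^sub>R B y b) has_derivative
      (\<lambda>u. \<Sum>b\<in>Basis. (h x \<bullet> b) *\<^sub>R dirD (\<lambda>y. B y b) x u + (h' u \<bullet> b) *\<^sub>R B x b)) (at x)"
    by (intro has_derivative_sum has_derivative_scaleR has_derivative_inner_left B assms(5))
  then have "((\<lambda>y. B y (h y)) has_derivative
      (\<lambda>u. \<Sum>b\<in>Basis. (h x \<bullet> b) *\<^sub>R dirD (\<lambda>y. B y b) x u + (h' u \<bullet> b) *\<^sub>R B x b)) (at x)"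
    by (rule has_derivative_transform_within_open[OF _ assms(1,2)]) (metis e)
  then show ?thesis
    by (simp add: d sum.distrib flip: e[OF assms(2)])
qed

lemma linear_dirD_linear_family:
  fixes B :: "'x::real_normed_vector \<Rightarrow> 'a::real_normed_vector \<Rightarrow> 'b::real_normed_vector"
  assumes "open S" "x \<in> S" "\<And>y. y \<in> S \<Longrightarrow> linear (B y)"
    and "\<And>u. (\<lambda>y. B y u) differentiable (at x)"
  shows "linear (\<lambda>w. dirD (\<lambda>y. B y w) x u)"
proof -
  have B: "((\<lambda>y. B y u) has_derivative dirD (\<lambda>y. B y u) x) (at x)" for u
    using assms(4) frechet_derivative_works by blast
  show ?thesis
  proof (rule linearI)
    fix v w
    have "((\<lambda>y. B y (v + w)) has_derivative (\<lambda>u. dirD (\<lambda>y. B y v) x u + dirD (\<lambda>y. B y w) x u)) (at x)"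
      by (rule has_derivative_transform_within_open[OF has_derivative_add[OF B B] assms(1,2)])
        (simp add: assms(3) linear_add)
    then show "dirD (\<lambda>y. B y (v + w)) x u = dirD (\<lambda>y. B y v) x u + dirD (\<lambda>y. B y w) x u"
      by (rule dirD_eqI)
  next
    fix r w
    have "((\<lambda>y. B y (r *\<^sub>R w)) has_derivative (\<lambda>u. r *\<^sub>R dirD (\<lambda>y. B y w) x u)) (at x)"
      by (rule has_derivative_transform_within_open[OF has_derivative_scaleR_right[OF B] assms(1,2)])
        (simp add: assms(3) linear_cmul)
    then show "dirD (\<lambda>y. B y (r *\<^sub>R w)) x u = r *\<^sub>R dirD (\<lambda>y. B y w) x u"
      by (rule dirD_eqI)
  qed
qed

section \<open>Symmetry of second derivatives\<close>

text \<open>The mean value theorem is used twice: in direction u on the increment of f along v, then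
  in direction v on the derivative of f along u.\<close>

lemma mixed_second_difference:
  fixes f :: "'a::real_normed_vector \<Rightarrow> real"
  assumes "0 < s"
    and f: "\<And>a b. 0 \<le> a \<Longrightarrow> a \<le> s \<Longrightarrow> 0 \<le> b \<Longrightarrow> b \<le> s \<Longrightarrow>
      f differentiable (at (x + a *\<^sub>R u + b *\<^sub>R v)) \<and>
      (\<lambda>y. dirD f y u) differentiable (at (x + a *\<^sub>R u + b *\<^sub>R v))"
  obtains a b where "0 < a" "a < s" "0 < b" "b < s"
    "f (x + s *\<^sub>R u + s *\<^sub>R v) - f (x + s *\<^sub>R u) - f (x + s *\<^sub>R v) + f x
      = s * s * dirD (\<lambda>y. dirD f y u) (x + a *\<^sub>R u + b *\<^sub>R v) v"
proof -
  let ?p = "\<lambda>a b. x + a *\<^sub>R u + b *\<^sub>R v"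
  let ?h = "\<lambda>a. f (?p a s) - f (?p a 0)"
  have D: "((\<lambda>a. f (?p a b)) has_real_derivative dirD f (?p a b) u) (at a)"
    if "0 \<le> a" "a \<le> s" "0 \<le> b" "b \<le> s" for a b
  proof -
    have 1: "(f has_derivative dirD f (?p a b)) (at (?p a b))"
      using f[OF that] frechet_derivative_works by blast
    have 2: "((\<lambda>a. ?p a b) has_derivative (\<lambda>h. h *\<^sub>R u)) (at a)"
      by (auto intro!: derivative_eq_intros)
    show ?thesis
      using has_derivative_compose[OF 2 1] linear_cmul[OF has_derivative_linear[OF 1]]
      by (simp add: has_field_derivative_def mult_commute_abs)
  qed
  have "\<exists>a. 0 < a \<and> a < s \<and> ?h s - ?h 0 = (s - 0) * (dirD f (?p a s) u - dirD f (?p a 0) u)"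
    using assms(1) by (intro MVT2 DERIV_diff D) auto
  then obtain a where a: "0 < a" "a < s" "?h s - ?h 0 = s * (dirD f (?p a s) u - dirD f (?p a 0) u)"
    by auto
  have D2: "((\<lambda>b. dirD f (?p a b) u) has_real_derivative dirD (\<lambda>y. dirD f y u) (?p a b) v) (at b)"
    if "0 \<le> b" "b \<le> s" for b
  proof -
    have 1: "((\<lambda>y. dirD f y u) has_derivative dirD (\<lambda>y. dirD f y u) (?p a b)) (at (?p a b))"
      using f[of a b] that a frechet_derivative_works by auto
    have 2: "((\<lambda>b. ?p a b) has_derivative (\<lambda>h. h *\<^sub>R v)) (at b)"
      by (auto intro!: derivative_eq_intros)
    show ?thesis
      using has_derivative_compose[OF 2 1] linear_cmul[OF has_derivative_linear[OF 1]]
      by (simp add: has_field_derivative_def mult_commute_abs)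
  qed
  have "\<exists>b. 0 < b \<and> b < s \<and>
      dirD f (?p a s) u - dirD f (?p a 0) u = (s - 0) * dirD (\<lambda>y. dirD f y u) (?p a b) v"
    using assms(1) by (intro MVT2 D2) auto
  then show ?thesis
    using a that by auto
qed

text \<open>The second difference over a small parallelogram is symmetric in u and v, and after
  division by the square of s it is a value of either mixed derivative near x. Continuity of both at
  x excludes different values.\<close>

lemma second_derivative_symmetric:
  fixes f :: "'a::real_normed_vector \<Rightarrow> real"
  assumes "open S" "x \<in> S" "smooth_on S f"
  shows "dirD (\<lambda>y. dirD f y u) x v = dirD (\<lambda>y. dirD f y v) x u"
proof (rule ccontr)
  let ?F = "\<lambda>y. dirD (\<lambda>y. dirD f y u) y v" and ?G = "\<lambda>y. dirD (\<lambda>y. dirD f y v) y u"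
  let ?e = "\<bar>?F x - ?G x\<bar> / 2"
  assume "?F x \<noteq> ?G x"
  then have e: "?e > 0" by simp
  have "isCont ?F x" "isCont ?G x"
    by (intro differentiable_imp_continuous_within smooth_on_differentiable[OF _ assms(2)]
        smooth_on_dirD assms(3))+
  then have "\<exists>d>0. \<forall>y. dist y x < d \<longrightarrow> dist (?F y) (?F x) < ?e"
    "\<exists>d>0. \<forall>y. dist y x < d \<longrightarrow> dist (?G y) (?G x) < ?e"
    using e unfolding continuous_at_eps_delta by blast+
  then obtain d1 d2 where d: "d1 > 0" "d2 > 0" "\<And>y. dist y x < d1 \<Longrightarrow> dist (?F y) (?F x) < ?e"
    "\<And>y. dist y x < d2 \<Longrightarrow> dist (?G y) (?G x) < ?e"
    by blast
  obtain d3 where d3: "d3 > 0" "ball x d3 \<subseteq> S"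
    using assms(1,2) openE by blast
  define d where "d = min d1 (min d2 d3)"
  have dpos: "d > 0" using d d3 by (simp add: d_def)
  \<comment> \<open>The side length keeps the parallelogram within distance \<open>d\<close> of x;
    the summand 1 avoids a division by zero when u and v both vanish.\<close>
  define s where "s = d / (2 * (norm u + norm v + 1))"
  have s0: "s > 0" unfolding s_def using dpos by (simp add: add_nonneg_pos)
  have s1: "s * (norm u + norm v) < d"
  proof -
    have "s * (norm u + norm v) \<le> s * (norm u + norm v + 1)"
      using s0 by (intro mult_left_mono) auto
    also have "\<dots> = d / 2"
    proof -
      define N where "N = norm u + norm v + 1"
      have "N > 0" by (simp add: N_def add_nonneg_pos)
      then show ?thesis unfolding s_def N_def[symmetric] by simp
    qed
    finally show ?thesis using dpos by simp
  qed
  have near: "dist (x + a *\<^sub>R u + b *\<^sub>R v) x < d" if "0 \<le> a" "a \<le> s" "0 \<le> b" "b \<le> s" for a b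
  proof -
    have "dist (x + a *\<^sub>R u + b *\<^sub>R v) x = norm (a *\<^sub>R u + b *\<^sub>R v)"
      by (simp add: dist_norm algebra_simps)
    also have "\<dots> \<le> a * norm u + b * norm v"
      using norm_triangle_ineq[of "a *\<^sub>R u" "b *\<^sub>R v"] that by simp
    also have "\<dots> \<le> s * norm u + s * norm v"
      using that by (intro add_mono mult_right_mono) auto
    finally show ?thesis using s1 by (simp add: algebra_simps)
  qed
  have inS: "x + a *\<^sub>R u + b *\<^sub>R v \<in> S" if "0 \<le> a" "a \<le> s" "0 \<le> b" "b \<le> s" for a b
    using near[OF that] d3(2) by (auto simp: d_def dist_commute)
  note diff = smooth_on_differentiable[OF assms(3)] smooth_on_differentiable[OF smooth_on_dirD[OF assms(3)]]
  obtain a b where ab: "0 < a" "a < s" "0 < b" "b < s"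
    "f (x + s *\<^sub>R u + s *\<^sub>R v) - f (x + s *\<^sub>R u) - f (x + s *\<^sub>R v) + f x
      = s * s * ?F (x + a *\<^sub>R u + b *\<^sub>R v)"
    using mixed_second_difference[OF s0, of f x u v] diff inS by metis
  have inS': "x + a *\<^sub>R v + b *\<^sub>R u \<in> S" if "0 \<le> a" "a \<le> s" "0 \<le> b" "b \<le> s" for a b
    using inS[of b a] that by (simp add: algebra_simps)
  obtain a' b' where ab': "0 < a'" "a' < s" "0 < b'" "b' < s"
    "f (x + s *\<^sub>R v + s *\<^sub>R u) - f (x + s *\<^sub>R v) - f (x + s *\<^sub>R u) + f x
      = s * s * ?G (x + a' *\<^sub>R v + b' *\<^sub>R u)"
    using mixed_second_difference[OF s0, of f x v u] diff inS' by metis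
  have "s * s * ?F (x + a *\<^sub>R u + b *\<^sub>R v) = s * s * ?G (x + b' *\<^sub>R u + a' *\<^sub>R v)"
    using ab(5) ab'(5) by (simp add: algebra_simps)
  then have eq: "?F (x + a *\<^sub>R u + b *\<^sub>R v) = ?G (x + b' *\<^sub>R u + a' *\<^sub>R v)"
    using s0 by simp
  have "dist (?F (x + a *\<^sub>R u + b *\<^sub>R v)) (?F x) < ?e"
    using near[of a b] ab by (intro d(3)) (auto simp: d_def)
  moreover have "dist (?G (x + b' *\<^sub>R u + a' *\<^sub>R v)) (?G x) < ?e"
    using near[of b' a'] ab' by (intro d(4)) (auto simp: d_def)
  \<comment> \<open>A common value cannot lie within half the gap of both limits.\<close>
  moreover have False if "dist p a < \<bar>a - b\<bar> / 2" "dist p b < \<bar>a - b\<bar> / 2" for p a b :: real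
  proof -
    have "\<bar>a - b\<bar> \<le> dist p a + dist p b"
      using dist_triangle2[of a b p] by (simp add: dist_real_def abs_minus_commute)
    also have "\<dots> < \<bar>a - b\<bar> / 2 + \<bar>a - b\<bar> / 2"
      by (rule add_strict_mono[OF that])
    finally show False by simp
  qed
  ultimately show False
    unfolding eq by blast
qed

section \<open>Projective differences and derivatives of determinants\<close>

text \<open>On the diagonal, \<open>S\<close> multiplies u by a factor 2 k(u). Additivity of k comes
  from the parallelogram law, homogeneity from bilinearity, and polarization recovers
  \<open>S\<close>. The trace of \<open>S u\<close> is then (d + 1) k(u), which explains the formula
  for \<open>\<alpha>\<close>.\<close>

lemma symmetric_bilinear_projective:
  fixes S :: "real ^ 'n::finite \<Rightarrow> real ^ 'n \<Rightarrow> real ^ 'n"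
  assumes S: "bilinear S" and sym: "\<And>u v. S u v = S v u"
    and proj: "\<And>u. \<exists>k. S u u = k *\<^sub>R u"
  defines "\<alpha> \<equiv> \<lambda>u. (\<Sum>i\<in>UNIV. S u (axis i 1) $ i) / (real CARD('n) + 1)"
  shows "S u v = \<alpha> u *\<^sub>R v + \<alpha> v *\<^sub>R u"
proof -
  note bl = bilinear_ladd[OF S] bilinear_radd[OF S] bilinear_lsub[OF S] bilinear_rsub[OF S]
    bilinear_lmul[OF S] bilinear_rmul[OF S] bilinear_lzero[OF S] bilinear_rzero[OF S]
  \<comment> \<open>The factor is undetermined at u = 0; a linear k must take the value 0
    there.\<close>
  have "\<exists>k. S u u = (2 * k) *\<^sub>R u \<and> (u = 0 \<longrightarrow> k = 0)" for u
  proof -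
    obtain l where "S u u = l *\<^sub>R u" using proj by blast
    then show ?thesis
      by (intro exI[of _ "if u = 0 then 0 else l / 2"]) auto
  qed
  then obtain k where k: "\<And>u. S u u = (2 * k u) *\<^sub>R u" and k0: "k 0 = 0"
    by metis
  have scale: "k (t *\<^sub>R u) = t * k u" for t u
  proof (cases "t = 0 \<or> u = 0")
    case False
    have "(2 * k (t *\<^sub>R u)) *\<^sub>R (t *\<^sub>R u) = S (t *\<^sub>R u) (t *\<^sub>R u)" by (simp only: k)
    also have "\<dots> = (t * t) *\<^sub>R ((2 * k u) *\<^sub>R u)" 
      by (simp only: bilinear_lmul[OF S] bilinear_rmul[OF S]) (simp only: k scaleR_scaleR mult.assoc)
    finally have "(2 * k (t *\<^sub>R u) * t) *\<^sub>R u = (t * t * (2 * k u)) *\<^sub>R u"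
      by (simp only: scaleR_scaleR)
    then have "2 * k (t *\<^sub>R u) * t = t * t * (2 * k u)"
      using False by (metis scaleR_right_imp_eq)
    then have "t * (2 * k (t *\<^sub>R u)) = t * (2 * (t * k u))" by (simp only: ac_simps)
    then show ?thesis using False by (simp only: mult_cancel_left) auto
  qed (auto simp: k0)
  have add: "k (u + v) = k u + k v" for u v
  \<comment> \<open>Comparing coefficients requires u and v to be independent. Otherwise one is a
    multiple of the other and homogeneity suffices.\<close>
  proof (cases "\<forall>a b. a *\<^sub>R u + b *\<^sub>R v = 0 \<longrightarrow> a = 0 \<and> b = 0")
    case True
    have "S (u + v) (u + v) + S (u - v) (u - v) = 2 *\<^sub>R S u u + 2 *\<^sub>R S v v"
      by (simp add: bl scaleR_2)
    moreover have "2 *\<^sub>R ((k (u + v) + k (u - v) - 2 * k u) *\<^sub>R u + (k (u + v) - k (u - v) - 2 * k v) *\<^sub>R v)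
        = S (u + v) (u + v) + S (u - v) (u - v) - (2 *\<^sub>R S u u + 2 *\<^sub>R S v v)"
      unfolding k by (simp add: vec_eq_iff algebra_simps)
    ultimately have "(k (u + v) + k (u - v) - 2 * k u) *\<^sub>R u + (k (u + v) - k (u - v) - 2 * k v) *\<^sub>R v = 0"
      by simp
    then have "k (u + v) + k (u - v) - 2 * k u = 0" "k (u + v) - k (u - v) - 2 * k v = 0"
      using True by blast+
    then show ?thesis by simp
  next
    case False
    then obtain a b where ab: "a *\<^sub>R u + b *\<^sub>R v = 0" "a \<noteq> 0 \<or> b \<noteq> 0" by blast
    have *: "k (x + y) = k x + k y" if "a *\<^sub>R x + b *\<^sub>R y = 0" "b \<noteq> 0" for a b x y
    proof -
      have "b *\<^sub>R y = (- a) *\<^sub>R x" using that(1) by (simp add: eq_neg_iff_add_eq_0 add.commute)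
      then have y: "y = (- a / b) *\<^sub>R x"
        using that(2) by (metis (no_types) divide_inverse_commute scaleR_one scaleR_scaleR left_inverse)
      have "k (x + y) = k ((1 + (- a / b)) *\<^sub>R x)" by (simp add: y scaleR_left_diff_distrib)
      then show ?thesis by (simp only: scale y) (simp add: left_diff_distrib)
    qed
    show ?thesis
      using *[of a u b v] *[of b v a u] ab by (auto simp: add.commute)
  qed
  have Sk: "S u v = k u *\<^sub>R v + k v *\<^sub>R u" for u v
  proof -
    have "2 *\<^sub>R S u v = S (u + v) (u + v) - S u u - S v v"
      by (simp add: bl scaleR_2 sym)
    also have "\<dots> = 2 *\<^sub>R (k u *\<^sub>R v + k v *\<^sub>R u)"
      by (simp add: k add algebra_simps)
    finally show ?thesis by simp
  qed
  have lin: "linear k" by (rule linearI) (simp_all add: add scale)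
  have "\<alpha> u = k u" for u
  proof -
    have "k u = k (\<Sum>i\<in>UNIV. (u $ i) *\<^sub>R axis i 1)"
      using basis_expansion[of u] by (simp add: scalar_mult_eq_scaleR)
    then have e: "k u = (\<Sum>i\<in>UNIV. u $ i * k (axis i 1))"
      by (simp add: linear_sum[OF lin] linear_cmul[OF lin])
    have "(\<Sum>i\<in>UNIV. S u (axis i 1) $ i) = (\<Sum>i\<in>UNIV. k u + u $ i * k (axis i 1))"
      by (rule sum.cong) (simp_all add: Sk axis_def mult.commute)
    also have "\<dots> = real CARD('n) * k u + k u"
      by (subst (3) e) (simp add: sum.distrib)
    finally show ?thesis
      by (simp add: \<alpha>_def field_simps)
  qed
  then show ?thesis using Sk by simp
qed

section \<open>Derivative of the determinant\<close>

lemma has_derivative_det: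
  fixes M :: "real ^ 'n ^ 'n"
  shows "(det has_derivative (\<lambda>H. \<Sum>p\<in>{p. p permutes UNIV}. of_int (sign p) *
      (\<Sum>i\<in>UNIV. H $ i $ p i * (\<Prod>j\<in>UNIV - {i}. M $ j $ p j)))) (at M)"
proof -
  have e: "((\<lambda>X. X $ i $ p i) has_derivative (\<lambda>H. H $ i $ p i)) (at M)" for p :: "'n \<Rightarrow> 'n" and i
    by (intro bounded_linear_imp_has_derivative bounded_linear_compose[OF bounded_linear_vec_nth bounded_linear_vec_nth])
  show ?thesis
    unfolding det_def[abs_def]
    by (intro has_derivative_sum has_derivative_mult_right has_derivative_prod e)
qed

text \<open>Only the identity permutation contributes: any other one moves at least two indices, so
  even with row i left out an off-diagonal zero of the identity matrix remains in the
  product.\<close>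

lemma det_derivative_mat_1:
  fixes L :: "real ^ 'n ^ 'n"
  shows "(\<Sum>p\<in>{p. p permutes UNIV}. of_int (sign p) *
      (\<Sum>i\<in>UNIV. L $ i $ p i * (\<Prod>j\<in>UNIV - {i}. (mat 1 :: real ^ 'n ^ 'n) $ j $ p j))) = trace L" (is "?lhs = _")
proof -
  have *: "of_int (sign p) * (\<Sum>i\<in>UNIV. L $ i $ p i * (\<Prod>j\<in>UNIV - {i}. (mat 1 :: real ^ 'n ^ 'n) $ j $ p j))
    = (if p = id then trace L else 0)" if p: "p permutes UNIV" for p
  proof (cases "p = id")
    case True
    then show ?thesis by (simp add: mat_def trace_def)
  next
    case False
    then obtain a where a: "p a \<noteq> a" by (auto simp: fun_eq_iff)
    have "p (p a) \<noteq> p a" using a p by (metis permutes_def)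
    then have "\<exists>j\<in>UNIV - {i}. j \<noteq> p j" for i
      using a by (metis DiffI UNIV_I singletonD)
    then have "(\<Prod>j\<in>UNIV - {i}. (mat 1 :: real ^ 'n ^ 'n) $ j $ p j) = 0" for i
      by (intro prod_zero) (auto simp: mat_def)
    then show ?thesis using False by (simp only: mult_zero_right sum.neutral_const if_False)
  qed
  have "?lhs = (\<Sum>p\<in>{p. p permutes (UNIV :: 'n set)}. if p = id then trace L else 0)"
    by (rule sum.cong) (use * in auto)
  also have "\<dots> = trace L"
    by (simp add: finite_permutations permutes_id)
  finally show ?thesis .
qed

text \<open>Liouville's formula. The derivative of \<open>det\<close> in the direction
  \<open>L ** X t\<close> is read off at s = 0 from det(X + s L X) = det(1 + s L) det X, which also
  covers singular \<open>X t\<close>.\<close>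

lemma has_real_derivative_det_matrix_ode:
  fixes X :: "real \<Rightarrow> real ^ 'n ^ 'n" and L :: "real ^ 'n ^ 'n"
  assumes "(X has_vector_derivative L ** X t) (at t)"
  shows "((\<lambda>t. det (X t)) has_real_derivative trace L * det (X t)) (at t)"
proof -
  let ?D = "\<lambda>M H :: real ^ 'n ^ 'n. \<Sum>p\<in>{p. p permutes UNIV}. of_int (sign p) *
      (\<Sum>i\<in>UNIV. H $ i $ p i * (\<Prod>j\<in>UNIV - {i}. M $ j $ p j))"
  have lin: "linear (?D M)" for M
    using has_derivative_det has_derivative_linear by blast
  have D: "((\<lambda>s. det (Y s)) has_real_derivative ?D (Y s) Y') (at s)"
    if "(Y has_vector_derivative Y') (at s)" for Y Y' s
  proof -
    have "((\<lambda>s. det (Y s)) has_derivative (\<lambda>h. ?D (Y s) (h *\<^sub>R Y'))) (at s)"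
      using has_derivative_compose[OF that[unfolded has_vector_derivative_def] has_derivative_det] .
    then show ?thesis
      unfolding linear_cmul[OF lin] by (simp add: has_field_derivative_def mult_commute_abs)
  qed
  have "((\<lambda>s. det (X t + s *\<^sub>R (L ** X t))) has_real_derivative ?D (X t + 0 *\<^sub>R (L ** X t)) (L ** X t)) (at 0)"
    by (rule D) (auto intro!: derivative_eq_intros)
  moreover have "((\<lambda>s. det (mat 1 + s *\<^sub>R L)) has_real_derivative ?D (mat 1 + 0 *\<^sub>R L) L) (at 0)"
    by (rule D) (auto intro!: derivative_eq_intros)
  then have "((\<lambda>s. det (mat 1 + s *\<^sub>R L) * det (X t)) has_real_derivative trace L * det (X t)) (at 0)"
    using det_derivative_mat_1[of L] by (auto intro!: derivative_eq_intros)
  moreover have "det (mat 1 + s *\<^sub>R L) * det (X t) = det (X t + s *\<^sub>R (L ** X t))" for s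
  proof -
    have "(mat 1 + s *\<^sub>R L) ** X t = X t + s *\<^sub>R (L ** X t)"
      by (simp add: matrix_matrix_mult_def vec_eq_iff mat_def distrib_right sum.distrib
          sum_distrib_left mult.assoc if_distrib[of "\<lambda>c. c * _"] cong: if_cong)
    then show ?thesis by (metis det_mul)
  qed
  ultimately have "?D (X t) (L ** X t) = trace L * det (X t)"
    using DERIV_unique by auto
  then show ?thesis using D[OF assms] by simp
qed

section \<open>Local solutions of ordinary differential equations and closed forms\<close>

text \<open>Compactness bounds the derivatives along basis vectors, hence the operator norm;
  convexity of the ball makes this a Lipschitz constant.\<close>

lemma smooth_on_lipschitz_cball:
  fixes F :: "'a::euclidean_space \<Rightarrow> 'b::real_normed_vector"
  assumes "smooth_on S F" "cball y0 r \<subseteq> S"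
  shows "\<exists>L\<ge>0. \<forall>x\<in>cball y0 r. \<forall>y\<in>cball y0 r. norm (F x - F y) \<le> L * norm (x - y)"
proof -
  have "\<exists>C. \<forall>x\<in>cball y0 r. norm (dirD F x b) \<le> C" for b
  proof -
    have "compact ((\<lambda>x. dirD F x b) ` cball y0 r)"
      by (intro compact_continuous_image continuous_on_subset[OF _ assms(2)]
          smooth_on_continuous_on smooth_on_dirD assms(1) compact_cball)
    then show ?thesis
      by (auto simp: bounded_iff dest!: compact_imp_bounded)
  qed
  then obtain C where C: "\<And>b x. x \<in> cball y0 r \<Longrightarrow> norm (dirD F x b) \<le> C b"
    by metis
  have F: "(F has_derivative dirD F x) (at x)" if "x \<in> cball y0 r" for x
    using that assms smooth_on_has_derivative by blast
  have on: "onorm (dirD F x) \<le> (\<Sum>b\<in>Basis. \<bar>C b\<bar>)" if x: "x \<in> cball y0 r" for x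
  proof (rule onorm_le)
    fix u
    have "norm (dirD F x u) = norm (\<Sum>b\<in>Basis. (u \<bullet> b) *\<^sub>R dirD F x b)"
      by (rule arg_cong[OF linear_euclidean_expansion[OF has_derivative_linear[OF F[OF x]]]])
    also have "\<dots> \<le> (\<Sum>b\<in>Basis. norm u * \<bar>C b\<bar>)"
    proof (rule order.trans[OF norm_sum sum_mono])
      fix b :: 'a assume b: "b \<in> Basis"
      have "norm (dirD F x b) \<le> \<bar>C b\<bar>" using C[OF x, of b] by linarith
      then show "norm ((u \<bullet> b) *\<^sub>R dirD F x b) \<le> norm u * \<bar>C b\<bar>"
        using Basis_le_norm[OF b, of u] by (auto intro: mult_mono)
    qed
    finally show "norm (dirD F x u) \<le> (\<Sum>b\<in>Basis. \<bar>C b\<bar>) * norm u"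
      by (simp add: sum_distrib_left mult.commute)
  qed
  have "norm (F x - F y) \<le> (\<Sum>b\<in>Basis. \<bar>C b\<bar>) * norm (x - y)"
    if "x \<in> cball y0 r" "y \<in> cball y0 r" for x y
    by (rule differentiable_bound[OF convex_cball has_derivative_at_withinI[OF F] on that])
  then show ?thesis
    by (intro exI[of _ "\<Sum>b\<in>Basis. \<bar>C b\<bar>"]) (auto intro: sum_nonneg)
qed

text \<open>Contraction principle on bounded continuous functions of the whole line. The integral
  from 0 to t is a difference of two integrals starting at -e, each over a length of at most 2 e.
  The map therefore has Lipschitz constant 4 e L, at most 1/2 by hypothesis, and the same count
  gives the bound 4 e M.\<close>

lemma picard_lindelof_global:
  fixes H :: "'a::euclidean_space \<Rightarrow> 'a"
  assumes L: "\<And>x y. norm (H x - H y) \<le> L * norm (x - y)" "0 \<le> L"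
    and M: "\<And>x. norm (H x) \<le> M"
    and e: "0 < e" "8 * e * L \<le> 1"
  shows "\<exists>y. y 0 = y0 \<and> (\<forall>t\<in>{-e<..<e}. (y has_vector_derivative H (y t)) (at t) \<and>
    norm (y t - y0) \<le> 4 * e * M)"
proof -
  \<comment> \<open>Clamping time to [-e, e] lets the integral operator produce bounded functions on
    the whole line.\<close>
  define p where "p t = max (- e) (min e t)" for t :: real
  have p: "p t \<in> {-e..e}" for t using e(1) by (auto simp: p_def)
  have pc: "continuous_on UNIV p" unfolding p_def by (intro continuous_intros)
  have M0: "0 \<le> M" using M norm_ge_zero order.trans by blast
  have Hc: "continuous_on UNIV H"
    by (rule lipschitz_on_continuous_on[of L]) (use L in \<open>auto simp: lipschitz_on_def dist_norm\<close>)
  define h where "h y t = H (apply_bcontfun y t)" for y :: "real \<Rightarrow>\<^sub>C 'a" and t :: real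
  have hc: "continuous_on T (h y)" for T y
    unfolding h_def by (rule continuous_on_compose2[OF Hc]) auto
  define \<Phi> where "\<Phi> y t = y0 + (integral {-e..p t} (h y) - integral {-e..0} (h y))" for y t
  have B: "norm (integral {-e..s} f) \<le> C * (2 * e)"
    if "s \<in> {-e..e}" "continuous_on UNIV f" "\<And>t. norm (f t) \<le> C" for s C and f :: "real \<Rightarrow> 'a"
  proof -
    have "0 \<le> C" using that(3) norm_ge_zero order.trans by blast
    have "norm (integral {-e..s} f) \<le> C * (s - (-e))"
      using that by (intro integral_bound) (auto intro: continuous_on_subset)
    also have "\<dots> \<le> C * (2 * e)" using that(1) \<open>0 \<le> C\<close> by (intro mult_left_mono) auto
    finally show ?thesis .
  qed
  have bd: "norm (\<Phi> y t - y0) \<le> 4 * e * M" for y t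
  proof -
    have "norm (\<Phi> y t - y0) \<le> norm (integral {-e..p t} (h y)) + norm (integral {-e..0} (h y))"
      by (simp add: \<Phi>_def norm_triangle_ineq4)
    also have "\<dots> \<le> M * (2 * e) + M * (2 * e)"
      using e(1) p M by (intro add_mono B hc) (auto simp: h_def)
    finally show ?thesis by (simp add: mult_ac)
  qed
  have "\<Phi> y \<in> bcontfun" for y
  proof (rule bcontfun_normI)
    have "continuous_on {-e..e} (\<lambda>s. integral {-e..s} (h y))"
      by (intro indefinite_integral_continuous_1 integrable_continuous_real hc)
    then have "continuous_on UNIV (\<lambda>t. integral {-e..p t} (h y))"
      by (rule continuous_on_compose2[OF _ pc]) (use p in auto)
    then show "continuous_on UNIV (\<Phi> y)"
      unfolding \<Phi>_def by (intro continuous_intros)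
    show "norm (\<Phi> y t) \<le> norm y0 + 4 * e * M" for t
      using bd[of y t] norm_triangle_sub[of "\<Phi> y t" y0] by linarith
  qed
  then have ap: "apply_bcontfun (Bcontfun (\<Phi> y)) = \<Phi> y" for y
    by (simp add: Bcontfun_inverse)
  have "dist (Bcontfun (\<Phi> y)) (Bcontfun (\<Phi> z)) \<le> (1 / 2) * dist y z" for y z
  proof (rule dist_bound)
    fix t
    define k where "k s = h y s - h z s" for s
    have kc: "continuous_on T k" for T unfolding k_def by (intro continuous_intros hc)
    have kb: "norm (k s) \<le> L * dist y z" for s
    proof -
      have "norm (k s) \<le> L * norm (apply_bcontfun y s - apply_bcontfun z s)"
        unfolding k_def h_def by (rule L(1))
      also have "\<dots> \<le> L * dist y z"
        using dist_bounded[of y s z] by (intro mult_left_mono L(2)) (simp add: dist_norm)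
      finally show ?thesis .
    qed
    have int: "integral {-e..s} k = integral {-e..s} (h y) - integral {-e..s} (h z)" for s
      unfolding k_def by (intro integral_diff integrable_continuous_real hc)
    have "dist (\<Phi> y t) (\<Phi> z t) = norm (integral {-e..p t} k - integral {-e..0} k)"
      by (simp add: \<Phi>_def dist_norm int algebra_simps)
    also have "\<dots> \<le> norm (integral {-e..p t} k) + norm (integral {-e..0} k)"
      by (rule norm_triangle_ineq4)
    also have "\<dots> \<le> L * dist y z * (2 * e) + L * dist y z * (2 * e)"
      using e(1) p by (intro add_mono B kc kb) auto
    also have "\<dots> = (8 * e * L) * (dist y z / 2)" by simp
    also have "\<dots> \<le> 1 * (dist y z / 2)" by (intro mult_right_mono e) auto
    finally show "dist (apply_bcontfun (Bcontfun (\<Phi> y)) t) (apply_bcontfun (Bcontfun (\<Phi> z)) t) \<le> (1 / 2) * dist y z"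
      by (simp add: ap)
  qed
  then obtain y where "Bcontfun (\<Phi> y) = y"
    using banach_fix_type[of "1/2" "\<lambda>y. Bcontfun (\<Phi> y)"] by auto
  then have y: "apply_bcontfun y = \<Phi> y" using ap by metis
  have "(apply_bcontfun y has_vector_derivative H (apply_bcontfun y t)) (at t)" if t: "t \<in> {-e<..<e}" for t
  proof -
    have "((\<lambda>u. integral {-e..u} (h y)) has_vector_derivative h y t) (at t within {-e..e})"
      using t by (intro integral_has_vector_derivative hc) auto
    then have "((\<lambda>u. integral {-e..u} (h y)) has_vector_derivative h y t) (at t)"
      using t at_within_interior[of t "{-e..e}"] by (simp add: interior_atLeastAtMost_real)
    then have "((\<lambda>u. y0 + (integral {-e..u} (h y) - integral {-e..0} (h y))) has_vector_derivative h y t) (at t)"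
      by (auto intro!: derivative_eq_intros)
    then have "(\<Phi> y has_vector_derivative h y t) (at t)"
      by (rule has_vector_derivative_transform_within_open[of _ _ _ "{-e<..<e}"])
        (use t in \<open>auto simp: \<Phi>_def p_def\<close>)
    then show ?thesis unfolding h_def y[symmetric] .
  qed
  moreover have "apply_bcontfun y 0 = y0"
    using e(1) by (simp add: y \<Phi>_def p_def)
  ultimately show ?thesis
    using bd[of y] y by (intro exI[of _ "apply_bcontfun y"]) auto
qed

text \<open>Composition with the nearest-point projection onto a closed ball makes the field
  globally bounded and Lipschitz. For short times the solution stays in the ball, where the
  projection is the identity. Smoothness is a bootstrap: if y is C^k, then so is its derivative
  \<open>F (y t)\<close>.\<close>

theorem ode_local_existence:
  fixes F :: "'a::euclidean_space \<Rightarrow> 'a"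
  assumes "open S" "y0 \<in> S" "smooth_on S F"
  obtains e y where "0 < e" "y 0 = y0" "y ` {-e<..<e} \<subseteq> S" "smooth_on {-e<..<e} y"
    "\<And>t. t \<in> {-e<..<e} \<Longrightarrow> (y has_vector_derivative F (y t)) (at t)"
proof -
  obtain r where r: "0 < r" "cball y0 r \<subseteq> S"
    using assms(1,2) open_contains_cball by blast
  obtain L where L: "0 \<le> L" "\<And>x y. x \<in> cball y0 r \<Longrightarrow> y \<in> cball y0 r \<Longrightarrow> norm (F x - F y) \<le> L * norm (x - y)"
    using smooth_on_lipschitz_cball[OF assms(3) r(2)] by blast
  have "compact (F ` cball y0 r)"
    by (intro compact_continuous_image continuous_on_subset[OF _ r(2)]
        smooth_on_continuous_on assms(3) compact_cball)
  then obtain M where M: "\<And>x. x \<in> cball y0 r \<Longrightarrow> norm (F x) \<le> M"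
    using compact_imp_bounded by (fastforce simp: bounded_iff)
  have M0: "0 \<le> M" using M[of y0] r(1) norm_ge_zero[of "F y0"] by (simp del: norm_ge_zero)
  define c where "c = closest_point (cball y0 r)"
  have c: "c x \<in> cball y0 r" for x
    unfolding c_def using r(1) by (intro closest_point_in_set) auto
  have cd: "dist (c x) (c y) \<le> dist x y" for x y
    unfolding c_def using r(1) by (intro closest_point_lipschitz) auto
  \<comment> \<open>The first bound makes the Picard map a contraction, the second keeps the
    solution within radius \<open>r\<close>; adding 1 guards against L = 0 or M = 0.\<close>
  define e where "e = min (1 / (8 * (L + 1))) (r / (4 * (M + 1)))"
  have e0: "0 < e" using L(1) M0 r(1) by (simp add: e_def)
  have e1: "8 * e * L \<le> 1"
  proof -
    have "e \<le> 1 / (8 * (L + 1))" by (simp add: e_def)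
    then have "8 * e * (L + 1) \<le> 1" using L(1) by (simp add: field_simps)
    then show ?thesis using e0 by (simp add: distrib_left)
  qed
  have e2: "4 * e * M \<le> r"
  proof -
    have "e \<le> r / (4 * (M + 1))" by (simp add: e_def)
    then have "4 * e * (M + 1) \<le> r" using M0 by (simp add: field_simps)
    then show ?thesis using e0 by (simp add: distrib_left)
  qed
  have "norm (F (c x) - F (c y)) \<le> L * norm (x - y)" for x y
    using L(2)[OF c c, of x y] mult_left_mono[OF cd[of x y] L(1)] by (simp add: dist_norm)
  then obtain y where y: "y 0 = y0"
    "\<And>t. t \<in> {-e<..<e} \<Longrightarrow> (y has_vector_derivative F (c (y t))) (at t)"
    "\<And>t. t \<in> {-e<..<e} \<Longrightarrow> norm (y t - y0) \<le> 4 * e * M"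
    using picard_lindelof_global[of "\<lambda>x. F (c x)" L M e y0] L(1) M[OF c] e0 e1 by blast
  have yb: "y t \<in> cball y0 r" if "t \<in> {-e<..<e}" for t
    using y(3)[OF that] e2 by (simp add: dist_norm norm_minus_commute)
  have yd: "(y has_vector_derivative F (y t)) (at t)" if "t \<in> {-e<..<e}" for t
    using y(2)[OF that] closest_point_self[OF yb[OF that]] by (simp add: c_def)
  have yS: "y ` {-e<..<e} \<subseteq> S" using yb r(2) by auto
  have "Ck_on k {-e<..<e} y" for k
  proof (induction k)
    case 0
    have "continuous_on {-e<..<e} y"
      by (rule continuous_at_imp_continuous_on) (use yd has_vector_derivative_continuous in blast)
    then show ?case by simp
  next
    case (Suc k)
    show ?case
    proof (rule Ck_on_SucI)
      show "(y has_derivative (\<lambda>h. h *\<^sub>R F (y t))) (at t)" if "t \<in> {-e<..<e}" for t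
        using yd[OF that] by (simp add: has_vector_derivative_def)
      show "Ck_on k {-e<..<e} (\<lambda>t. v *\<^sub>R F (y t))" for v
        using assms(3) by (intro Ck_on_bounded_linear[OF bounded_linear_scaleR_right]
          Ck_on_compose[OF _ assms(1) yS _ Suc]) (auto simp: smooth_on_def)
    qed auto
  qed
  then show ?thesis
    using that[OF e0 y(1) yS _ yd] by (auto simp: smooth_on_def)
qed

text \<open>The primitive integrates a along segments from the centre. After differentiation under
  the integral sign, closedness turns the integrand into the t-derivative of t a(z + t (x - z)) u,
  whose integral over [0, 1] is a(x) u.\<close>

theorem poincare_lemma_ball:
  fixes a :: "'a::euclidean_space \<Rightarrow> 'a \<Rightarrow> real"
  assumes lin: "\<And>x. x \<in> ball z r \<Longrightarrow> linear (a x)"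
    and smooth: "\<And>u. smooth_on (ball z r) (\<lambda>x. a x u)"
    and closed: "\<And>x u v. x \<in> ball z r \<Longrightarrow> dirD (\<lambda>y. a y v) x u = dirD (\<lambda>y. a y u) x v"
  obtains F where "\<And>x. x \<in> ball z r \<Longrightarrow> (F has_derivative a x) (at x)"
proof
  define q where "q x t = z + t *\<^sub>R (x - z)" for x :: 'a and t :: real
  have q: "q x t \<in> ball z r" if "x \<in> ball z r" "t \<in> {0..1}" for x t
  proof -
    have "dist z (q x t) \<le> dist z x"
      using that by (auto simp: q_def dist_norm norm_minus_commute abs_mult mult_left_le_one_le)
    then show ?thesis using that(1) by simp
  qed
  define f' where "f' x t u = t * dirD (\<lambda>y. a y (x - z)) (q x t) u + a (q x t) u" for x t u
  note diff = smooth_on_differentiable[OF smooth]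
  have f: "((\<lambda>x. a (q x t) (x - z)) has_derivative f' x t) (at x)"
    if x: "x \<in> ball z r" and t: "t \<in> {0..1}" for x t
  proof -
    let ?S = "(\<lambda>x. q x t) -` ball z r"
    have qd: "((\<lambda>x. q x t) has_derivative (\<lambda>u. t *\<^sub>R u)) (at x)"
      unfolding q_def by (auto intro!: derivative_eq_intros)
    have "open ?S"
      unfolding q_def by (intro open_vimage continuous_intros) auto
    moreover have ad: "((\<lambda>x. a (q x t) w) has_derivative (\<lambda>u. dirD (\<lambda>y. a y w) (q x t) (t *\<^sub>R u))) (at x)" for w
      by (rule has_derivative_compose[OF qd smooth_on_has_derivative[OF smooth q[OF x t]]])
    moreover have "((\<lambda>x. x - z) has_derivative (\<lambda>u. u)) (at x)"
      by (auto intro!: derivative_eq_intros)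
    ultimately have "((\<lambda>x. a (q x t) (x - z)) has_derivative
        (\<lambda>u. dirD (\<lambda>y. a (q y t) (x - z)) x u + a (q x t) u)) (at x)"
      using q[OF x t] by (intro has_derivative_linear_family[of ?S]) (auto simp: differentiable_def intro!: lin)
    then show ?thesis
      by (simp add: f'_def[abs_def] dirD_eqI[OF ad]
          linear_cmul[OF linear_frechet_derivative[OF diff[OF q[OF x t]]]])
  qed
  have qc: "continuous_on (ball z r \<times> {0..1}) (\<lambda>p. q (fst p) (snd p))"
    unfolding q_def by (intro continuous_intros)
  have comp: "continuous_on (ball z r \<times> {0..1}) (\<lambda>p. k (q (fst p) (snd p)))"
    if "smooth_on (ball z r) k" for k :: "'a \<Rightarrow> real"
    by (rule continuous_on_compose2[OF smooth_on_continuous_on[OF that] qc]) (auto intro: q[simplified])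
  \<comment> \<open>Differentiation under the integral needs continuity jointly in x and t. The
    argument x - z of \<open>a\<close> moves with x, so it is expanded in the basis first.\<close>
  have f'_exp: "f' x t u = t * (\<Sum>b\<in>Basis. ((x - z) \<bullet> b) * dirD (\<lambda>y. a y b) (q x t) u) + a (q x t) u"
    if x: "x \<in> ball z r" and t: "t \<in> {0..1}" for x t u
  proof -
    have "linear (\<lambda>w. dirD (\<lambda>y. a y w) (q x t) u)"
      by (rule linear_dirD_linear_family[of "ball z r"]) (use q[OF x t] in \<open>auto intro!: lin diff\<close>)
    from linear_euclidean_expansion[OF this, of "x - z"] show ?thesis
      by (simp add: f'_def)
  qed
  have f'_cont: "continuous_on (ball z r \<times> {0..1}) (\<lambda>p. f' (fst p) (snd p) u)" for u
  proof -
    have "continuous_on (ball z r \<times> {0..1}) (\<lambda>p. snd p * (\<Sum>b\<in>Basis. ((fst p - z) \<bullet> b) *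
        dirD (\<lambda>y. a y b) (q (fst p) (snd p)) u) + a (q (fst p) (snd p)) u)"
      by (intro continuous_intros comp smooth_on_dirD smooth)
    then show ?thesis
      by (rule continuous_on_eq) (auto simp: f'_exp)
  qed
  have bl: "blinfun_apply (Blinfun (f' x t)) = f' x t" if "x \<in> ball z r" "t \<in> {0..1}" for x t
    using has_derivative_bounded_linear[OF f[OF that]] by (rule bounded_linear_Blinfun_apply)
  fix x assume x: "x \<in> ball z r"
  have "((\<lambda>x. integral (cbox 0 1) (\<lambda>t. a (q x t) (x - z))) has_derivative
      blinfun_apply (integral (cbox 0 1) (\<lambda>t. Blinfun (f' x t)))) (at x within ball z r)"
  proof (rule leibniz_rule)
    show "((\<lambda>x. a (q x t) (x - z)) has_derivative blinfun_apply (Blinfun (f' x t))) (at x within ball z r)"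
      if "x \<in> ball z r" "t \<in> cbox 0 1" for x t
      using f[of x t] bl[of x t] that by (auto intro: has_derivative_at_withinI)
    show "(\<lambda>t. a (q x t) (x - z)) integrable_on cbox 0 1" if "x \<in> ball z r" for x
    proof (rule integrable_continuous)
      have "continuous_on {0..1} (q x)" unfolding q_def by (intro continuous_intros)
      then show "continuous_on (cbox 0 1) (\<lambda>t. a (q x t) (x - z))"
        by (intro continuous_on_compose2[OF smooth_on_continuous_on[OF smooth], of "cbox 0 1" "q x"])
          (use q[OF that] in auto)
    qed
    have "continuous_on (ball z r \<times> {0..1}) (\<lambda>p. Blinfun (f' (fst p) (snd p)))"
    proof (rule continuous_on_blinfun_componentwise)
      fix b :: 'a
      show "continuous_on (ball z r \<times> {0..1}) (\<lambda>p. blinfun_apply (Blinfun (f' (fst p) (snd p))) b)"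
        by (rule continuous_on_eq[OF f'_cont[of b]]) (auto simp: bl)
    qed
    then show "continuous_on (ball z r \<times> cbox 0 1) (\<lambda>(x, t). Blinfun (f' x t))"
      by (simp add: case_prod_unfold)
  qed (use x in auto)
  moreover have "blinfun_apply (integral {0..1} (\<lambda>t. Blinfun (f' x t))) u = a x u" for u
  proof -
    have cont: "continuous_on {0..1} (\<lambda>t. Blinfun (f' x t))"
    proof (rule continuous_on_blinfun_componentwise)
      fix b :: 'a
      have "continuous_on {0..1} (\<lambda>t. f' x t b)"
        using continuous_on_compose2[OF f'_cont[of b], of "{0..1}" "\<lambda>t. (x, t)"] x
        by (simp add: image_subset_iff continuous_on_Pair)
      then show "continuous_on {0..1} (\<lambda>t. blinfun_apply (Blinfun (f' x t)) b)"
        by (rule continuous_on_eq) (simp add: bl[OF x])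
    qed
    have "blinfun_apply (integral {0..1} (\<lambda>t. Blinfun (f' x t))) u
        = integral {0..1} (\<lambda>t. blinfun_apply (Blinfun (f' x t)) u)"
      by (rule blinfun_apply_integral) (intro integrable_continuous_real cont)
    also have "\<dots> = integral {0..1} (\<lambda>t. f' x t u)"
      by (rule integral_cong) (simp add: bl[OF x])
    also have "\<dots> = 1 * a (q x 1) u - 0 * a (q x 0) u"
    proof (rule integral_unique, rule fundamental_theorem_of_calculus)
      fix t :: real assume t: "t \<in> {0..1}"
      have "((\<lambda>t. q x t) has_derivative (\<lambda>h. h *\<^sub>R (x - z))) (at t)"
        unfolding q_def by (auto intro!: derivative_eq_intros)
      from has_derivative_compose[OF this smooth_on_has_derivative[OF smooth q[OF x t]]]
      have "((\<lambda>t. a (q x t) u) has_derivative (\<lambda>h. h * dirD (\<lambda>y. a y u) (q x t) (x - z))) (at t)"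
        by (simp add: linear_cmul[OF linear_frechet_derivative[OF diff[OF q[OF x t]]]])
      then have "((\<lambda>t. a (q x t) u) has_real_derivative dirD (\<lambda>y. a y u) (q x t) (x - z)) (at t)"
        by (simp add: has_field_derivative_def mult_commute_abs)
      \<comment> \<open>Closedness exchanges u with x - z and makes \<open>f'\<close> an exact
        derivative in t.\<close>
      then have "((\<lambda>t. t * a (q x t) u) has_real_derivative f' x t u) (at t)"
        unfolding f'_def closed[OF q[OF x t], of "x - z" u]
        by (auto intro!: derivative_eq_intros)
      then show "((\<lambda>t. t * a (q x t) u) has_vector_derivative f' x t u) (at t within {0..1})"
        by (simp add: has_real_derivative_iff_has_vector_derivative has_vector_derivative_at_within)
    qed auto
    finally show ?thesis by (simp add: q_def)
  qed
  then have "blinfun_apply (integral (cbox 0 1) (\<lambda>t. Blinfun (f' x t))) = a x"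
    by auto
  ultimately show "((\<lambda>x. integral (cbox 0 1) (\<lambda>t. a (q x t) (x - z))) has_derivative a x) (at x)"
    by (simp only: at_within_open[OF x open_ball])
qed

section \<open>Connections and one-forms on an open set\<close>

lemma smooth_on_Pair:
  fixes f :: "'a::real_normed_vector \<Rightarrow> 'b::real_normed_vector" and g :: "'a \<Rightarrow> 'c::real_normed_vector"
  assumes "open S" "smooth_on S f" "smooth_on S g"
  shows "smooth_on S (\<lambda>x. (f x, g x))"
proof -
  have l: "bounded_linear (\<lambda>v :: 'b. (v, 0 :: 'c))" "bounded_linear (\<lambda>v :: 'c. (0 :: 'b, v))"
    by (intro bounded_linear_Pair bounded_linear_ident bounded_linear_zero)+
  have "smooth_on S (\<lambda>x. (f x, 0) + (0, g x))"
    by (intro smooth_on_add smooth_on_bounded_linear[OF l(1)] smooth_on_bounded_linear[OF l(2)] assms)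
  then show ?thesis by simp
qed

lemma smooth_on_vec_lambda:
  fixes f :: "'n::finite \<Rightarrow> 'a::real_normed_vector \<Rightarrow> 'b::euclidean_space"
  assumes "open S" "\<And>j. smooth_on S (f j)"
  shows "smooth_on S (\<lambda>x. \<chi> j. f j x)"
proof -
  have "linear (axis j :: 'b \<Rightarrow> 'b ^ 'n)" for j
    by (rule linearI) (auto simp: axis_def vec_eq_iff)
  then have "bounded_linear (axis j :: 'b \<Rightarrow> 'b ^ 'n)" for j
    by (simp add: linear_conv_bounded_linear)
  then have "smooth_on S (\<lambda>x. axis j (f j x))" for j
    using smooth_on_bounded_linear[OF _ assms(1) assms(2)] by blast
  then have "smooth_on S (\<lambda>x. \<Sum>j\<in>UNIV. axis j (f j x))"
    by (intro smooth_on_sum assms(1))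
  moreover have "(\<Sum>j\<in>UNIV. axis j (f j x)) = (\<chi> j. f j x)" for x
    by (simp add: vec_eq_iff axis_def if_distrib cong: if_cong)
  ultimately show ?thesis by simp
qed

lemma smooth_on_power:
  fixes f :: "'a::real_normed_vector \<Rightarrow> real"
  assumes "open S" "smooth_on S f"
  shows "smooth_on S (\<lambda>x. f x ^ n)"
  by (induction n) (auto intro: smooth_on_const smooth_on_mult assms)

definition one_form_on :: "'a::euclidean_space set \<Rightarrow> ('a \<Rightarrow> 'a \<Rightarrow> real) \<Rightarrow> bool" where
  "one_form_on U a \<longleftrightarrow> (\<forall>x\<in>U. linear (a x)) \<and> (\<forall>u. smooth_on U (\<lambda>x. a x u))"

text \<open>The target type is left open so that one notion covers both metrics and Christoffel
  symbols.\<close>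

definition bilinear_field_on ::
  "'a::euclidean_space set \<Rightarrow> ('a \<Rightarrow> 'a \<Rightarrow> 'a \<Rightarrow> 'b::real_normed_vector) \<Rightarrow> bool" where
  "bilinear_field_on U D \<longleftrightarrow> (\<forall>x\<in>U. bilinear (D x)) \<and> (\<forall>u v. smooth_on U (\<lambda>x. D x u v))"

definition curv :: "('a::euclidean_space \<Rightarrow> 'a \<Rightarrow> 'a \<Rightarrow> 'a) \<Rightarrow> 'a \<Rightarrow> 'a \<Rightarrow> 'a \<Rightarrow> 'a \<Rightarrow> 'a" where
  "curv D x u v w = dirD (\<lambda>y. D y v w) x u + D x u (D x v w)
     - (dirD (\<lambda>y. D y u w) x v + D x v (D x u w))"

text \<open>This is the covariant derivative (D_u a)(v). For symmetric \<open>D\<close> its symmetry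
  in u and v says da = 0, and for a = df it is the Hessian of f.\<close>

definition cov_form ::
  "('a::euclidean_space \<Rightarrow> 'a \<Rightarrow> 'a \<Rightarrow> 'a) \<Rightarrow> ('a \<Rightarrow> 'a \<Rightarrow> real) \<Rightarrow> 'a \<Rightarrow> 'a \<Rightarrow> 'a \<Rightarrow> real" where
  "cov_form D a x u v = dirD (\<lambda>y. a y v) x u - a x (D x u v)"

text \<open>\<open>(D\<^sub>u Q)(v,w) - (D\<^sub>v Q)(u,w)\<close> for a symmetric connection, in which the two terms
  \<open>Q(D(u,v),w)\<close> cancel.\<close>

definition codazzi ::
  "('a::euclidean_space \<Rightarrow> 'a \<Rightarrow> 'a \<Rightarrow> 'a) \<Rightarrow> ('a \<Rightarrow> 'a \<Rightarrow> 'a \<Rightarrow> real) \<Rightarrow> 'a \<Rightarrow> 'a \<Rightarrow> 'a \<Rightarrow> 'a \<Rightarrow> real" where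
  "codazzi D Q x u v w = dirD (\<lambda>y. Q y v w) x u - dirD (\<lambda>y. Q y u w) x v
     - Q x v (D x u w) + Q x u (D x v w)"

lemma smooth_on_bilinear_field:
  fixes D :: "'x::real_normed_vector \<Rightarrow> 'a::euclidean_space \<Rightarrow> 'b::euclidean_space \<Rightarrow> 'c::real_normed_vector"
  assumes "open S" "\<And>x. x \<in> S \<Longrightarrow> bilinear (D x)" "\<And>u v. smooth_on S (\<lambda>x. D x u v)"
    and "smooth_on S h" "smooth_on S k"
  shows "smooth_on S (\<lambda>x. D x (h x) (k x))"
proof (rule smooth_on_linear_family[OF assms(1) _ _ assms(5)])
  show "linear (D x (h x))" if "x \<in> S" for x
    using assms(2)[OF that] by (simp add: bilinear_def)
  show "smooth_on S (\<lambda>x. D x (h x) v)" for v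
    by (rule smooth_on_linear_family[OF assms(1) _ _ assms(4), of "\<lambda>x u. D x u v"])
      (use assms(2,3) in \<open>auto simp: bilinear_def\<close>)
qed

lemma has_derivative_one_form_field:
  assumes "open U" "x \<in> U" "one_form_on U a" "(h has_derivative h') (at x)"
  shows "((\<lambda>y. a y (h y)) has_derivative (\<lambda>u. dirD (\<lambda>y. a y (h x)) x u + a x (h' u))) (at x)"
  using assms(3) by (intro has_derivative_linear_family[OF assms(1,2) _ _ assms(4)])
    (auto simp: one_form_on_def intro: smooth_on_differentiable assms(2))

lemma one_form_on_cov_smooth:
  assumes "open U" "one_form_on U a" "bilinear_field_on U D"
  shows "smooth_on U (\<lambda>x. cov_form D a x u v)"
proof -
  have "smooth_on U (\<lambda>x. a x (D x u v))"
    by (rule smooth_on_linear_family[OF assms(1)])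
      (use assms(2,3) in \<open>auto simp: one_form_on_def bilinear_field_on_def\<close>)
  moreover have "smooth_on U (\<lambda>x. dirD (\<lambda>y. a y v) x u)"
    using assms(2) by (simp add: one_form_on_def smooth_on_dirD)
  ultimately show ?thesis
    unfolding cov_form_def by (intro smooth_on_diff assms(1))
qed

section \<open>Ricci and Codazzi identities, projective change of curvature\<close>

text \<open>Ricci identity. Second derivatives of a cancel by symmetry, first derivatives cancel
  against the correction terms of \<open>codazzi\<close>, and a applied to the curvature
  remains.\<close>

lemma codazzi_cov_form:
  assumes U: "open U" "x \<in> U" and a: "one_form_on U a" and D: "bilinear_field_on U D"
  shows "codazzi D (cov_form D a) x u v w = - a x (curv D x u v w)"
proof -
  have *: "dirD (\<lambda>y. cov_form D a y v w) x u = dirD (\<lambda>y. dirD (\<lambda>z. a z w) y v) x u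
      - (dirD (\<lambda>y. a y (D x v w)) x u + a x (dirD (\<lambda>y. D y v w) x u))" for u v w
    unfolding cov_form_def using a D U(2)
    by (intro dirD_eqI[OF has_derivative_diff] has_derivative_one_form_field[OF U a]
        smooth_on_has_derivative[of U] smooth_on_dirD)
      (auto simp: one_form_on_def bilinear_field_on_def)
  have "linear (a x)" using a U(2) by (simp add: one_form_on_def)
  moreover have "dirD (\<lambda>y. dirD (\<lambda>z. a z w) y v) x u = dirD (\<lambda>y. dirD (\<lambda>z. a z w) y u) x v"
    by (rule second_derivative_symmetric[OF U]) (use a in \<open>simp add: one_form_on_def\<close>)
  ultimately show ?thesis
    unfolding codazzi_def * by (simp add: cov_form_def curv_def linear_add linear_diff)
qed

text \<open>The product rule leaves da(u, v) a(w), which vanishes for closed a; the other terms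
  combine into covariant derivatives.\<close>

lemma codazzi_square:
  assumes "x \<in> U" and a: "one_form_on U a" and sym: "\<And>u v. D x u v = D x v u"
    and closed: "\<And>u v. cov_form D a x u v = cov_form D a x v u"
  shows "codazzi D (\<lambda>y u v. a y u * a y v) x u v w
    = a x v * cov_form D a x u w - a x u * cov_form D a x v w"
proof -
  have *: "dirD (\<lambda>y. a y v * a y w) x u = a x v * dirD (\<lambda>y. a y w) x u + dirD (\<lambda>y. a y v) x u * a x w" for u v w
    using a assms(1)
    by (intro dirD_eqI[OF has_derivative_mult] smooth_on_has_derivative[of U])
      (auto simp: one_form_on_def)
  have "dirD (\<lambda>y. a y v) x u = dirD (\<lambda>y. a y u) x v"
    using closed[of u v] by (simp add: cov_form_def sym[of u v])
  then show ?thesis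
    unfolding codazzi_def * by (simp add: cov_form_def algebra_simps)
qed

lemma codazzi_diff:
  assumes "x \<in> U" "\<And>u v. smooth_on U (\<lambda>y. P y u v)" "\<And>u v. smooth_on U (\<lambda>y. Q y u v)"
  shows "codazzi D (\<lambda>y u v. P y u v - Q y u v) x u v w = codazzi D P x u v w - codazzi D Q x u v w"
proof -
  have "dirD (\<lambda>y. P y v w - Q y v w) x u = dirD (\<lambda>y. P y v w) x u - dirD (\<lambda>y. Q y v w) x u" for u v w
    by (intro dirD_eqI[OF has_derivative_diff] smooth_on_has_derivative[of U] assms)
  then show ?thesis by (simp add: codazzi_def)
qed

lemma codazzi_scale:
  assumes "x \<in> U" "smooth_on U l" "\<And>u v. smooth_on U (\<lambda>y. Q y u v)"
  shows "codazzi D (\<lambda>y u v. l y * Q y u v) x u v w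
    = dirD l x u * Q x v w - dirD l x v * Q x u w + l x * codazzi D Q x u v w"
proof -
  have "dirD (\<lambda>y. l y * Q y v w) x u = l x * dirD (\<lambda>y. Q y v w) x u + dirD l x u * Q x v w" for u v w
    by (intro dirD_eqI[OF has_derivative_mult] smooth_on_has_derivative[of U] assms)
  then show ?thesis by (simp add: codazzi_def algebra_simps)
qed

lemma codazzi_cong:
  assumes "open U" "x \<in> U" "\<And>y u v. y \<in> U \<Longrightarrow> P y u v = Q y u v"
  shows "codazzi D P x u v w = codazzi D Q x u v w"
proof -
  have "dirD (\<lambda>y. P y u w) x = dirD (\<lambda>y. Q y u w) x" for u
    by (rule dirD_cong[OF assms(1,2)]) (rule assms(3))
  then show ?thesis by (simp add: codazzi_def assms(2,3))
qed

text \<open>Closedness removes the component da(u, v) w. Among the terms quadratic in a, those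
  surviving antisymmetrization in u and v turn Da into Da - a \<otimes> a.\<close>

lemma curv_projective_change:
  assumes U: "open U" "x \<in> U" and a: "one_form_on U a" and D: "bilinear_field_on U D"
    and sym: "\<And>u v. D x u v = D x v u"
    and closed: "\<And>u v. cov_form D a x u v = cov_form D a x v u"
    and G: "\<And>y u v. y \<in> U \<Longrightarrow> G y u v = D y u v + (a y u *\<^sub>R v + a y v *\<^sub>R u)"
  shows "curv G x u v w = curv D x u v w
    + ((cov_form D a x u w - a x u * a x w) *\<^sub>R v - (cov_form D a x v w - a x v * a x w) *\<^sub>R u)"
proof -
  have l: "linear (a x)" and bl: "bilinear (D x)"
    using a D U(2) by (auto simp: one_form_on_def bilinear_field_on_def)
  have *: "dirD (\<lambda>y. G y v w) x u = dirD (\<lambda>y. D y v w) x u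
      + (dirD (\<lambda>y. a y v) x u *\<^sub>R w + dirD (\<lambda>y. a y w) x u *\<^sub>R v)" for u v w
  proof -
    have "dirD (\<lambda>y. D y v w + (a y v *\<^sub>R w + a y w *\<^sub>R v)) x u = dirD (\<lambda>y. D y v w) x u
        + (dirD (\<lambda>y. a y v) x u *\<^sub>R w + dirD (\<lambda>y. a y w) x u *\<^sub>R v)"
      using a D U(2)
      by (intro dirD_eqI[OF has_derivative_add] has_derivative_add has_derivative_scaleR_left
          smooth_on_has_derivative[of U])
        (auto simp: one_form_on_def bilinear_field_on_def)
    then show ?thesis
      using dirD_cong[OF U, of "\<lambda>y. G y v w" "\<lambda>y. D y v w + (a y v *\<^sub>R w + a y w *\<^sub>R v)"] G by simp
  qed
  have c: "dirD (\<lambda>y. a y v) x u = dirD (\<lambda>y. a y u) x v"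
    using closed[of u v] by (simp add: cov_form_def sym[of u v])
  have GG: "G x u (G x v w) = D x u (D x v w) + a x v *\<^sub>R D x u w + a x w *\<^sub>R D x u v
      + a x u *\<^sub>R (D x v w + a x v *\<^sub>R w + a x w *\<^sub>R v)
      + (a x (D x v w) + a x v * a x w + a x v * a x w) *\<^sub>R u" for u v w
    by (simp add: G[OF U(2)] bilinear_radd[OF bl] bilinear_rmul[OF bl] linear_add[OF l] linear_cmul[OF l]
        algebra_simps)
  have two: "(2 * r) *\<^sub>R u = r *\<^sub>R u + r *\<^sub>R u" for r and u :: 'a
    by (simp flip: scaleR_left_distrib)
  show ?thesis
    unfolding curv_def * GG c cov_form_def sym[of v u]
    by (simp add: algebra_simps two)
qed


text \<open>The span of u has dimension at most 1. Only the coefficient of v is claimed to vanish: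
  this makes sense also for u = 0 and is the coefficient read off in the applications.\<close>

lemma exists_independent_vector:
  fixes u :: "'a::euclidean_space"
  assumes "2 \<le> DIM('a)"
  shows "\<exists>v. \<forall>a b. a *\<^sub>R u + b *\<^sub>R v = 0 \<longrightarrow> b = 0"
proof -
  have "dim (span {u}) < DIM('a)"
    using assms dim_le_card'[of "{u}"] by (simp add: dim_span)
  then have "span {u} \<noteq> UNIV"
    using dim_UNIV[where 'a = 'a] by (metis less_irrefl)
  then obtain v where v: "v \<notin> span {u}" by blast
  have "b = 0" if "a *\<^sub>R u + b *\<^sub>R v = 0" for a b
  proof (rule ccontr)
    assume "b \<noteq> 0"
    have "b *\<^sub>R v = (- a) *\<^sub>R u" using that by (simp add: eq_neg_iff_add_eq_0 add.commute)
    then have "b *\<^sub>R v \<in> span {u}"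
      by (metis span_scale span_base singletonI)
    then show False using v \<open>b \<noteq> 0\<close> span_scale[of "b *\<^sub>R v" "{u}" "inverse b"] by simp
  qed
  then show ?thesis by blast
qed

text \<open>The Codazzi equation of a Hessian metric \<open>g\<close> and the Ricci identity for \<open>a\<close> leave
  \<open>\<beta>(u) g(v,w) = \<beta>(v) g(u,w)\<close> for \<open>\<beta> = dl - l a\<close>, which forces \<open>\<beta> = 0\<close> in dimension at least \<open>2\<close>.\<close>

lemma conformal_factor_derivative:
  fixes a :: "'a::euclidean_space \<Rightarrow> 'a \<Rightarrow> real"
  assumes U: "open U" "x \<in> U" and a: "one_form_on U a" and D: "bilinear_field_on U D"
    and sym: "\<And>u v. D x u v = D x v u"
    and flat: "\<And>u v w. curv D x u v w = 0"
    and closed: "\<And>u v. cov_form D a x u v = cov_form D a x v u"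
    and g: "bilinear_field_on U g" "\<And>u. (\<And>w. g x u w = 0) \<Longrightarrow> u = 0"
    and g_codazzi: "\<And>u v w. codazzi D g x u v w = 0"
    and l: "smooth_on U l"
    and P: "\<And>y u v. y \<in> U \<Longrightarrow> cov_form D a y u v - a y u * a y v = l y * g y u v"
    and dim: "2 \<le> DIM('a)"
  shows "dirD l x u = l x * a x u"
proof (cases "u = 0")
  case True
  have "linear (dirD l x)"
    by (rule linear_frechet_derivative[OF smooth_on_differentiable[OF l U(2)]])
  moreover have "linear (a x)" using a U(2) by (simp add: one_form_on_def)
  ultimately show ?thesis by (simp add: True linear_0)
next
  case False
  define \<beta> where "\<beta> u = dirD l x u - l x * a x u" for u
  have as: "smooth_on U (\<lambda>x. a x u)" and gs: "smooth_on U (\<lambda>x. g x u v)" for u v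
    using a g(1) by (auto simp: one_form_on_def bilinear_field_on_def)
  have bl: "bilinear (g x)" using g(1) U(2) by (simp add: bilinear_field_on_def)
  have \<beta>: "\<beta> u * g x v w = \<beta> v * g x u w" for u v w
  proof -
    have "dirD l x u * g x v w - dirD l x v * g x u w + l x * codazzi D g x u v w
        = codazzi D (\<lambda>y u v. l y * g y u v) x u v w"
      by (rule codazzi_scale[OF U(2) l gs, symmetric])
    also have "\<dots> = codazzi D (\<lambda>y u v. cov_form D a y u v - a y u * a y v) x u v w"
      by (rule codazzi_cong[OF U]) (simp add: P)
    also have "\<dots> = codazzi D (cov_form D a) x u v w - codazzi D (\<lambda>y u v. a y u * a y v) x u v w"
      by (rule codazzi_diff[OF U(2) one_form_on_cov_smooth[OF U(1) a D]]) (intro smooth_on_mult U(1) as)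
    also have "\<dots> = - a x (curv D x u v w) - (a x v * cov_form D a x u w - a x u * cov_form D a x v w)"
      by (simp only: codazzi_cov_form[OF U a D] codazzi_square[OF U(2) a sym closed])
    \<comment> \<open>Flatness removes the curvature term. Replacing Da by l g + a \<otimes> a makes
      the cubic terms in a cancel.\<close>
    also have "\<dots> = a x u * (l x * g x v w + a x v * a x w) - a x v * (l x * g x u w + a x u * a x w)"
      using a U(2) by (simp add: flat one_form_on_def linear_0 flip: P)
    finally show ?thesis by (simp add: \<beta>_def g_codazzi algebra_simps)
  qed
  obtain v where v: "\<And>a b. a *\<^sub>R u + b *\<^sub>R v = 0 \<Longrightarrow> b = 0"
    using exists_independent_vector[OF dim] by blast
  \<comment> \<open>The vector - \<beta>(v) u + \<beta>(u) v is orthogonal to everything, hence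
    zero; the choice of v then gives \<beta>(u) = 0.\<close>
  have "g x ((- \<beta> v) *\<^sub>R u + \<beta> u *\<^sub>R v) w = 0" for w
    using \<beta>[of u v w] by (simp only: bilinear_ladd[OF bl] bilinear_lmul[OF bl]) simp
  then have "\<beta> u = 0" using g(2) v by blast
  then show ?thesis by (simp add: \<beta>_def)
qed

text \<open>The equation for dl is required on a neighbourhood because it is differentiated once
  more; P = l g is evaluated at x alone.\<close>

lemma hessian_potential_of_conformal_factor:
  assumes U: "open U" "x \<in> U" and a: "one_form_on U a" and D: "bilinear_field_on U D"
    and l: "smooth_on U l" "\<And>y. y \<in> U \<Longrightarrow> l y \<noteq> 0"
    and dl: "\<And>y u. y \<in> U \<Longrightarrow> dirD l y u = l y * a y u"
    and P: "\<And>u v. cov_form D a x u v - a x u * a x v = l x * g x u v"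
  defines "\<psi> \<equiv> \<lambda>y. - inverse (l y)"
  shows "\<And>y u. y \<in> U \<Longrightarrow> dirD \<psi> y u = - \<psi> y * a y u"
    and "cov_form D (dirD \<psi>) x u v = g x u v"
proof -
  show d\<psi>: "dirD \<psi> y u = - \<psi> y * a y u" if y: "y \<in> U" for y u
  proof -
    have "dirD \<psi> y u = - (- (inverse (l y) * dirD l y u * inverse (l y)))"
      unfolding \<psi>_def using l y
      by (intro dirD_eqI has_derivative_minus Deriv.has_derivative_inverse smooth_on_has_derivative[of U]) auto
    also have "\<dots> = - \<psi> y * a y u" using l(2)[OF y] by (simp add: dl[OF y] \<psi>_def)
    finally show ?thesis .
  qed
  have \<psi>: "smooth_on U \<psi>"
    unfolding \<psi>_def by (intro smooth_on_uminus smooth_on_inverse U(1) l)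
  have "dirD (\<lambda>y. dirD \<psi> y v) x u = dirD (\<lambda>y. - \<psi> y * a y v) x u"
    using dirD_cong[OF U, of "\<lambda>y. dirD \<psi> y v" "\<lambda>y. - \<psi> y * a y v"] d\<psi> by simp
  also have "\<dots> = - \<psi> x * dirD (\<lambda>y. a y v) x u + - dirD \<psi> x u * a x v"
    using a U(2) \<psi>
    by (intro dirD_eqI[OF has_derivative_mult] has_derivative_minus smooth_on_has_derivative[of U])
      (auto simp: one_form_on_def)
  finally have "cov_form D (dirD \<psi>) x u v = - \<psi> x * (cov_form D a x u v - a x u * a x v)"
    by (simp add: cov_form_def d\<psi>[OF U(2)] algebra_simps)
  then show "cov_form D (dirD \<psi>) x u v = g x u v"
    using l(2)[OF U(2)] by (simp add: P \<psi>_def)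
qed

lemma one_form_on_dirD: "smooth_on U f \<Longrightarrow> one_form_on U (dirD f)"
  unfolding one_form_on_def
  by (auto intro: smooth_on_dirD linear_frechet_derivative smooth_on_differentiable)

lemma cov_form_dirD_sym:
  assumes "open U" "x \<in> U" "smooth_on U f" "D x u v = D x v u"
  shows "cov_form D (dirD f) x u v = cov_form D (dirD f) x v u"
  unfolding cov_form_def assms(4) second_derivative_symmetric[OF assms(1-3), of v u] ..

text \<open>Here a = - d log |\<psi>|. Differentiating the factor 1/\<psi> produces exactly a
  \<otimes> a, so that Da - a \<otimes> a retains only the Hessian of \<psi>, whose symmetry makes a
  closed.\<close>

lemma cov_form_logarithmic_derivative:
  assumes U: "open U" "x \<in> U" and \<psi>: "smooth_on U \<psi>" "\<And>y. y \<in> U \<Longrightarrow> \<psi> y \<noteq> 0"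
    and D: "\<And>u v. D x u v = D x v u"
  defines "a \<equiv> \<lambda>y u. - inverse (\<psi> y) * dirD \<psi> y u"
  shows "one_form_on U a"
    and "cov_form D a x u v - a x u * a x v = - inverse (\<psi> x) * cov_form D (dirD \<psi>) x u v"
    and "cov_form D a x u v = cov_form D a x v u"
proof -
  have "linear (dirD \<psi> y)" if "y \<in> U" for y
    by (rule linear_frechet_derivative[OF smooth_on_differentiable[OF \<psi>(1) that]])
  then have "linear (a y)" if "y \<in> U" for y
    using that unfolding a_def by (auto simp: linear_iff algebra_simps)
  moreover have "smooth_on U (\<lambda>x. a x u)" for u
    unfolding a_def by (intro smooth_on_mult smooth_on_uminus smooth_on_inverse smooth_on_dirD U \<psi>)
  ultimately show "one_form_on U a" by (simp add: one_form_on_def)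
  have "dirD (\<lambda>y. a y v) x u = - inverse (\<psi> x) * dirD (\<lambda>y. dirD \<psi> y v) x u
      + - (- (inverse (\<psi> x) * dirD \<psi> x u * inverse (\<psi> x))) * dirD \<psi> x v" for u v
    unfolding a_def using \<psi> U(2)
    by (intro dirD_eqI[OF has_derivative_mult] has_derivative_minus Deriv.has_derivative_inverse
        smooth_on_has_derivative[of U] smooth_on_dirD) auto
  then show P: "cov_form D a x u v - a x u * a x v = - inverse (\<psi> x) * cov_form D (dirD \<psi>) x u v" for u v
    by (simp add: cov_form_def a_def algebra_simps)
  show "cov_form D a x u v = cov_form D a x v u"
    using P[of u v] P[of v u] cov_form_dirD_sym[of U x \<psi> D u v] U \<psi>(1) D
    by (simp add: mult.commute)
qed

text \<open>Differentiating \<open>dirD T y v\<close> yields the second derivative of the chart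
  change, which is the inhomogeneous term in the law for Christoffel symbols; the two cancel and Da
  is a tensor.\<close>

lemma cov_form_transform:
  fixes T :: "'a::euclidean_space \<Rightarrow> 'a"
  assumes "open O1" "x \<in> O1" "smooth_on O1 T" "T ` O1 \<subseteq> O2" "open O2" "one_form_on O2 a'"
    and a: "\<And>y v. y \<in> O1 \<Longrightarrow> a y v = a' (T y) (dirD T y v)"
    and law: "dirD (\<lambda>y. dirD T y v) x u + D' (T x) (dirD T x u) (dirD T x v) = dirD T x (D x u v)"
  shows "cov_form D a x u v = cov_form D' a' (T x) (dirD T x u) (dirD T x v)"
proof -
  have T: "(T has_derivative dirD T x) (at x)"
    by (rule smooth_on_has_derivative[OF assms(3,2)])
  have T2: "((\<lambda>y. dirD T y v) has_derivative dirD (\<lambda>y. dirD T y v) x) (at x)"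
    by (rule smooth_on_has_derivative[OF smooth_on_dirD[OF assms(3)] assms(2)])
  have Tx: "T y \<in> O2" if "y \<in> O1" for y using assms(4) that by auto
  have aT: "((\<lambda>y. a' (T y) w) has_derivative (\<lambda>u. dirD (\<lambda>z. a' z w) (T x) (dirD T x u))) (at x)" for w
    using assms(6) Tx[OF assms(2)]
    by (intro has_derivative_compose[OF T] smooth_on_has_derivative[of O2]) (auto simp: one_form_on_def)
  have "dirD (\<lambda>y. a y v) x u = dirD (\<lambda>y. a' (T y) (dirD T y v)) x u"
    using dirD_cong[OF assms(1,2), of "\<lambda>y. a y v" "\<lambda>y. a' (T y) (dirD T y v)"] a by simp
  also have "\<dots> = dirD (\<lambda>y. a' (T y) (dirD T x v)) x u + a' (T x) (dirD (\<lambda>y. dirD T y v) x u)"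
    using assms(6) Tx aT
    by (intro dirD_eqI has_derivative_linear_family[OF assms(1,2) _ _ T2])
      (auto simp: one_form_on_def differentiable_def)
  also have "dirD (\<lambda>y. a' (T y) (dirD T x v)) x u = dirD (\<lambda>z. a' z (dirD T x v)) (T x) (dirD T x u)"
    by (rule dirD_eqI[OF aT])
  finally show ?thesis
    using assms(6) Tx[OF assms(2)]
    by (simp add: cov_form_def a[OF assms(2)] one_form_on_def linear_add flip: law)
qed

section \<open>Similarities, traces and parallel frames\<close>

lemma bilinear_sum_right: "bilinear h \<Longrightarrow> h x (sum f S) = sum (\<lambda>i. h x (f i)) S"
  unfolding bilinear_def by (simp add: linear_sum)

lemma bilinear_sum_left: "bilinear h \<Longrightarrow> h (sum f S) x = sum (\<lambda>i. h (f i) x) S"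
  unfolding bilinear_def using linear_sum[of "\<lambda>y. h y x"] by simp

lemma matrix_mult_add_left:
  fixes A B :: "real ^ 'n ^ 'm"
  shows "(A + B) ** C = A ** C + B ** C"
  by (simp add: vec_eq_iff matrix_matrix_mult_def distrib_right sum.distrib)

text \<open>With Gram matrix \<open>B\<close> the hypothesis reads M^T B + B M = k B. Multiplying by
  the inverse of \<open>B\<close> and taking traces gives 2 tr M = k d.\<close>

lemma similarity_factor_zero:
  fixes g :: "real ^ 'n::finite \<Rightarrow> real ^ 'n \<Rightarrow> real"
  assumes g: "bilinear g" and nondeg: "\<And>w. (\<And>v. g v w = 0) \<Longrightarrow> w = 0"
    and M: "linear M" "\<And>v w. g (M v) w + g v (M w) = k * g v w" and tr: "trace (matrix M) = 0"
  shows "k = 0"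
proof -
  define B where "B = (\<chi> i j. g (axis i 1) (axis j 1))"
  let ?M = "matrix M"
  have ex: "v = (\<Sum>l\<in>UNIV. (v $ l) *\<^sub>R axis l 1)" for v :: "real ^ 'n"
    using basis_expansion[of v] by (simp add: scalar_mult_eq_scaleR)
  have gl: "g v w = (\<Sum>l\<in>UNIV. v $ l * g (axis l 1) w)" for v w
    by (subst ex[of v]) (simp add: bilinear_sum_left[OF g] bilinear_lmul[OF g])
  have gr: "g v w = (\<Sum>l\<in>UNIV. w $ l * g v (axis l 1))" for v w
    by (subst ex[of w]) (simp add: bilinear_sum_right[OF g] bilinear_rmul[OF g])
  have "w = 0" if "B *v w = 0" for w
  proof (rule nondeg)
    fix v
    have "g (axis i 1) w = (B *v w) $ i" for i
      by (subst gr) (simp add: B_def matrix_vector_mult_def mult.commute)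
    then show "g v w = 0" using that by (subst gl) simp
  qed
  then obtain C where C: "C ** B = mat 1"
    using matrix_left_invertible_ker[of B] by blast
  then have C': "B ** C = mat 1" using matrix_left_right_inverse by blast
  have "transpose ?M ** B + B ** ?M = k *\<^sub>R B"
  proof -
    have "g (M (axis i 1)) (axis j 1) + g (axis i 1) (M (axis j 1)) = k * g (axis i 1) (axis j 1)" for i j
      by (rule M(2))
    then show ?thesis
      by (subst (asm) (1) gl, subst (asm) (2) gr)
        (simp add: vec_eq_iff B_def matrix_matrix_mult_def transpose_def matrix_def mult.commute)
  qed
  then have "(transpose ?M ** B) ** C + (B ** ?M) ** C = (k *\<^sub>R B) ** C"
    by (simp flip: matrix_mult_add_left)
  moreover have "(k *\<^sub>R B) ** C = k *\<^sub>R (B ** C)"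
    by (simp add: vec_eq_iff matrix_matrix_mult_def sum_distrib_left mult.assoc)
  ultimately have "transpose ?M + B ** (?M ** C) = k *\<^sub>R mat 1"
    by (simp add: C' flip: matrix_mul_assoc)
  then have "trace (transpose ?M) + trace (B ** (?M ** C)) = trace (k *\<^sub>R mat 1 :: real ^ 'n ^ 'n)"
    by (metis trace_add)
  moreover have "trace (k *\<^sub>R mat 1 :: real ^ 'n ^ 'n) = k * real CARD('n)"
    by (simp add: trace_def mat_def)
  moreover have "trace (transpose ?M) = 0" using tr by (simp add: trace_def transpose_def)
  \<comment> \<open>Cyclicity of the trace moves \<open>B\<close> next to its inverse
    \<open>C\<close>.\<close>
  moreover have "trace (B ** (?M ** C)) = 0"
    by (subst trace_mul_sym) (simp add: matrix_mul_assoc[symmetric] C tr)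
  ultimately show "k = 0" by simp
qed

text \<open>Skewness on the diagonal, g(Mw, w) = 0, gives P(u,w) g(v,w) = P(v,w) g(u,w). So for each
  w the forms P(., w) and g(., w) are proportional, and linearity in w makes the factor
  constant.\<close>

lemma similarity_imp_proportional:
  fixes g P :: "real ^ 'n::finite \<Rightarrow> real ^ 'n \<Rightarrow> real"
  assumes g: "bilinear g" "\<And>u v. g u v = g v u" "\<And>u. (\<And>v. g u v = 0) \<Longrightarrow> u = 0"
    and P: "bilinear P" "\<And>u v. P u v = P v u"
    and sim: "\<And>u v. infinitesimal_similarity g (\<lambda>w. - (P u w *\<^sub>R v - P v w *\<^sub>R u))"
  shows "\<exists>l. \<forall>u v. P u v = l * g u v"
proof -
  note bl = bilinear_ladd[OF g(1)] bilinear_radd[OF g(1)] bilinear_lsub[OF g(1)] bilinear_rsub[OF g(1)]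
    bilinear_lmul[OF g(1)] bilinear_rmul[OF g(1)] bilinear_lneg[OF g(1)] bilinear_rneg[OF g(1)]
  have nondeg: "w = 0" if "\<And>v. g v w = 0" for w
    using g(3)[of w] that g(2)[of w] by simp
  have eq: "P u w * g v w = P v w * g u w" for u v w
  proof -
    let ?M = "\<lambda>w. - (P u w *\<^sub>R v - P v w *\<^sub>R u)"
    from sim obtain k where M: "linear ?M" "\<And>x y. g (?M x) y + g x (?M y) = k * g x y"
      unfolding infinitesimal_similarity_def by blast
    have ex: "v = (\<Sum>l\<in>UNIV. (v $ l) *\<^sub>R axis l 1)" for v :: "real ^ 'n"
      using basis_expansion[of v] by (simp add: scalar_mult_eq_scaleR)
    have Pr: "P v w = (\<Sum>l\<in>UNIV. P v (axis l 1) * w $ l)" for v w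
      by (subst ex[of w]) (simp add: bilinear_sum_right[OF P(1)] bilinear_rmul[OF P(1)] mult.commute)
    have "trace (matrix ?M) = - (P u v - P v u)"
      by (simp add: trace_def matrix_def sum_subtractf Pr[of u v] Pr[of v u])
    then have tr: "trace (matrix ?M) = 0" by (simp add: P(2)[of v u])
    have "k = 0"
      by (rule similarity_factor_zero[where M = ?M, OF g(1) _ M(1) _ tr]) (rule nondeg, assumption, rule M(2))
    then have "g (?M w) w + g w (?M w) = 0" using M(2)[of w w] by simp
    then show ?thesis by (simp add: bl g(2)[of w v] g(2)[of w u])
  qed
  have "\<exists>l. \<forall>u. P u w = l * g u w" for w
  proof (cases "\<exists>v. g v w \<noteq> 0")
    case True
    then obtain v where "g v w \<noteq> 0" by blast
    then have "P u w = (P v w / g v w) * g u w" for u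
      using eq[of u w v] by (simp add: field_simps)
    then show ?thesis by blast
  next
    case False
    then have "w = 0" using nondeg by blast
    then show ?thesis by (simp add: bilinear_rzero[OF P(1)] bilinear_rzero[OF g(1)])
  qed
  then obtain l where l: "\<And>u w. P u w = l w * g u w" by metis
  define w0 :: "real ^ 'n" where "w0 = axis undefined 1"
  have w0: "w0 \<noteq> 0" by (simp add: w0_def)
  have "P u w = l w0 * g u w" for u w
  proof (cases "\<exists>t. w = t *\<^sub>R w0")
    case True
    then obtain t where "w = t *\<^sub>R w0" by blast
    then show ?thesis by (simp add: bilinear_rmul[OF P(1)] bl l[of u w0])
  next
    case False
    \<comment> \<open>For w not a multiple of \<open>w0\<close>, comparing the factors at w,
      \<open>w0\<close> and their sum through nondegeneracy forces all three to agree.\<close>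
    let ?m = "l (w + w0)"
    have "g v ((?m - l w) *\<^sub>R w + (?m - l w0) *\<^sub>R w0) = 0" for v
      using bilinear_radd[OF P(1), of v w w0] by (simp add: bl l algebra_simps)
    then have z: "(?m - l w) *\<^sub>R w + (?m - l w0) *\<^sub>R w0 = 0" by (rule nondeg)
    have "?m - l w = 0"
    proof (rule ccontr)
      assume n: "?m - l w \<noteq> 0"
      have "(?m - l w) *\<^sub>R w = - ((?m - l w0) *\<^sub>R w0)"
        using z by (simp only: eq_neg_iff_add_eq_0)
      also have "\<dots> = (?m - l w) *\<^sub>R ((- (?m - l w0) / (?m - l w)) *\<^sub>R w0)"
        using n by (simp only: scaleR_scaleR times_divide_eq_right nonzero_mult_div_cancel_left
            scaleR_minus_left[symmetric] not_False_eq_True)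
      finally have "(?m - l w) *\<^sub>R w = (?m - l w) *\<^sub>R ((- (?m - l w0) / (?m - l w)) *\<^sub>R w0)" .
      then show False using False n by (metis scaleR_left_imp_eq)
    qed
    with z w0 have "?m - l w0 = 0" by simp
    with \<open>?m - l w = 0\<close> show ?thesis by (simp add: l[of u w])
  qed
  then show ?thesis by blast
qed

lemma proportional_imp_similarity:
  fixes g P :: "real ^ 'n::finite \<Rightarrow> real ^ 'n \<Rightarrow> real"
  assumes g: "bilinear g" "\<And>u v. g u v = g v u" and P: "\<And>u v. P u v = l * g u v"
  shows "infinitesimal_similarity g (\<lambda>w. - (P u w *\<^sub>R v - P v w *\<^sub>R u))"
proof -
  note bl = bilinear_ladd[OF g(1)] bilinear_radd[OF g(1)] bilinear_lsub[OF g(1)] bilinear_rsub[OF g(1)]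
    bilinear_lmul[OF g(1)] bilinear_rmul[OF g(1)] bilinear_lneg[OF g(1)] bilinear_rneg[OF g(1)]
  let ?M = "\<lambda>w. - (P u w *\<^sub>R v - P v w *\<^sub>R u)"
  have "linear ?M"
    by (rule linearI) (simp_all add: P bl algebra_simps)
  moreover have "g (?M x) y + g x (?M y) = 0 * g x y" for x y
    by (simp add: P bl g(2)[of x] algebra_simps)
  ultimately show ?thesis unfolding infinitesimal_similarity_def by blast
qed

section \<open>Traces of Christoffel symbols and volume forms\<close>

text \<open>The connection form on top-degree forms: a density \<rho> is parallel when d\<rho> is
  \<rho> times it. It is not a tensor and has to be handled chart by chart.\<close>

definition christoffel_trace :: "('a \<Rightarrow> real ^ 'n::finite \<Rightarrow> real ^ 'n \<Rightarrow> real ^ 'n) \<Rightarrow> 'a \<Rightarrow> real ^ 'n \<Rightarrow> real" where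
  "christoffel_trace G x u = (\<Sum>i\<in>UNIV. G x u (axis i 1) $ i)"

lemma trace_matrix_christoffel: "trace (matrix (G x u)) = christoffel_trace G x u"
  by (simp add: trace_def matrix_def christoffel_trace_def)

lemma one_form_on_christoffel_trace:
  assumes "open U" "bilinear_field_on U G"
  shows "one_form_on U (christoffel_trace G)"
proof -
  have "linear (christoffel_trace G x)" if "x \<in> U" for x
  proof -
    have b: "bilinear (G x)" using assms that by (simp add: bilinear_field_on_def)
    show ?thesis
      by (rule linearI)
        (simp_all add: christoffel_trace_def bilinear_ladd[OF b] bilinear_lmul[OF b] sum.distrib sum_distrib_left)
  qed
  moreover have "smooth_on U (\<lambda>x. christoffel_trace G x u)" for u
    unfolding christoffel_trace_def
    using assms by (intro smooth_on_sum smooth_on_nth) (auto simp: bilinear_field_on_def)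
  ultimately show ?thesis by (simp add: one_form_on_def)
qed

text \<open>The trace of the curvature is the exterior derivative of this form, since the quadratic
  part of the curvature is a commutator and has trace 0.\<close>

lemma christoffel_trace_closed:
  assumes "open U" "x \<in> U" and D: "bilinear_field_on U D" and flat: "\<And>w. curv D x u v w = 0"
  shows "dirD (\<lambda>y. christoffel_trace D y v) x u = dirD (\<lambda>y. christoffel_trace D y u) x v"
proof -
  have *: "dirD (\<lambda>y. christoffel_trace D y v) x u = (\<Sum>i\<in>UNIV. dirD (\<lambda>y. D y v (axis i 1)) x u $ i)" for u v
    unfolding christoffel_trace_def using D assms(2)
    by (intro dirD_eqI[OF has_derivative_sum] bounded_linear.has_derivative[OF bounded_linear_vec_nth]
        smooth_on_has_derivative[of U])
      (auto simp: bilinear_field_on_def)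
  have lin: "linear (D x u)" for u
    using D assms(2) by (simp add: bilinear_field_on_def bilinear_def)
  have "(\<Sum>i\<in>UNIV. D x u (D x v (axis i 1)) $ i) = trace (matrix (D x u) ** matrix (D x v))" for u v
    by (simp add: matrix_compose[symmetric] lin) (simp add: trace_def matrix_def)
  then have "(\<Sum>i\<in>UNIV. D x u (D x v (axis i 1)) $ i) = (\<Sum>i\<in>UNIV. D x v (D x u (axis i 1)) $ i)"
    using trace_mul_sym by metis
  moreover have "(\<Sum>i\<in>UNIV. curv D x u v (axis i 1) $ i) = 0" by (simp add: flat)
  ultimately show ?thesis
    unfolding * by (simp add: curv_def sum_subtractf sum.distrib)
qed

text \<open>Product rule combined with Liouville's formula for X' = - L X. Only one time t is
  involved, so L may be the Christoffel endomorphism at that time.\<close>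

lemma volume_form_derivative:
  fixes X :: "'n::finite \<Rightarrow> real \<Rightarrow> real ^ 'n"
  assumes \<sigma>: "(\<sigma> has_vector_derivative \<sigma>') (at t)" and \<rho>: "(\<rho> has_derivative \<rho>') (at (\<sigma> t))"
    and L: "linear L" and X: "\<And>j. (X j has_vector_derivative - L (X j t)) (at t)"
  shows "((\<lambda>s. volume_form \<rho> (\<sigma> s) (\<lambda>j. X j s)) has_real_derivative
    (\<rho>' \<sigma>' - \<rho> (\<sigma> t) * trace (matrix L)) * det (\<chi> i j. X j t $ i)) (at t)"
proof -
  let ?X = "\<lambda>s. (\<chi> i j. X j s $ i)"
  have "(?X has_vector_derivative (\<chi> i j. (- L (X j t)) $ i)) (at t)"
  proof -
    have "((\<lambda>s. ?X s $ i $ j) has_derivative (\<lambda>h. h * ((- L (X j t)) $ i))) (at t)" for i j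
      using bounded_linear.has_derivative[OF bounded_linear_vec_nth X[of j, unfolded has_vector_derivative_def], of i]
      by simp
    then show ?thesis
      unfolding has_vector_derivative_def has_derivative_componentwise_within[where 'b = "real ^ 'n ^ 'n"]
      by (auto simp: Basis_vec_def inner_axis)
  qed
  moreover have "(\<chi> i j. (- L (X j t)) $ i) = (- matrix L) ** ?X t"
  proof -
    have "(\<Sum>k\<in>UNIV. matrix L $ i $ k * X j t $ k) = L (X j t) $ i" for i j
      using matrix_vector_mul(2)[OF L] by (simp add: fun_eq_iff matrix_vector_mult_def vec_eq_iff)
    then show ?thesis by (simp add: vec_eq_iff matrix_matrix_mult_def sum_negf)
  qed
  ultimately have "((\<lambda>s. det (?X s)) has_real_derivative trace (- matrix L) * det (?X t)) (at t)"
    by (intro has_real_derivative_det_matrix_ode) simp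
  moreover have "((\<lambda>s. \<rho> (\<sigma> s)) has_real_derivative \<rho>' \<sigma>') (at t)"
    using has_derivative_compose[OF \<sigma>[unfolded has_vector_derivative_def] \<rho>]
      linear_cmul[OF has_derivative_linear[OF \<rho>]]
    by (simp add: has_field_derivative_def mult_commute_abs)
  moreover have "trace (- matrix L) = - trace (matrix L)" by (simp add: trace_def sum_negf)
  ultimately show ?thesis
    unfolding volume_form_def by (auto intro!: derivative_eq_intros simp: algebra_simps)
qed

section \<open>Parallel frames and geodesics as solutions of differential equations\<close>

text \<open>Parallel transport along a line depends on time; including the base point, with constant
  velocity u, in the state makes it autonomous. The frame is one matrix with rows
  \<open>X j\<close>, so its vectors share an interval of existence.\<close>

lemma parallel_frame_exists:
  fixes G :: "real ^ 'n::finite \<Rightarrow> real ^ 'n \<Rightarrow> real ^ 'n \<Rightarrow> real ^ 'n"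
  assumes U: "open U" "x \<in> U" and G: "bilinear_field_on U G"
  obtains e \<sigma> X where "0 < e" "\<sigma> 0 = x" "\<sigma> ` {-e<..<e} \<subseteq> U" "smooth_on {-e<..<e} \<sigma>"
    "\<And>t. t \<in> {-e<..<e} \<Longrightarrow> (\<sigma> has_vector_derivative u) (at t)"
    "\<And>j. X j 0 = axis j 1" "\<And>j. smooth_on {-e<..<e} (X j)"
    "\<And>j t. t \<in> {-e<..<e} \<Longrightarrow> (X j has_vector_derivative - G (\<sigma> t) u (X j t)) (at t)"
proof -
  let ?S = "U \<times> (UNIV :: (real ^ 'n ^ 'n) set)"
  define F where "F p = (u, \<chi> j. - G (fst p) u (snd p $ j))" for p :: "(real ^ 'n) \<times> (real ^ 'n ^ 'n)"
  have S: "open ?S" using U by (intro open_Times) auto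
  have fst: "smooth_on ?S fst"
    using smooth_on_bounded_linear[OF bounded_linear_fst S smooth_on_ident[OF S]] .
  have "smooth_on ?S (\<lambda>p. G (fst p) u (snd p $ j))" for j
  proof (rule smooth_on_linear_family[OF S, where B = "\<lambda>p. G (fst p) u" and h = "\<lambda>p. snd p $ j"])
    show "linear (G (fst p) u)" if "p \<in> ?S" for p
      using that G by (auto simp: bilinear_field_on_def bilinear_def)
    show "smooth_on ?S (\<lambda>p. G (fst p) u w)" for w
      using G by (intro smooth_on_compose[OF S U(1) _ _ fst, of "\<lambda>x. G x u w"])
        (auto simp: bilinear_field_on_def)
    show "smooth_on ?S (\<lambda>p. snd p $ j)"
      by (rule smooth_on_bounded_linear[OF bounded_linear_compose[OF bounded_linear_vec_nth bounded_linear_snd] S smooth_on_ident[OF S]])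
  qed
  then have F: "smooth_on ?S F"
    unfolding F_def by (intro smooth_on_Pair smooth_on_vec_lambda smooth_on_uminus smooth_on_const S)
  obtain e y where y: "0 < e" "y 0 = (x, \<chi> j. axis j 1)" "y ` {-e<..<e} \<subseteq> ?S" "smooth_on {-e<..<e} y"
    "\<And>t. t \<in> {-e<..<e} \<Longrightarrow> (y has_vector_derivative F (y t)) (at t)"
    using ode_local_existence[OF S _ F, of "(x, \<chi> j. axis j 1)"] U(2) by auto
  note yd = y(5)[unfolded has_vector_derivative_def]
  show ?thesis
  proof (rule that[OF y(1), of "\<lambda>t. fst (y t)" "\<lambda>j t. snd (y t) $ j"])
    show "fst (y 0) = x" "snd (y 0) $ j = axis j 1" for j by (simp_all add: y(2))
    show "(\<lambda>t. fst (y t)) ` {-e<..<e} \<subseteq> U" using y(3) by auto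
    show "smooth_on {-e<..<e} (\<lambda>t. fst (y t))"
      by (rule smooth_on_bounded_linear[OF bounded_linear_fst _ y(4)]) simp
    show "smooth_on {-e<..<e} (\<lambda>t. snd (y t) $ j)" for j
      by (rule smooth_on_bounded_linear[OF bounded_linear_compose[OF bounded_linear_vec_nth bounded_linear_snd] _ y(4)]) simp
    fix t assume t: "t \<in> {-e<..<e}"
    show "((\<lambda>t. fst (y t)) has_vector_derivative u) (at t)"
      using bounded_linear.has_derivative[OF bounded_linear_fst yd[OF t]]
      by (simp add: has_vector_derivative_def F_def)
    show "((\<lambda>t. snd (y t) $ j) has_vector_derivative - G (fst (y t)) u (snd (y t) $ j)) (at t)" for j
      using bounded_linear.has_derivative[OF bounded_linear_compose[OF bounded_linear_vec_nth bounded_linear_snd] yd[OF t], of j]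
      by (simp add: has_vector_derivative_def F_def)
  qed
qed

text \<open>A first-order system for position and velocity. Velocity zero is removed from the open
  state space, so the solution is automatically a regular curve.\<close>

lemma geodesic_exists:
  fixes D :: "real ^ 'n::finite \<Rightarrow> real ^ 'n \<Rightarrow> real ^ 'n \<Rightarrow> real ^ 'n"
  assumes U: "open U" "x \<in> U" and D: "bilinear_field_on U D" and u: "u \<noteq> 0"
  obtains e \<sigma> \<sigma>' where "0 < e" "\<sigma> 0 = x" "\<sigma>' 0 = u" "\<sigma> ` {-e<..<e} \<subseteq> U" "smooth_on {-e<..<e} \<sigma>"
    "\<And>t. t \<in> {-e<..<e} \<Longrightarrow> \<sigma>' t \<noteq> 0"
    "\<And>t. t \<in> {-e<..<e} \<Longrightarrow> (\<sigma> has_vector_derivative \<sigma>' t) (at t)"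
    "\<And>t. t \<in> {-e<..<e} \<Longrightarrow> (\<sigma>' has_vector_derivative - D (\<sigma> t) (\<sigma>' t) (\<sigma>' t)) (at t)"
proof -
  let ?S = "U \<times> (- {0 :: real ^ 'n})"
  define F where "F p = (snd p, - D (fst p) (snd p) (snd p))" for p :: "(real ^ 'n) \<times> (real ^ 'n)"
  have S: "open ?S" using U by (intro open_Times) auto
  have snd: "smooth_on ?S snd"
    using smooth_on_bounded_linear[OF bounded_linear_snd S smooth_on_ident[OF S]] .
  have fst: "smooth_on ?S fst"
    using smooth_on_bounded_linear[OF bounded_linear_fst S smooth_on_ident[OF S]] .
  have "smooth_on ?S (\<lambda>p. D (fst p) (snd p) (snd p))"
  proof (rule smooth_on_bilinear_field[OF S _ _ snd snd, where D = "\<lambda>p. D (fst p)"])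
    show "bilinear (D (fst p))" if "p \<in> ?S" for p
      using that D by (auto simp: bilinear_field_on_def)
    show "smooth_on ?S (\<lambda>p. D (fst p) v w)" for v w
      using D by (intro smooth_on_compose[OF S U(1) _ _ fst, of "\<lambda>x. D x v w"])
        (auto simp: bilinear_field_on_def)
  qed
  then have F: "smooth_on ?S F"
    unfolding F_def by (intro smooth_on_Pair snd smooth_on_uminus S)
  obtain e y where y: "0 < e" "y 0 = (x, u)" "y ` {-e<..<e} \<subseteq> ?S" "smooth_on {-e<..<e} y"
    "\<And>t. t \<in> {-e<..<e} \<Longrightarrow> (y has_vector_derivative F (y t)) (at t)"
    using ode_local_existence[OF S _ F, of "(x, u)"] U(2) u by auto
  note yd = y(5)[unfolded has_vector_derivative_def]
  show ?thesis
  proof (rule that[OF y(1), of "\<lambda>t. fst (y t)" "\<lambda>t. snd (y t)"])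
    show "fst (y 0) = x" "snd (y 0) = u" by (simp_all add: y(2))
    show "(\<lambda>t. fst (y t)) ` {-e<..<e} \<subseteq> U" using y(3) by auto
    show "smooth_on {-e<..<e} (\<lambda>t. fst (y t))"
      by (rule smooth_on_bounded_linear[OF bounded_linear_fst _ y(4)]) simp
    fix t assume t: "t \<in> {-e<..<e}"
    have "y t \<in> ?S" using y(3) t by blast
    then show "snd (y t) \<noteq> 0" by (simp add: mem_Times_iff)
    show "((\<lambda>t. fst (y t)) has_vector_derivative snd (y t)) (at t)"
      using bounded_linear.has_derivative[OF bounded_linear_fst yd[OF t]]
      by (simp add: has_vector_derivative_def F_def)
    show "((\<lambda>t. snd (y t)) has_vector_derivative - D (fst (y t)) (snd (y t)) (snd (y t))) (at t)"
      using bounded_linear.has_derivative[OF bounded_linear_snd yd[OF t]]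
      by (simp add: has_vector_derivative_def F_def)
  qed
qed

section \<open>Connections on a manifold\<close>

text \<open>Derivatives are taken at points, not within \<open>U\<close>, so each level of the
  recursion is a local property.\<close>

lemma smooth_on_locally:
  assumes "\<And>x. x \<in> U \<Longrightarrow> \<exists>V. open V \<and> x \<in> V \<and> smooth_on V f"
  shows "smooth_on U f"
proof -
  have loc: "Ck_on k U h" if "\<And>x. x \<in> U \<Longrightarrow> \<exists>V. open V \<and> x \<in> V \<and> Ck_on k V h" for k and h
    using that
  proof (induction k arbitrary: h)
    case 0
    have "isCont h x" if "x \<in> U" for x
      using 0[OF that] by (auto simp: continuous_on_eq_continuous_at)
    then show ?case by (simp add: continuous_at_imp_continuous_on)
  next
    case (Suc k)
    have "h differentiable (at x)" if "x \<in> U" for x using Suc.prems[OF that] by auto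
    moreover have "Ck_on k U (\<lambda>x. dirD h x v)" for v
      by (rule Suc.IH) (use Suc.prems in fastforce)
    ultimately show ?case by simp
  qed
  show ?thesis
    unfolding smooth_on_def
  proof (intro allI loc)
    fix k x assume "x \<in> U"
    then show "\<exists>V. open V \<and> x \<in> V \<and> Ck_on k V f"
      using assms[of x] by (auto simp: smooth_on_def)
  qed
qed

lemma one_form_on_subset: "one_form_on U a \<Longrightarrow> V \<subseteq> U \<Longrightarrow> one_form_on V a"
  by (auto simp: one_form_on_def intro: smooth_on_subset)

lemma bilinear_field_on_subset: "bilinear_field_on U D \<Longrightarrow> V \<subseteq> U \<Longrightarrow> bilinear_field_on V D"
  unfolding bilinear_field_on_def using smooth_on_subset by blast

lemma cov_form_cong:
  assumes "open U" "x \<in> U" "\<And>y v. y \<in> U \<Longrightarrow> a y v = b y v"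
  shows "cov_form D a x u v = cov_form D b x u v"
proof -
  have "dirD (\<lambda>y. a y v) x = dirD (\<lambda>y. b y v) x"
    by (rule dirD_cong[OF assms(1,2)]) (rule assms(3))
  then show ?thesis by (simp add: cov_form_def assms(2,3))
qed

section \<open>Charts and transition maps\<close>

lemma is_chart_param:
  assumes "is_chart c"
  shows "x \<in> img c \<Longrightarrow> param c x \<in> dom_of c" "x \<in> img c \<Longrightarrow> coord c (param c x) = x"
    "p \<in> dom_of c \<Longrightarrow> param c (coord c p) = p" "p \<in> dom_of c \<Longrightarrow> coord c p \<in> img c"
    "continuous_on (img c) (param c)" "open (img c)"
  using assms by (auto simp: is_chart_def homeomorphism_def)

lemma coord_image_eq:
  assumes "is_chart c"
  shows "coord c ` (dom_of c \<inter> V) = {x \<in> img c. param c x \<in> V}"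
proof (intro equalityI subsetI)
  fix x assume "x \<in> {x \<in> img c. param c x \<in> V}"
  then have "param c x \<in> dom_of c \<inter> V" "x = coord c (param c x)"
    using is_chart_param(1,2)[OF assms] by auto
  then show "x \<in> coord c ` (dom_of c \<inter> V)" by blast
qed (use is_chart_param(3,4)[OF assms] in auto)

lemma open_coord_image:
  assumes "is_chart c" "open V"
  shows "open (coord c ` (dom_of c \<inter> V))"
proof -
  have "open (img c \<inter> param c -` V)"
    by (rule continuous_open_preimage[OF is_chart_param(5,6)[OF assms(1)] assms(2)])
  then show ?thesis
    by (simp only: coord_image_eq[OF assms(1)]) (simp add: Int_def vimage_def)
qed

locale smooth_atlas =
  fixes A :: "('m::{t2_space,second_countable_topology}, 'n::finite) chart set"
  assumes smooth_structure: "smooth_structure A"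
begin

lemma chart: "c \<in> A \<Longrightarrow> is_chart c"
  using smooth_structure by (simp add: smooth_structure_def)

lemmas chart_param = is_chart_param[OF chart]

lemma chart_at: "\<exists>c\<in>A. p \<in> dom_of c"
  using smooth_structure unfolding smooth_structure_def by blast

lemma overlap_iff: "c \<in> A \<Longrightarrow> x \<in> overlap c c' \<longleftrightarrow> x \<in> img c \<and> param c x \<in> dom_of c'"
  unfolding overlap_def by (simp add: coord_image_eq[OF chart])

lemma open_overlap: "c \<in> A \<Longrightarrow> c' \<in> A \<Longrightarrow> open (overlap c c')"
  unfolding overlap_def using chart[of c'] by (auto intro: open_coord_image chart simp: is_chart_def)

lemma smooth_transition: "c \<in> A \<Longrightarrow> c' \<in> A \<Longrightarrow> smooth_on (overlap c c') (transition c c')"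
  using smooth_structure by (simp add: smooth_structure_def compatible_def)

lemma transition_overlap:
  assumes "c \<in> A" "c' \<in> A" "x \<in> overlap c c'"
  shows "param c' (transition c c' x) = param c x"
    and "transition c c' x \<in> overlap c' c" and "transition c c' x \<in> img c'"
    and "transition c' c (transition c c' x) = x"
proof -
  have x: "x \<in> img c" "param c x \<in> dom_of c'" using assms overlap_iff by auto
  show p: "param c' (transition c c' x) = param c x"
    using chart_param(3)[OF assms(2) x(2)] by (simp add: transition_def)
  show i: "transition c c' x \<in> img c'"
    using chart_param(4)[OF assms(2) x(2)] by (simp add: transition_def)
  show "transition c c' x \<in> overlap c' c"
    using i p chart_param(1)[OF assms(1) x(1)] by (simp add: overlap_iff assms)
  show "transition c' c (transition c c' x) = x"
    using p chart_param(2)[OF assms(1) x(1)] by (simp add: transition_def)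
qed

lemma transition_derivative_inverse:
  assumes "c \<in> A" "c' \<in> A" "x \<in> overlap c c'"
  shows "dirD (transition c' c) (transition c c' x) (dirD (transition c c') x u) = u"
proof -
  note T = smooth_on_has_derivative[OF smooth_transition[OF assms(1,2)] assms(3)]
  note T' = smooth_on_has_derivative[OF smooth_transition[OF assms(2,1)] transition_overlap(2)[OF assms]]
  have "((\<lambda>y. transition c' c (transition c c' y)) has_derivative
      (\<lambda>u. dirD (transition c' c) (transition c c' x) (dirD (transition c c') x u))) (at x)"
    by (rule has_derivative_compose[OF T T'])
  moreover have "((\<lambda>y. transition c' c (transition c c' y)) has_derivative (\<lambda>u. u)) (at x)"
    by (rule has_derivative_transform_within_open[OF has_derivative_ident open_overlap[OF assms(1,2)] assms(3)])
      (simp add: transition_overlap(4)[OF assms(1,2)])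
  ultimately show ?thesis
    by (metis has_derivative_unique)
qed

lemma transition_derivative_linear:
  assumes "c \<in> A" "c' \<in> A" "x \<in> overlap c c'"
  shows "linear (dirD (transition c c') x)"
  by (rule linear_frechet_derivative[OF smooth_on_differentiable[OF smooth_transition[OF assms(1,2)] assms(3)]])

lemma transition_derivative_nonzero:
  assumes "c \<in> A" "c' \<in> A" "x \<in> overlap c c'" "u \<noteq> 0"
  shows "dirD (transition c c') x u \<noteq> 0"
  using transition_derivative_inverse[OF assms(1-3), of u] assms(4)
    linear_0[OF transition_derivative_linear[OF assms(2,1) transition_overlap(2)[OF assms(1-3)]]]
  by metis

lemma connection_field: "affine_connection A G \<Longrightarrow> c \<in> A \<Longrightarrow> bilinear_field_on (img c) (G c)"
  by (simp add: affine_connection_def bilinear_field_on_def)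

lemma connection_law:
  assumes "affine_connection A G" "c \<in> A" "c' \<in> A" "x \<in> overlap c c'"
  shows "dirD (\<lambda>y. dirD (transition c c') y v) x u
      + G c' (transition c c' x) (dirD (transition c c') x u) (dirD (transition c c') x v)
    = dirD (transition c c') x (G c x u v)"
  using assms unfolding affine_connection_def Let_def by blast

section \<open>Geodesics and projective equivalence\<close>

text \<open>The equation is solved in one chart, whereas an unparameterized geodesic is tested in
  all. The transformation law carries zero acceleration to every overlapping chart, so the factor is
  0 throughout.\<close>

lemma geodesic_unparam:
  assumes G: "affine_connection A G" and c: "c \<in> A" and J: "open J"
    and \<sigma>: "\<sigma> ` J \<subseteq> img c" "smooth_on J \<sigma>" "\<And>t. t \<in> J \<Longrightarrow> \<sigma>' t \<noteq> 0"
    "\<And>t. t \<in> J \<Longrightarrow> (\<sigma> has_vector_derivative \<sigma>' t) (at t)"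
    "\<And>t. t \<in> J \<Longrightarrow> (\<sigma>' has_vector_derivative - G c (\<sigma> t) (\<sigma>' t) (\<sigma>' t)) (at t)"
  shows "unparam_geodesic_on A G J (param c \<circ> \<sigma>)"
proof -
  have cont: "continuous_on J (param c \<circ> \<sigma>)"
    using continuous_on_compose2[OF chart_param(5)[OF c] smooth_on_continuous_on[OF \<sigma>(2)] \<sigma>(1)]
    by (simp add: comp_def)
  have "smooth_on {t \<in> J. (param c \<circ> \<sigma>) t \<in> dom_of c'} (coord c' \<circ> (param c \<circ> \<sigma>)) \<and>
      (\<forall>t\<in>J. (param c \<circ> \<sigma>) t \<in> dom_of c' \<longrightarrow>
        (let \<tau> = coord c' \<circ> (param c \<circ> \<sigma>); \<tau>' = (\<lambda>s. vector_derivative \<tau> (at s)) in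
          \<tau>' t \<noteq> 0 \<and> (\<exists>k. cov_along G c' \<tau> \<tau>' t = k *\<^sub>R \<tau>' t)))"
    if c': "c' \<in> A" for c'
  proof -
    let ?T = "transition c c'"
    \<comment> \<open>The times at which the curve lies in both charts; openness allows derivatives
      to be computed there.\<close>
    define K where "K = {t \<in> J. (param c \<circ> \<sigma>) t \<in> dom_of c'}"
    have "open (J \<inter> (param c \<circ> \<sigma>) -` dom_of c')"
      using chart[OF c'] by (intro continuous_open_preimage[OF cont J]) (simp add: is_chart_def)
    then have K: "open K" by (simp add: K_def Int_def vimage_def)
    have KO: "\<sigma> t \<in> overlap c c'" and KJ: "t \<in> J" if "t \<in> K" for t
      using that \<sigma>(1) by (auto simp: K_def overlap_iff[OF c])
    have \<tau>: "coord c' \<circ> (param c \<circ> \<sigma>) = (\<lambda>t. ?T (\<sigma> t))" by (simp add: fun_eq_iff transition_def)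
    have sm: "smooth_on K (\<lambda>t. ?T (\<sigma> t))"
      by (rule smooth_on_compose[OF K open_overlap[OF c c'] _ smooth_transition[OF c c']])
        (use KO KJ in \<open>auto intro: smooth_on_subset[OF \<sigma>(2)]\<close>)
    have d1: "((\<lambda>t. k (\<sigma> t)) has_vector_derivative dirD k (\<sigma> t) (\<sigma>' t)) (at t)"
      if t: "t \<in> K" and k: "smooth_on (overlap c c') k" for t and k :: "real ^ 'n \<Rightarrow> real ^ 'n"
      using has_derivative_compose[OF \<sigma>(4)[OF KJ[OF t], unfolded has_vector_derivative_def]
          smooth_on_has_derivative[OF k KO[OF t]]]
        linear_cmul[OF linear_frechet_derivative[OF smooth_on_differentiable[OF k KO[OF t]]]]
      by (simp add: has_vector_derivative_def)
    have \<tau>': "vector_derivative (\<lambda>t. ?T (\<sigma> t)) (at t) = dirD ?T (\<sigma> t) (\<sigma>' t)" if "t \<in> K" for t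
      by (rule vector_derivative_at[OF d1[OF that smooth_transition[OF c c']]])
    have "cov_along G c' (\<lambda>t. ?T (\<sigma> t)) (\<lambda>s. vector_derivative (\<lambda>t. ?T (\<sigma> t)) (at s)) t = 0"
      if t: "t \<in> K" for t
    proof -
      let ?DT = "dirD ?T (\<sigma> t)" and ?DDT = "\<lambda>u. dirD (\<lambda>y. dirD ?T y (\<sigma>' t)) (\<sigma> t) u"
      have lin: "linear (dirD ?T (\<sigma> s))" if "s \<in> K" for s
        by (rule transition_derivative_linear[OF c c' KO[OF that]])
      have lin2: "linear ?DDT"
        by (rule linear_frechet_derivative[OF smooth_on_differentiable[OF smooth_on_dirD[OF
          smooth_transition[OF c c']] KO[OF t]]])
      have d2: "((\<lambda>s. dirD ?T (\<sigma> s) w) has_vector_derivative dirD (\<lambda>y. dirD ?T y w) (\<sigma> t) (\<sigma>' t)) (at t)" for w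
        by (rule d1[OF t smooth_on_dirD[OF smooth_transition[OF c c']]])
      \<comment> \<open>The first term leads to the second derivative of the chart change, the
        second to the acceleration of \<sigma>.\<close>
      have "((\<lambda>s. dirD ?T (\<sigma> s) (\<sigma>' s)) has_derivative (\<lambda>h. dirD (\<lambda>s. dirD ?T (\<sigma> s) (\<sigma>' t)) t h
          + ?DT (h *\<^sub>R (- G c (\<sigma> t) (\<sigma>' t) (\<sigma>' t))))) (at t)"
        using d2 \<sigma>(5)[OF KJ[OF t]]
        by (intro has_derivative_linear_family[OF K t lin])
          (auto simp: has_vector_derivative_def differentiable_def)
      moreover have "dirD (\<lambda>s. dirD ?T (\<sigma> s) (\<sigma>' t)) t h = h *\<^sub>R ?DDT (\<sigma>' t)" for h
        by (rule dirD_eqI[OF d2[of "\<sigma>' t", unfolded has_vector_derivative_def]])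
      ultimately have "((\<lambda>s. dirD ?T (\<sigma> s) (\<sigma>' s)) has_vector_derivative
          ?DDT (\<sigma>' t) + ?DT (- G c (\<sigma> t) (\<sigma>' t) (\<sigma>' t))) (at t)"
        by (simp add: has_vector_derivative_def linear_cmul[OF lin[OF t]] scaleR_add_right
            scaleR_diff_right linear_neg[OF lin[OF t]])
      then have "((\<lambda>s. vector_derivative (\<lambda>t. ?T (\<sigma> t)) (at s)) has_vector_derivative
          ?DDT (\<sigma>' t) + ?DT (- G c (\<sigma> t) (\<sigma>' t) (\<sigma>' t))) (at t)"
        by (rule has_vector_derivative_transform_within_open[OF _ K t]) (simp add: \<tau>')
      then have "cov_along G c' (\<lambda>t. ?T (\<sigma> t)) (\<lambda>s. vector_derivative (\<lambda>t. ?T (\<sigma> t)) (at s)) t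
          = ?DDT (\<sigma>' t) - ?DT (G c (\<sigma> t) (\<sigma>' t) (\<sigma>' t)) + G c' (?T (\<sigma> t)) (?DT (\<sigma>' t)) (?DT (\<sigma>' t))"
        unfolding cov_along_def by (simp add: vector_derivative_at \<tau>'[OF t] linear_neg[OF lin[OF t]])
      then show ?thesis
        using connection_law[OF G c c' KO[OF t], of "\<sigma>' t" "\<sigma>' t"] by (simp add: algebra_simps)
    qed
    moreover have "vector_derivative (\<lambda>t. ?T (\<sigma> t)) (at t) \<noteq> 0" if "t \<in> K" for t
      unfolding \<tau>'[OF that] by (rule transition_derivative_nonzero[OF c c' KO[OF that] \<sigma>(3)[OF KJ[OF that]]])
    moreover have "\<exists>k. 0 = k *\<^sub>R w" for w :: "real ^ 'n" by (rule exI[of _ 0]) simp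
    ultimately show ?thesis
      using sm unfolding \<tau> K_def[symmetric] Let_def by (auto simp: K_def)
  qed
  then show ?thesis
    unfolding unparam_geodesic_on_def smooth_curve_on_def using cont by blast
qed

text \<open>The D-geodesic with initial velocity u has D-acceleration 0, so at time 0 its
  G-acceleration is G(u, u) - D(u, u), and this has to be a multiple of u.\<close>

lemma projectively_equivalent_imp:
  assumes D: "affine_connection A D" and G: "affine_connection A G"
    and proj: "projectively_equivalent A G D" and c: "c \<in> A" and x: "x \<in> img c"
  shows "\<exists>k. G c x u u - D c x u u = k *\<^sub>R u"
proof (cases "u = 0")
  case True
  have "bilinear (G c x)" "bilinear (D c x)"
    using connection_field[OF D c] connection_field[OF G c] x by (auto simp: bilinear_field_on_def)
  then show ?thesis by (simp add: True bilinear_lzero)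
next
  case False
  obtain e \<sigma> \<sigma>' where e: "0 < e" and \<sigma>: "\<sigma> 0 = x" "\<sigma>' 0 = u" "\<sigma> ` {-e<..<e} \<subseteq> img c"
    "smooth_on {-e<..<e} \<sigma>" "\<And>t. t \<in> {-e<..<e} \<Longrightarrow> \<sigma>' t \<noteq> 0"
    "\<And>t. t \<in> {-e<..<e} \<Longrightarrow> (\<sigma> has_vector_derivative \<sigma>' t) (at t)"
    "\<And>t. t \<in> {-e<..<e} \<Longrightarrow> (\<sigma>' has_vector_derivative - D c (\<sigma> t) (\<sigma>' t) (\<sigma>' t)) (at t)"
    using geodesic_exists[OF chart_param(6)[OF c] x connection_field[OF D c] False] by metis
  let ?J = "{-e<..<e}" and ?\<gamma> = "param c \<circ> \<sigma>"
  let ?\<tau> = "coord c \<circ> ?\<gamma>"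
  have "unparam_geodesic_on A D ?J ?\<gamma>"
    by (rule geodesic_unparam[OF D c _ \<sigma>(3-7)]) auto
  then have "unparam_geodesic_on A G ?J ?\<gamma>"
    using proj by (simp add: projectively_equivalent_def is_interval_def)
  moreover have "0 \<in> ?J" using e by simp
  moreover have "?\<gamma> 0 \<in> dom_of c" using chart_param(1)[OF c x] by (simp add: \<sigma>)
  ultimately obtain k where k: "cov_along G c ?\<tau> (\<lambda>s. vector_derivative ?\<tau> (at s)) 0
      = k *\<^sub>R vector_derivative ?\<tau> (at 0)"
    using c unfolding unparam_geodesic_on_def Let_def by blast
  have \<tau>: "?\<tau> t = \<sigma> t" if "t \<in> ?J" for t
    using that \<sigma>(3) chart_param(2)[OF c, of "\<sigma> t"] by (auto simp: image_subset_iff)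
  have J: "open ?J" by simp
  have \<tau>': "vector_derivative ?\<tau> (at t) = \<sigma>' t" if "t \<in> ?J" for t
    by (rule vector_derivative_at, rule has_vector_derivative_transform_within_open[OF \<sigma>(6)[OF that] J that])
      (rule \<tau>[symmetric])
  have "vector_derivative (\<lambda>s. vector_derivative ?\<tau> (at s)) (at 0) = - D c (\<sigma> 0) (\<sigma>' 0) (\<sigma>' 0)"
    using e by (intro vector_derivative_at has_vector_derivative_transform_within_open[OF \<sigma>(7) J])
      (auto simp: \<tau>')
  then have "- D c x u u + G c x u u = k *\<^sub>R u"
    using k e by (simp add: cov_along_def \<tau>' \<tau> \<sigma>(1,2) chart_param(2)[OF c x])
  then show ?thesis by (intro exI[of _ k]) simp
qed

text \<open>The two accelerations of a curve differ by 2 a(\<sigma>') \<sigma>', a multiple of the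
  velocity, so the factor k is merely shifted.\<close>

lemma projectively_equivalentI:
  assumes G: "\<And>c x u v. c \<in> A \<Longrightarrow> x \<in> img c \<Longrightarrow> G c x u v = D c x u v + (a c x u *\<^sub>R v + a c x v *\<^sub>R u)"
  shows "projectively_equivalent A G D"
proof -
  have "(\<exists>k. cov_along G c \<tau> (\<lambda>s. vector_derivative \<tau> (at s)) t = k *\<^sub>R vector_derivative \<tau> (at t)) \<longleftrightarrow>
      (\<exists>k. cov_along D c \<tau> (\<lambda>s. vector_derivative \<tau> (at s)) t = k *\<^sub>R vector_derivative \<tau> (at t))"
    if "c \<in> A" "\<tau> t \<in> img c" for c \<tau> t
  proof -
    let ?v = "vector_derivative \<tau> (at t)" and ?r = "2 * a c (\<tau> t) (vector_derivative \<tau> (at t))"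
    have e: "cov_along G c \<tau> (\<lambda>s. vector_derivative \<tau> (at s)) t
        = cov_along D c \<tau> (\<lambda>s. vector_derivative \<tau> (at s)) t + ?r *\<^sub>R ?v"
      using that by (simp add: cov_along_def G algebra_simps flip: scaleR_2)
    have "w + ?r *\<^sub>R ?v = k *\<^sub>R ?v \<longleftrightarrow> w = (k - ?r) *\<^sub>R ?v" for k w
      by (auto simp: algebra_simps)
    then show ?thesis
      unfolding e by (metis add_diff_cancel)
  qed
  moreover have "(coord c \<circ> \<gamma>) t \<in> img c" if "c \<in> A" "\<gamma> t \<in> dom_of c" for c and \<gamma> :: "real \<Rightarrow> 'm" and t
    using that by (simp add: chart_param)
  ultimately show ?thesis
    unfolding projectively_equivalent_def unparam_geodesic_on_def Let_def by blast
qed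

section \<open>Parallel volume forms and the trace of a connection\<close>

text \<open>Along a line of velocity u, a parallel frame starting at the standard one keeps its
  volume; the derivative at time 0 gives d\<rho> = \<rho> tr G. Symmetry of the second derivatives
  of \<rho>, divided by \<rho>, is the claim.\<close>

lemma incompressible_trace_closed:
  assumes G: "affine_connection A G" and inc: "incompressible A G"
  obtains c W where "c \<in> A" "p \<in> dom_of c" "open W" "coord c p \<in> W" "W \<subseteq> img c"
    "\<And>x u v. x \<in> W \<Longrightarrow> dirD (\<lambda>y. christoffel_trace (G c) y v) x u = dirD (\<lambda>y. christoffel_trace (G c) y u) x v"
proof -
  obtain c W \<rho> where c: "c \<in> A" "p \<in> dom_of c" and W: "open W" "coord c p \<in> W" "W \<subseteq> img c"
    and \<rho>: "smooth_on W \<rho>" "\<And>x. x \<in> W \<Longrightarrow> \<rho> x \<noteq> 0"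
    and par: "\<And>J \<sigma> X s t. open J \<Longrightarrow> is_interval J \<Longrightarrow> smooth_on J \<sigma> \<Longrightarrow> \<sigma> ` J \<subseteq> W \<Longrightarrow>
      (\<And>j. parallel_along G c J \<sigma> (X j)) \<Longrightarrow> s \<in> J \<Longrightarrow> t \<in> J \<Longrightarrow>
      volume_form \<rho> (\<sigma> s) (\<lambda>j. X j s) = volume_form \<rho> (\<sigma> t) (\<lambda>j. X j t)"
    using inc unfolding incompressible_def by metis
  have GW: "bilinear_field_on W (G c)"
    by (rule bilinear_field_on_subset[OF connection_field[OF G c(1)] W(3)])
  let ?\<tau> = "christoffel_trace (G c)"
  have d\<rho>: "dirD \<rho> x u = \<rho> x * ?\<tau> x u" if x: "x \<in> W" for x u
  proof -
    obtain e \<sigma> X where e: "0 < e" and \<sigma>: "\<sigma> 0 = x" "\<sigma> ` {-e<..<e} \<subseteq> W" "smooth_on {-e<..<e} \<sigma>"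
      "\<And>t. t \<in> {-e<..<e} \<Longrightarrow> (\<sigma> has_vector_derivative u) (at t)"
      and X: "\<And>j. X j 0 = axis j 1" "\<And>j. smooth_on {-e<..<e} (X j)"
      "\<And>j t. t \<in> {-e<..<e} \<Longrightarrow> (X j has_vector_derivative - G c (\<sigma> t) u (X j t)) (at t)"
      using parallel_frame_exists[OF W(1) x GW, of u] by metis
    let ?J = "{-e<..<e}" and ?V = "\<lambda>s. volume_form \<rho> (\<sigma> s) (\<lambda>j. X j s)"
    have 0: "0 \<in> ?J" using e by simp
    have "parallel_along G c ?J \<sigma> (X j)" for j
      unfolding parallel_along_def cov_along_def
      by (simp add: X(2) vector_derivative_at[OF X(3)] vector_derivative_at[OF \<sigma>(4)])
    then have const: "?V s = ?V 0" if "s \<in> ?J" for s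
      by (intro par[OF _ _ \<sigma>(3,2) _ that 0]) (auto simp: is_interval_def)
    have "(?V has_real_derivative 0) (at 0)"
      by (rule has_field_derivative_transform_within_open[OF DERIV_const[of "?V 0"] _ 0])
        (simp, rule const[symmetric])
    moreover have "linear (G c x u)" using GW x by (simp add: bilinear_field_on_def bilinear_def)
    then have "(?V has_real_derivative (dirD \<rho> (\<sigma> 0) u - \<rho> (\<sigma> 0) * trace (matrix (G c x u)))
        * det (\<chi> i j. X j 0 $ i)) (at 0)"
      using 0 X(3) \<sigma>(1) by (intro volume_form_derivative \<sigma>(4) smooth_on_has_derivative[OF \<rho>(1)]) (auto simp: x)
    moreover have "(\<chi> i j. X j 0 $ i) = mat 1" by (simp add: X(1) axis_def mat_def vec_eq_iff)
    ultimately show ?thesis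
      using DERIV_unique by (fastforce simp: \<sigma>(1) trace_matrix_christoffel)
  qed
  have sym: "dirD (\<lambda>y. ?\<tau> y v) x u = dirD (\<lambda>y. ?\<tau> y u) x v" if x: "x \<in> W" for x u v
  proof -
    have \<tau>: "((\<lambda>y. ?\<tau> y v) has_derivative dirD (\<lambda>y. ?\<tau> y v) x) (at x)" for v
      using one_form_on_christoffel_trace[OF W(1) GW] x
      by (auto simp: one_form_on_def intro: smooth_on_has_derivative)
    have "dirD (\<lambda>y. dirD \<rho> y v) x u = \<rho> x * dirD (\<lambda>y. ?\<tau> y v) x u + \<rho> x * ?\<tau> x u * ?\<tau> x v" for u v
    proof -
      have "dirD (\<lambda>y. dirD \<rho> y v) x u = dirD (\<lambda>y. \<rho> y * ?\<tau> y v) x u"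
        using dirD_cong[OF W(1) x, of "\<lambda>y. dirD \<rho> y v" "\<lambda>y. \<rho> y * ?\<tau> y v"] d\<rho> by simp
      also have "\<dots> = \<rho> x * dirD (\<lambda>y. ?\<tau> y v) x u + dirD \<rho> x u * ?\<tau> x v"
        by (rule dirD_eqI[OF has_derivative_mult[OF smooth_on_has_derivative[OF \<rho>(1) x] \<tau>]])
      finally show ?thesis by (simp add: d\<rho>[OF x])
    qed
    then show ?thesis
      using second_derivative_symmetric[OF W(1) x \<rho>(1), of v u] \<rho>(2)[OF x] by simp
  qed
  show ?thesis by (rule that[OF c W sym])
qed

text \<open>The equation d\<rho> = \<rho> tr G makes the volume of a parallel frame have zero
  derivative along every curve, hence constant on an interval.\<close>

lemma incompressibleI:
  assumes G: "affine_connection A G"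
    and vol: "\<And>p. \<exists>c\<in>A. \<exists>W \<rho>. p \<in> dom_of c \<and> open W \<and> coord c p \<in> W \<and> W \<subseteq> img c \<and>
        smooth_on W \<rho> \<and> (\<forall>x\<in>W. \<rho> x \<noteq> 0 \<and> (\<forall>u. dirD \<rho> x u = \<rho> x * christoffel_trace (G c) x u))"
  shows "incompressible A G"
proof -
  have *: "volume_form \<rho> (\<sigma> s) (\<lambda>j. X j s) = volume_form \<rho> (\<sigma> t) (\<lambda>j. X j t)"
    if c: "c \<in> A" and W: "W \<subseteq> img c" and \<rho>: "smooth_on W \<rho>"
      "\<And>x u. x \<in> W \<Longrightarrow> dirD \<rho> x u = \<rho> x * christoffel_trace (G c) x u"
      and J: "open J" "is_interval J" and \<sigma>: "smooth_on J \<sigma>" "\<sigma> ` J \<subseteq> W"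
      and X: "\<And>j. parallel_along G c J \<sigma> (X j)" and st: "s \<in> J" "t \<in> J"
    for c W \<rho> J \<sigma> X s t
  proof -
    have "((\<lambda>s. volume_form \<rho> (\<sigma> s) (\<lambda>j. X j s)) has_real_derivative 0) (at t within J)" if t: "t \<in> J" for t
    proof -
      let ?u = "vector_derivative \<sigma> (at t)"
      have \<sigma>t: "\<sigma> t \<in> W" using \<sigma>(2) t by auto
      have d: "(\<sigma> has_vector_derivative ?u) (at t)"
        using smooth_on_differentiable[OF \<sigma>(1) t] by (simp add: vector_derivative_works)
      have "(X j has_vector_derivative - G c (\<sigma> t) ?u (X j t)) (at t)" for j
      proof -
        have "(X j has_vector_derivative vector_derivative (X j) (at t)) (at t)"
          using smooth_on_differentiable[OF _ t, of "X j"] X[of j]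
          by (simp add: parallel_along_def flip: vector_derivative_works)
        moreover have "vector_derivative (X j) (at t) = - G c (\<sigma> t) ?u (X j t)"
          using X[of j] t by (simp add: parallel_along_def cov_along_def eq_neg_iff_add_eq_0)
        ultimately show ?thesis by simp
      qed
      moreover have "linear (G c (\<sigma> t) ?u)"
        using connection_field[OF G c] \<sigma>t W by (auto simp: bilinear_field_on_def bilinear_def)
      ultimately have "((\<lambda>s. volume_form \<rho> (\<sigma> s) (\<lambda>j. X j s)) has_real_derivative
          (dirD \<rho> (\<sigma> t) ?u - \<rho> (\<sigma> t) * trace (matrix (G c (\<sigma> t) ?u))) * det (\<chi> i j. X j t $ i)) (at t)"
        by (intro volume_form_derivative d smooth_on_has_derivative[OF \<rho>(1) \<sigma>t])
      then have "((\<lambda>s. volume_form \<rho> (\<sigma> s) (\<lambda>j. X j s)) has_real_derivative 0) (at t)"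
        by (simp add: \<rho>(2)[OF \<sigma>t] trace_matrix_christoffel)
      then show ?thesis by (rule has_field_derivative_at_within)
    qed
    then show ?thesis
      using has_field_derivative_zero_constant[of J "\<lambda>s. volume_form \<rho> (\<sigma> s) (\<lambda>j. X j s)"] J st
      by (auto simp: is_interval_convex)
  qed
  show ?thesis
    unfolding incompressible_def
  proof
    fix p
    obtain c W \<rho> where c: "c \<in> A" "p \<in> dom_of c" "open W" "coord c p \<in> W" "W \<subseteq> img c"
      "smooth_on W \<rho>" "\<forall>x\<in>W. \<rho> x \<noteq> 0" "\<And>x u. x \<in> W \<Longrightarrow> dirD \<rho> x u = \<rho> x * christoffel_trace (G c) x u"
      using vol[of p] by blast
    have "\<forall>s\<in>J. \<forall>t\<in>J. volume_form \<rho> (\<sigma> s) (\<lambda>j. X j s) = volume_form \<rho> (\<sigma> t) (\<lambda>j. X j t)"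
      if J: "open J \<and> is_interval J \<and> smooth_on J \<sigma> \<and> \<sigma> ` J \<subseteq> W \<and> (\<forall>j. parallel_along G c J \<sigma> (X j))"
      for J \<sigma> X
    proof (intro ballI)
      fix s t assume "s \<in> J" "t \<in> J"
      then show "volume_form \<rho> (\<sigma> s) (\<lambda>j. X j s) = volume_form \<rho> (\<sigma> t) (\<lambda>j. X j t)"
        using J by (intro *[OF c(1,5,6,8), of J]) auto
    qed
    then show "\<exists>c\<in>A. \<exists>W \<rho>. p \<in> dom_of c \<and> open W \<and> coord c p \<in> W \<and> W \<subseteq> img c \<and>
        smooth_on W \<rho> \<and> (\<forall>x\<in>W. \<rho> x \<noteq> 0) \<and>
        (\<forall>J \<sigma> X. open J \<and> is_interval J \<and> smooth_on J \<sigma> \<and> \<sigma> ` J \<subseteq> W \<and>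
           (\<forall>j. parallel_along G c J \<sigma> (X j)) \<longrightarrow>
           (\<forall>s\<in>J. \<forall>t\<in>J. volume_form \<rho> (\<sigma> s) (\<lambda>j. X j s) = volume_form \<rho> (\<sigma> t) (\<lambda>j. X j t)))"
      by (intro bexI[OF _ c(1)] exI[of _ W] exI[of _ \<rho>] conjI c(2-7) allI impI)
  qed
qed

text \<open>The scalar part a(u) v contributes d a(u) to the trace, the part a(v) u of rank at most
  one contributes a(u).\<close>

lemma christoffel_trace_projective_change:
  assumes "linear (a x)" "\<And>v. G x u v = D x u v + (a x u *\<^sub>R v + a x v *\<^sub>R u)"
  shows "christoffel_trace G x u = christoffel_trace D x u + (real CARD('n) + 1) * a x (u :: real ^ 'n)"
proof -
  have "a x u = a x (\<Sum>i\<in>UNIV. (u $ i) *\<^sub>R axis i 1)"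
    using basis_expansion[of u] by (simp add: scalar_mult_eq_scaleR)
  then have "a x u = (\<Sum>i\<in>UNIV. a x (axis i 1) * u $ i)"
    by (simp add: linear_sum[OF assms(1)] linear_cmul[OF assms(1)] mult.commute)
  then show ?thesis
    by (simp add: christoffel_trace_def assms(2) sum.distrib axis_def algebra_simps)
qed

end

section \<open>Hybrid connections\<close>

lemma curvature_curv: "curvature G c = curv (G c)"
  by (simp add: fun_eq_iff curvature_def cov_deriv_def curv_def)

lemma hessian_cov_form: "hessian D c f x u v = cov_form (D c) (dirD (f \<circ> param c)) x u v"
  by (simp add: hessian_def differential_def cov_form_def)

locale hessian_mfd =
  fixes A :: "('m::{t2_space,second_countable_topology}, 'n::finite) chart set"
    and D :: "('m, 'n) connection"
    and g :: "('m, 'n) bilinear_field"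
  assumes hessian_manifold: "hessian_manifold A D g"

sublocale hessian_mfd \<subseteq> smooth_atlas A
  by unfold_locales (use hessian_manifold in \<open>simp add: hessian_manifold_def\<close>)

context hessian_mfd
begin

lemma D_affine: "affine_connection A D"
  using hessian_manifold by (simp add: hessian_manifold_def flat_affine_connection_def)

lemmas D_field = connection_field[OF D_affine]

lemma D_sym: "c \<in> A \<Longrightarrow> x \<in> img c \<Longrightarrow> D c x u v = D c x v u"
  using hessian_manifold
  unfolding hessian_manifold_def flat_affine_connection_def torsion_free_def by blast

lemma D_flat: "c \<in> A \<Longrightarrow> x \<in> img c \<Longrightarrow> curv (D c) x u v w = 0"
  using hessian_manifold
  unfolding hessian_manifold_def flat_affine_connection_def curvature_curv by blast

lemma metric: "pseudo_riemannian_metric A g"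
  using hessian_manifold by (simp add: hessian_manifold_def)

lemma g_field: "c \<in> A \<Longrightarrow> bilinear_field_on (img c) (g c)"
  using metric unfolding pseudo_riemannian_metric_def bilinear_field_on_def by blast

lemma g_bilinear: "c \<in> A \<Longrightarrow> x \<in> img c \<Longrightarrow> bilinear (g c x)"
  using g_field by (auto simp: bilinear_field_on_def)

lemma g_sym: "c \<in> A \<Longrightarrow> x \<in> img c \<Longrightarrow> g c x u v = g c x v u"
  using metric unfolding pseudo_riemannian_metric_def by blast

lemma g_nondegenerate: "c \<in> A \<Longrightarrow> x \<in> img c \<Longrightarrow> (\<And>v. g c x u v = 0) \<Longrightarrow> u = 0"
  using metric unfolding pseudo_riemannian_metric_def by blast

lemma g_law:
  "c \<in> A \<Longrightarrow> c' \<in> A \<Longrightarrow> x \<in> overlap c c' \<Longrightarrow>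
    g c' (transition c c' x) (dirD (transition c c') x u) (dirD (transition c c') x v) = g c x u v"
  using metric unfolding pseudo_riemannian_metric_def Let_def by blast

lemma dim: "2 \<le> DIM(real ^ 'n)"
  using hessian_manifold by (simp add: hessian_manifold_def)

lemma g_nonzero:
  assumes "c \<in> A" "x \<in> img c" "u \<noteq> 0"
  shows "\<exists>v. g c x u v \<noteq> 0"
  using g_nondegenerate[OF assms(1,2)] assms(3) by blast

text \<open>Locally g = D df, so the Ricci identity expresses the left side by the curvature of
  \<open>D\<close>, which vanishes.\<close>

lemma g_codazzi:
  assumes c: "c \<in> A" and x: "x \<in> img c"
  shows "codazzi (D c) (g c) x u v w = 0"
proof -
  obtain U f where U: "open U" "param c x \<in> U" and f: "hessian_potential_on A D g U f"
    using hessian_manifold unfolding hessian_manifold_def by blast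
  let ?V = "coord c ` (dom_of c \<inter> U)"
  have V: "open ?V" "x \<in> ?V" "?V \<subseteq> img c"
    using open_coord_image[OF chart[OF c] U(1)] x U(2) by (auto simp: coord_image_eq[OF chart[OF c]])
  have f': "smooth_on ?V (f \<circ> param c)"
    "\<And>y u v. y \<in> ?V \<Longrightarrow> g c y u v = cov_form (D c) (dirD (f \<circ> param c)) y u v"
    using f c by (auto simp: hessian_potential_on_def smooth_fun_on_def hessian_cov_form)
  have "codazzi (D c) (g c) x u v w = codazzi (D c) (cov_form (D c) (dirD (f \<circ> param c))) x u v w"
    by (rule codazzi_cong[OF V(1,2) f'(2)])
  also have "\<dots> = - dirD (f \<circ> param c) x (curv (D c) x u v w)"
    by (rule codazzi_cov_form[OF V(1,2) one_form_on_dirD[OF f'(1)] bilinear_field_on_subset[OF D_field[OF c] V(3)]])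
  also have "\<dots> = 0"
    using linear_0[OF linear_frechet_derivative[OF smooth_on_differentiable[OF f'(1) V(2)]]]
    by (simp add: D_flat[OF c x])
  finally show ?thesis .
qed

text \<open>Fields constant in the chart isolate the Christoffel symbols; for other fields the
  derivative terms on both sides coincide.\<close>

lemma logarithmic_potential_iff:
  "logarithmic_potential A D G f \<longleftrightarrow> (\<forall>c\<in>A. \<forall>x\<in>img c. \<forall>u v. G c x u v = D c x u v
     - (1 / f (param c x)) *\<^sub>R (differential c f x u *\<^sub>R v + differential c f x v *\<^sub>R u))"
proof
  assume L: "logarithmic_potential A D G f"
  show "\<forall>c\<in>A. \<forall>x\<in>img c. \<forall>u v. G c x u v = D c x u v
     - (1 / f (param c x)) *\<^sub>R (differential c f x u *\<^sub>R v + differential c f x v *\<^sub>R u)"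
  proof (intro ballI allI)
    fix c x and u v :: "real ^ 'n" assume c: "c \<in> A" "x \<in> img c"
    have "smooth_on (img c) (\<lambda>y. v)" by (rule smooth_on_const[OF chart_param(6)[OF c(1)]])
    then have "cov_deriv G c (\<lambda>y. v) x u = cov_deriv D c (\<lambda>y. v) x u
        - (1 / f (param c x)) *\<^sub>R (differential c f x u *\<^sub>R v + differential c f x v *\<^sub>R u)"
      using L c chart_param(6)[OF c(1)] unfolding logarithmic_potential_def by blast
    then show "G c x u v = D c x u v
        - (1 / f (param c x)) *\<^sub>R (differential c f x u *\<^sub>R v + differential c f x v *\<^sub>R u)"
      by (simp add: cov_deriv_def)
  qed
next
  assume "\<forall>c\<in>A. \<forall>x\<in>img c. \<forall>u v. G c x u v = D c x u v
     - (1 / f (param c x)) *\<^sub>R (differential c f x u *\<^sub>R v + differential c f x v *\<^sub>R u)"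
  then show "logarithmic_potential A D G f"
    unfolding logarithmic_potential_def cov_deriv_def by (auto simp: subset_iff algebra_simps)
qed

lemma differential_transform:
  assumes "smooth_fun_on A UNIV f" "c \<in> A" "c' \<in> A" "x \<in> overlap c c'"
  shows "dirD (f \<circ> param c) x u = dirD (f \<circ> param c') (transition c c' x) (dirD (transition c c') x u)"
proof -
  have "smooth_on (img c') (f \<circ> param c')"
    using assms(1,3) by (simp add: smooth_fun_on_def img_def)
  then have "((\<lambda>y. (f \<circ> param c') (transition c c' y)) has_derivative
      (\<lambda>u. dirD (f \<circ> param c') (transition c c' x) (dirD (transition c c') x u))) (at x)"
    by (intro has_derivative_compose[OF smooth_on_has_derivative[OF smooth_transition[OF assms(2,3)] assms(4)]]
        smooth_on_has_derivative[of "img c'"] transition_overlap(3)[OF assms(2-4)])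
  then have "((f \<circ> param c) has_derivative
      (\<lambda>u. dirD (f \<circ> param c') (transition c c' x) (dirD (transition c c') x u))) (at x)"
    by (rule has_derivative_transform_within_open[OF _ open_overlap[OF assms(2,3)] assms(4)])
      (simp add: transition_overlap(1)[OF assms(2,3)])
  then show ?thesis by (rule dirD_eqI)
qed

lemma hybrid_curvature:
  assumes c: "c \<in> A" and x: "x \<in> img c" and a: "one_form_on (img c) a"
    and G: "\<And>x u v. x \<in> img c \<Longrightarrow> G c x u v = D c x u v + (a x u *\<^sub>R v + a x v *\<^sub>R u)"
    and closed: "\<And>u v. cov_form (D c) a x u v = cov_form (D c) a x v u"
  shows "curvature G c x u v w = (cov_form (D c) a x u w - a x u * a x w) *\<^sub>R v
    - (cov_form (D c) a x v w - a x v * a x w) *\<^sub>R u"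
  unfolding curvature_curv
  using curv_projective_change[where G = "G c", OF chart_param(6)[OF c] x a D_field[OF c] D_sym[OF c x] closed G]
  by (simp add: D_flat[OF c x])

section \<open>From a hybrid connection to its potential\<close>

lemma hybrid_difference_form:
  assumes "hybrid_connection A D g G"
  obtains a where "\<And>c. c \<in> A \<Longrightarrow> one_form_on (img c) (a c)"
    "\<And>c x u v. c \<in> A \<Longrightarrow> x \<in> img c \<Longrightarrow> G c x u v = D c x u v + (a c x u *\<^sub>R v + a c x v *\<^sub>R u)"
proof
  have G: "affine_connection A G" "torsion_free A G" "projectively_equivalent A G D"
    using assms by (auto simp: hybrid_connection_def)
  \<comment> \<open>Defining the form by the trace formula, rather than choosing it at each point,
    lets it inherit smoothness from the connections.\<close>
  define a where "a c x u = inverse (real CARD('n) + 1) *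
    (christoffel_trace (G c) x u - christoffel_trace (D c) x u)" for c x u
  fix c assume c: "c \<in> A"
  have "one_form_on (img c) (christoffel_trace (G c))" "one_form_on (img c) (christoffel_trace (D c))"
    by (intro one_form_on_christoffel_trace chart_param(6)[OF c] connection_field[OF _ c] G D_affine)+
  then show "one_form_on (img c) (a c)"
    unfolding one_form_on_def a_def
    by (auto intro!: smooth_on_mult smooth_on_const smooth_on_diff chart_param(6)[OF c] linearI
        simp: linear_add linear_cmul algebra_simps)
  fix x u v assume x: "x \<in> img c"
  define S where "S u v = G c x u v - D c x u v" for u v
  have b: "bilinear (G c x)" "bilinear (D c x)"
    using connection_field[OF G(1) c] D_field[OF c] x by (auto simp: bilinear_field_on_def)
  have "bilinear S"
    using b unfolding bilinear_def S_def by (auto intro!: linear_compose_sub)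
  moreover have "S u v = S v u" for u v
    using G(2) c x D_sym[OF c x] by (simp add: S_def torsion_free_def)
  moreover have "\<exists>k. S u u = k *\<^sub>R u" for u
    unfolding S_def by (rule projectively_equivalent_imp[OF D_affine G(1,3) c x])
  ultimately have "S u v = ((\<Sum>i\<in>UNIV. S u (axis i 1) $ i) / (real CARD('n) + 1)) *\<^sub>R v
      + ((\<Sum>i\<in>UNIV. S v (axis i 1) $ i) / (real CARD('n) + 1)) *\<^sub>R u"
    by (rule symmetric_bilinear_projective)
  moreover have "(\<Sum>i\<in>UNIV. S u (axis i 1) $ i) / (real CARD('n) + 1) = a c x u" for u
    by (simp add: S_def a_def christoffel_trace_def sum_subtractf divide_inverse)
  ultimately have "S u v = a c x u *\<^sub>R v + a c x v *\<^sub>R u" by simp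
  then show "G c x u v = D c x u v + (a c x u *\<^sub>R v + a c x v *\<^sub>R u)"
    by (simp add: S_def algebra_simps)
qed

text \<open>Inhomogeneous terms cancel in G - D, which is therefore a tensor. On the diagonal it is
  2 a(u) u, and since the image of u is nonzero the coefficients can be compared.\<close>

lemma difference_form_transform:
  assumes G: "affine_connection A G"
    and a: "\<And>c. c \<in> A \<Longrightarrow> one_form_on (img c) (a c)"
    "\<And>c x u v. c \<in> A \<Longrightarrow> x \<in> img c \<Longrightarrow> G c x u v = D c x u v + (a c x u *\<^sub>R v + a c x v *\<^sub>R u)"
    and c: "c \<in> A" "c' \<in> A" and x: "x \<in> overlap c c'"
  shows "a c x u = a c' (transition c c' x) (dirD (transition c c') x u)"
proof -
  let ?T = "transition c c'"
  let ?u = "dirD ?T x u"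
  have xi: "x \<in> img c" "?T x \<in> img c'"
    using x c transition_overlap(3)[OF c x] by (auto simp: overlap_iff)
  note lin = transition_derivative_linear[OF c x]
  show ?thesis
  proof (cases "u = 0")
    case True
    then show ?thesis
      using a(1)[OF c(1)] a(1)[OF c(2)] xi linear_0[OF lin] by (simp add: one_form_on_def linear_0)
  next
    case False
    have "(2 * a c' (?T x) ?u) *\<^sub>R ?u = G c' (?T x) ?u ?u - D c' (?T x) ?u ?u"
      unfolding a(2)[OF c(2) xi(2)] by (simp flip: scaleR_left_distrib)
    also have "\<dots> = dirD ?T x (G c x u u) - dirD ?T x (D c x u u)"
      by (simp flip: connection_law[OF G c x] connection_law[OF D_affine c x])
    also have "\<dots> = dirD ?T x ((2 * a c x u) *\<^sub>R u)"
      unfolding a(2)[OF c(1) xi(1)] by (simp flip: scaleR_left_distrib linear_diff[OF lin])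
    also have "\<dots> = (2 * a c x u) *\<^sub>R ?u" by (rule linear_cmul[OF lin])
    finally show ?thesis
      using transition_derivative_nonzero[OF c x False] by simp
  qed
qed

lemma cov_difference_form_transform:
  assumes a: "\<And>c. c \<in> A \<Longrightarrow> one_form_on (img c) (a c)"
    "\<And>c c' x u. c \<in> A \<Longrightarrow> c' \<in> A \<Longrightarrow> x \<in> overlap c c' \<Longrightarrow>
      a c x u = a c' (transition c c' x) (dirD (transition c c') x u)"
    and c: "c \<in> A" "c' \<in> A" and x: "x \<in> overlap c c'"
  shows "cov_form (D c) (a c) x u v = cov_form (D c') (a c') (transition c c' x)
    (dirD (transition c c') x u) (dirD (transition c c') x v)"
proof (rule cov_form_transform[OF open_overlap[OF c] x smooth_transition[OF c] _ _ a(1)[OF c(2)]])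
  show "transition c c' ` overlap c c' \<subseteq> img c'" using transition_overlap(3)[OF c] by auto
  show "open (img c')" by (rule chart_param(6)[OF c(2)])
qed (use a(2)[OF c] connection_law[OF D_affine c x] in auto)

text \<open>Incompressibility provides a closed tr G only in some chart near the point. There,
  subtracting the closed tr D isolates (d + 1) a, and tensoriality of Da carries symmetry to the
  given chart.\<close>

lemma difference_form_closed:
  assumes G: "affine_connection A G" "incompressible A G"
    and a: "\<And>c. c \<in> A \<Longrightarrow> one_form_on (img c) (a c)"
    "\<And>c x u v. c \<in> A \<Longrightarrow> x \<in> img c \<Longrightarrow> G c x u v = D c x u v + (a c x u *\<^sub>R v + a c x v *\<^sub>R u)"
    and c: "c \<in> A" and x: "x \<in> img c"
  shows "cov_form (D c) (a c) x u v = cov_form (D c) (a c) x v u"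
proof -
  obtain c' W where c': "c' \<in> A" "param c x \<in> dom_of c'" and W: "open W" "coord c' (param c x) \<in> W" "W \<subseteq> img c'"
    and tr: "\<And>x u v. x \<in> W \<Longrightarrow>
      dirD (\<lambda>y. christoffel_trace (G c') y v) x u = dirD (\<lambda>y. christoffel_trace (G c') y u) x v"
    using incompressible_trace_closed[OF G] by metis
  have xo: "x \<in> overlap c c'" using x c'(2) by (simp add: overlap_iff[OF c])
  let ?x = "transition c c' x"
  have xW: "?x \<in> W" using W(2) by (simp add: transition_def)
  then have xi: "?x \<in> img c'" using W(3) by auto
  have lin: "linear (a c' y)" if "y \<in> W" for y
    using a(1)[OF c'(1)] W(3) that by (auto simp: one_form_on_def)
  have "one_form_on W (christoffel_trace (D c'))"
    by (rule one_form_on_subset[OF one_form_on_christoffel_trace[OF chart_param(6)[OF c'(1)] D_field[OF c'(1)]] W(3)])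
  then have sD: "smooth_on W (\<lambda>y. christoffel_trace (D c') y u)" for u by (simp add: one_form_on_def)
  have sa: "smooth_on W (\<lambda>y. a c' y u)" for u
    using one_form_on_subset[OF a(1)[OF c'(1)] W(3)] by (simp add: one_form_on_def)
  have dG: "dirD (\<lambda>y. christoffel_trace (G c') y v) ?x u = dirD (\<lambda>y. christoffel_trace (D c') y v) ?x u
      + (real CARD('n) + 1) * dirD (\<lambda>y. a c' y v) ?x u" for u v
  proof -
    have "dirD (\<lambda>y. christoffel_trace (G c') y v) ?x u
        = dirD (\<lambda>y. christoffel_trace (D c') y v + (real CARD('n) + 1) * a c' y v) ?x u"
      by (rule fun_cong[OF dirD_cong[OF W(1) xW]], rule christoffel_trace_projective_change[where a = "a c'", OF lin])
        (use a(2)[OF c'(1)] W(3) in auto)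
    also have "\<dots> = dirD (\<lambda>y. christoffel_trace (D c') y v) ?x u + (real CARD('n) + 1) * dirD (\<lambda>y. a c' y v) ?x u"
      by (intro dirD_eqI[OF has_derivative_add] has_derivative_mult_right smooth_on_has_derivative[OF _ xW] sD sa)
    finally show ?thesis .
  qed
  have "dirD (\<lambda>y. christoffel_trace (D c') y v) ?x u = dirD (\<lambda>y. christoffel_trace (D c') y u) ?x v" for u v
    by (rule christoffel_trace_closed[OF chart_param(6)[OF c'(1)] xi D_field[OF c'(1)] D_flat[OF c'(1) xi]])
  then have "dirD (\<lambda>y. a c' y v) ?x u = dirD (\<lambda>y. a c' y u) ?x v" for u v
    using tr[OF xW, of v u] unfolding dG by simp
  then have "cov_form (D c') (a c') ?x u v = cov_form (D c') (a c') ?x v u" for u v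
    by (simp add: cov_form_def D_sym[OF c'(1) xi, of u v])
  moreover have "cov_form (D c) (a c) x u v
      = cov_form (D c') (a c') ?x (dirD (transition c c') x u) (dirD (transition c c') x v)" for u v
    by (rule cov_difference_form_transform[OF a(1) _ c c'(1) xo], assumption,
        rule difference_form_transform[OF G(1) a]) auto
  ultimately show ?thesis by simp
qed

lemma curvature_proportional:
  assumes "hybrid_connection A D g G"
    and a: "\<And>c. c \<in> A \<Longrightarrow> one_form_on (img c) (a c)"
    "\<And>c x u v. c \<in> A \<Longrightarrow> x \<in> img c \<Longrightarrow> G c x u v = D c x u v + (a c x u *\<^sub>R v + a c x v *\<^sub>R u)"
    and c: "c \<in> A" and x: "x \<in> img c"
  shows "\<exists>l. l \<noteq> 0 \<and> (\<forall>u v. cov_form (D c) (a c) x u v - a c x u * a c x v = l * g c x u v)"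
proof -
  have G: "affine_connection A G" "incompressible A G" "infinitesimally_conformal A g G"
    "\<exists>u v w. curvature G c x u v w \<noteq> 0"
    using assms(1) c x by (auto simp: hybrid_connection_def)
  define P where "P u v = cov_form (D c) (a c) x u v - a c x u * a c x v" for u v
  have closed: "cov_form (D c) (a c) x u v = cov_form (D c) (a c) x v u" for u v
    by (rule difference_form_closed[OF G(1,2) a c x])
  have curv: "curvature G c x u v w = P u w *\<^sub>R v - P v w *\<^sub>R u" for u v w
    unfolding P_def by (rule hybrid_curvature[where a = "a c" and G = G and c = c, OF c x a(1)[OF c] a(2)[OF c] closed])
  have la: "linear (a c x)" using a(1)[OF c] x by (simp add: one_form_on_def)
  have bD: "bilinear (D c x)" using D_field[OF c] x by (simp add: bilinear_field_on_def)
  have Psym: "P u v = P v u" for u v using closed[of u v] by (simp add: P_def mult.commute)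
  have "linear (P u)" for u
  proof -
    have lin: "linear (\<lambda>w. dirD (\<lambda>y. a c y w) x u)"
      using a(1)[OF c] x
      by (intro linear_dirD_linear_family[OF chart_param(6)[OF c] x])
        (auto simp: one_form_on_def intro: smooth_on_differentiable)
    show ?thesis
      by (intro linearI)
        (simp_all add: P_def cov_form_def linear_add[OF la] linear_cmul[OF la] linear_add[OF lin]
          linear_cmul[OF lin] bilinear_radd[OF bD] bilinear_rmul[OF bD]
          algebra_simps)
  qed
  moreover have "(\<lambda>u. P u v) = P v" for v by (rule ext) (rule Psym)
  ultimately have P: "bilinear P" unfolding bilinear_def by simp
  have sim: "infinitesimal_similarity (g c x) (\<lambda>w. - (P u w *\<^sub>R v - P v w *\<^sub>R u))" for u v
    unfolding curv[symmetric]
    using G(3) c x unfolding infinitesimally_conformal_def holonomy_generator_def by blast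
  have "\<exists>l. \<forall>u v. P u v = l * g c x u v"
    by (rule similarity_imp_proportional[OF g_bilinear[OF c x] g_sym[OF c x] _ P Psym sim])
      (rule g_nondegenerate[OF c x])
  then obtain l where l: "\<And>u v. P u v = l * g c x u v" by blast
  moreover have "l \<noteq> 0" using G(4) unfolding curv l by auto
  ultimately show ?thesis unfolding P_def by blast
qed

theorem hybrid_imp_potential:
  assumes hyb: "hybrid_connection A D g G"
  shows "\<exists>\<psi>. (\<forall>p. \<psi> p \<noteq> 0) \<and> hessian_potential_on A D g UNIV \<psi> \<and> logarithmic_potential A D G \<psi>"
proof -
  have G: "affine_connection A G" "incompressible A G"
    using hyb by (auto simp: hybrid_connection_def)
  obtain a where a: "\<And>c. c \<in> A \<Longrightarrow> one_form_on (img c) (a c)"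
    "\<And>c x u v. c \<in> A \<Longrightarrow> x \<in> img c \<Longrightarrow> G c x u v = D c x u v + (a c x u *\<^sub>R v + a c x v *\<^sub>R u)"
    using hybrid_difference_form[OF hyb] by metis
  have closed: "cov_form (D c) (a c) x u v = cov_form (D c) (a c) x v u"
    if "c \<in> A" "x \<in> img c" for c x u v
    by (rule difference_form_closed[OF G a that])
  have a_law: "a c x u = a c' (transition c c' x) (dirD (transition c c') x u)"
    if "c \<in> A" "c' \<in> A" "x \<in> overlap c c'" for c c' x u
    by (rule difference_form_transform[OF G(1) a that])
  define P where "P c x u v = cov_form (D c) (a c) x u v - a c x u * a c x v" for c x u v
  have "\<exists>l. \<forall>c\<in>A. \<forall>x\<in>img c. l c x \<noteq> 0 \<and> (\<forall>u v. P c x u v = l c x * g c x u v)"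
    using curvature_proportional[OF hyb a] unfolding P_def by metis
  then obtain l where l: "\<And>c x. c \<in> A \<Longrightarrow> x \<in> img c \<Longrightarrow> l c x \<noteq> 0"
    "\<And>c x u v. c \<in> A \<Longrightarrow> x \<in> img c \<Longrightarrow> P c x u v = l c x * g c x u v"
    by blast
  have g_ex: "\<exists>u v. g c x u v \<noteq> 0" if "c \<in> A" "x \<in> img c" for c x
    using g_nonzero[OF that, of "axis undefined 1"] by auto
  \<comment> \<open>Since \<open>g\<close> is nonzero on some pair of vectors, the ratio of the two
    tensors on that pair determines l independently of the chart.\<close>
  have l_law: "l c x = l c' (transition c c' x)" if c: "c \<in> A" "c' \<in> A" and x: "x \<in> overlap c c'" for c c' x
  proof -
    have xi: "x \<in> img c" "transition c c' x \<in> img c'"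
      using x c transition_overlap(3)[OF c x] by (auto simp: overlap_iff)
    obtain u v where uv: "g c x u v \<noteq> 0" using g_ex[OF c(1) xi(1)] by blast
    have "l c x * g c x u v = P c x u v" by (rule l(2)[OF c(1) xi(1), symmetric])
    also have "\<dots> = P c' (transition c c' x) (dirD (transition c c') x u) (dirD (transition c c') x v)"
    proof -
      have "cov_form (D c) (a c) x u v = cov_form (D c') (a c') (transition c c' x)
          (dirD (transition c c') x u) (dirD (transition c c') x v)"
        by (rule cov_difference_form_transform[OF a(1) a_law c x])
      then show ?thesis by (simp add: P_def a_law[OF c x])
    qed
    also have "\<dots> = l c' (transition c c' x) * g c x u v"
      unfolding l(2)[OF c(2) xi(2)] g_law[OF c x] ..
    finally show ?thesis using uv by simp
  qed
  \<comment> \<open>Near each point l is the quotient of P and \<open>g\<close> on two fixed vectors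
    on which \<open>g\<close> does not vanish.\<close>
  have l_smooth: "smooth_on (img c) (l c)" if c: "c \<in> A" for c
  proof (rule smooth_on_locally)
    fix x assume x: "x \<in> img c"
    obtain u v where uv: "g c x u v \<noteq> 0" using g_ex[OF c x] by blast
    have gs: "smooth_on (img c) (\<lambda>y. g c y u v)" using g_field[OF c] by (simp add: bilinear_field_on_def)
    define V where "V = {y \<in> img c. g c y u v \<noteq> 0}"
    have "open (img c \<inter> (\<lambda>y. g c y u v) -` (- {0}))"
      by (rule continuous_open_preimage[OF smooth_on_continuous_on[OF gs] chart_param(6)[OF c]]) auto
    then have V: "open V" by (simp add: V_def Int_def vimage_def)
    have sub: "V \<subseteq> img c" by (auto simp: V_def)
    have "smooth_on (img c) (\<lambda>y. a c y u)" for u using a(1)[OF c] by (simp add: one_form_on_def)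
    then have "smooth_on (img c) (\<lambda>y. P c y u v)"
      unfolding P_def
      by (intro smooth_on_diff smooth_on_mult one_form_on_cov_smooth[OF _ a(1)[OF c] D_field[OF c]] chart_param(6)[OF c])
    then have "smooth_on V (\<lambda>y. P c y u v * inverse (g c y u v))"
      by (intro smooth_on_mult smooth_on_inverse V smooth_on_subset[OF _ sub] gs) (auto simp: V_def)
    then have "smooth_on V (l c)"
      by (rule smooth_on_cong[OF V, rotated]) (auto simp: V_def l(2)[OF c])
    then show "\<exists>V. open V \<and> x \<in> V \<and> smooth_on V (l c)"
      using V x uv by (auto simp: V_def)
  qed
  have dl: "dirD (l c) x u = l c x * a c x u" if c: "c \<in> A" and x: "x \<in> img c" for c x u
    by (rule conformal_factor_derivative[where g = "g c" and D = "D c" and a = "a c" and l = "l c",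
          OF chart_param(6)[OF c] x a(1)[OF c] D_field[OF c] D_sym[OF c x] D_flat[OF c x]
          closed[OF c x] g_field[OF c] _ g_codazzi[OF c x] l_smooth[OF c] _ dim])
      (rule g_nondegenerate[OF c x], assumption, erule l(2)[OF c, unfolded P_def])
  obtain ch where ch: "\<And>p. ch p \<in> A" "\<And>p. p \<in> dom_of (ch p)"
    using chart_at by metis
  \<comment> \<open>The chart may change from point to point; invariance of l makes the value
    independent of it, so in any fixed chart the function reads - 1 / l and is smooth.\<close>
  define \<psi> where "\<psi> p = - inverse (l (ch p) (coord (ch p) p))" for p
  have \<psi>: "\<psi> (param c x) = - inverse (l c x)" if c: "c \<in> A" and x: "x \<in> img c" for c x
    using l_law[OF c ch(1)[of "param c x"]] ch(2)[of "param c x"] x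
    by (simp add: \<psi>_def overlap_iff[OF c] transition_def)
  have \<psi>0: "\<psi> p \<noteq> 0" for p
    using l(1)[OF ch(1) chart_param(4)[OF ch]] by (simp add: \<psi>_def)
  have dom: "coord c ` (dom_of c \<inter> UNIV) = img c" for c :: "('m, 'n) chart" by (simp add: img_def)
  have d\<psi>: "dirD (\<psi> \<circ> param c) x u = dirD (\<lambda>y. - inverse (l c y)) x u" if "c \<in> A" "x \<in> img c" for c x u
    by (rule fun_cong[OF dirD_cong[OF chart_param(6)[OF that(1)] that(2)]]) (simp add: \<psi>[OF that(1)])
  have "hessian_potential_on A D g UNIV \<psi>"
    unfolding hessian_potential_on_def smooth_fun_on_def dom
  proof (intro conjI ballI allI)
    fix c assume c: "c \<in> A"
    have "smooth_on (img c) (\<lambda>y. - inverse (l c y))"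
      by (intro smooth_on_uminus smooth_on_inverse chart_param(6)[OF c] l_smooth[OF c] l(1)[OF c])
    then show "smooth_on (img c) (\<psi> \<circ> param c)"
      by (rule smooth_on_cong[OF chart_param(6)[OF c], rotated]) (simp add: \<psi>[OF c])
    fix x u v assume x: "x \<in> img c"
    have "hessian D c \<psi> x u v = cov_form (D c) (dirD (\<lambda>y. - inverse (l c y))) x u v"
      unfolding hessian_cov_form by (rule cov_form_cong[OF chart_param(6)[OF c] x d\<psi>[OF c]])
    also have "\<dots> = g c x u v"
      by (rule hessian_potential_of_conformal_factor(2)[where g = "g c" and D = "D c" and a = "a c" and l = "l c",
            OF chart_param(6)[OF c] x a(1)[OF c] D_field[OF c] l_smooth[OF c]])
        (erule l(1)[OF c], erule dl[OF c], rule l(2)[OF c x, unfolded P_def])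
    finally show "hessian D c \<psi> x u v = g c x u v" .
  qed
  moreover have "logarithmic_potential A D G \<psi>"
    unfolding logarithmic_potential_iff
  proof (intro ballI allI)
    fix c x u v assume c: "c \<in> A" and x: "x \<in> img c"
    have "differential c \<psi> x u = - \<psi> (param c x) * a c x u" for u
      unfolding differential_def d\<psi>[OF c x] \<psi>[OF c x]
      by (rule hessian_potential_of_conformal_factor(1)[where g = "g c" and D = "D c" and a = "a c" and l = "l c",
            OF chart_param(6)[OF c] x a(1)[OF c] D_field[OF c] l_smooth[OF c]])
        (erule l(1)[OF c], erule dl[OF c], rule l(2)[OF c x, unfolded P_def], rule x)
    then show "G c x u v = D c x u v
        - (1 / \<psi> (param c x)) *\<^sub>R (differential c \<psi> x u *\<^sub>R v + differential c \<psi> x v *\<^sub>R u)"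
      using \<psi>0[of "param c x"] by (simp add: a(2)[OF c x] scaleR_add_right scaleR_diff_right)
  qed
  ultimately show ?thesis using \<psi>0 by blast
qed

section \<open>From a potential to a hybrid connection\<close>

lemma potential_difference_form:
  assumes \<psi>: "\<And>p. \<psi> p \<noteq> 0" and pot: "hessian_potential_on A D g UNIV \<psi>"
  defines "a \<equiv> \<lambda>c y u. - inverse ((\<psi> \<circ> param c) y) * dirD (\<psi> \<circ> param c) y u"
  assumes c: "c \<in> A"
  shows "one_form_on (img c) (a c)"
    and "\<And>x u v. x \<in> img c \<Longrightarrow> cov_form (D c) (a c) x u v - a c x u * a c x v = - inverse (\<psi> (param c x)) * g c x u v"
    and "\<And>x u v. x \<in> img c \<Longrightarrow> cov_form (D c) (a c) x u v = cov_form (D c) (a c) x v u"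
    and "smooth_on (img c) (\<psi> \<circ> param c)"
proof -
  show s: "smooth_on (img c) (\<psi> \<circ> param c)"
    using pot c by (simp add: hessian_potential_on_def smooth_fun_on_def img_def)
  have h: "cov_form (D c) (dirD (\<psi> \<circ> param c)) x u v = g c x u v" if "x \<in> img c" for x u v
    using pot c that unfolding hessian_potential_on_def hessian_cov_form img_def by auto
  have x: "one_form_on (img c) (a c)"
    "cov_form (D c) (a c) x u v - a c x u * a c x v = - inverse (\<psi> (param c x)) * g c x u v"
    "cov_form (D c) (a c) x u v = cov_form (D c) (a c) x v u" if x: "x \<in> img c" for x u v
    using cov_form_logarithmic_derivative[where D = "D c", OF chart_param(6)[OF c] x s _ D_sym[OF c x]] \<psi>
    unfolding a_def by (simp_all add: h[OF x] del: minus_mult_minus)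
  show "\<And>x u v. x \<in> img c \<Longrightarrow> cov_form (D c) (a c) x u v - a c x u * a c x v = - inverse (\<psi> (param c x)) * g c x u v"
    and "\<And>x u v. x \<in> img c \<Longrightarrow> cov_form (D c) (a c) x u v = cov_form (D c) (a c) x v u"
    by (rule x(2), assumption) (rule x(3))
  show "one_form_on (img c) (a c)"
  \<comment> \<open>The facts collected above are stated at a point of the chart, so a chart with
    empty image is treated apart.\<close>
  proof (cases "img c = {}")
    case True
    have "smooth_on {} f" for f :: "real ^ 'n \<Rightarrow> real" using smooth_on_locally[of "{}" f] by simp
    then show ?thesis by (simp add: True one_form_on_def)
  qed (use x(1) in blast)
qed

theorem potential_imp_hybrid:
  assumes \<psi>: "\<And>p. \<psi> p \<noteq> 0" and pot: "hessian_potential_on A D g UNIV \<psi>"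
    and G: "affine_connection A G" and log: "logarithmic_potential A D G \<psi>"
  shows "hybrid_connection A D g G"
proof -
  define a :: "('m, 'n) chart \<Rightarrow> real ^ 'n \<Rightarrow> real ^ 'n \<Rightarrow> real"
    where "a c y u = - inverse ((\<psi> \<circ> param c) y) * dirD (\<psi> \<circ> param c) y u" for c y u
  have a: "c \<in> A \<Longrightarrow> one_form_on (img c) (a c)"
    "c \<in> A \<Longrightarrow> x \<in> img c \<Longrightarrow> cov_form (D c) (a c) x u v - a c x u * a c x v = - inverse (\<psi> (param c x)) * g c x u v"
    "c \<in> A \<Longrightarrow> x \<in> img c \<Longrightarrow> cov_form (D c) (a c) x u v = cov_form (D c) (a c) x v u"
    "c \<in> A \<Longrightarrow> smooth_on (img c) (\<psi> \<circ> param c)" for c x u v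
    using potential_difference_form[OF \<psi> pot, of c] unfolding a_def[abs_def] by auto
  have Ga: "G c x u v = D c x u v + (a c x u *\<^sub>R v + a c x v *\<^sub>R u)" if "c \<in> A" "x \<in> img c" for c x u v
    using log that unfolding logarithmic_potential_iff
    by (simp add: a_def differential_def scaleR_add_right divide_inverse)
  have curv: "curvature G c x u v w = (- inverse (\<psi> (param c x)) * g c x u w) *\<^sub>R v
      - (- inverse (\<psi> (param c x)) * g c x v w) *\<^sub>R u" if "c \<in> A" "x \<in> img c" for c x u v w
    using hybrid_curvature[where a = "a c" and G = G, OF that a(1)[OF that(1)] Ga[OF that(1)] a(3)[OF that]] by (simp only: a(2)[OF that])
  have "torsion_free A G"
    unfolding torsion_free_def using Ga D_sym by (simp add: add.commute)
  moreover have "projectively_equivalent A G D"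
    by (rule projectively_equivalentI[OF Ga])
  moreover have "incompressible A G"
  proof (rule incompressibleI[OF G])
    fix p
    obtain c where c: "c \<in> A" "p \<in> dom_of c" using chart_at by blast
    obtain r where r: "0 < r" "ball (coord c p) r \<subseteq> img c"
      using chart_param(6)[OF c(1)] chart_param(4)[OF c] openE by blast
    let ?W = "ball (coord c p) r" and ?n = "CARD('n) + 1"
    have \<tau>: "one_form_on ?W (christoffel_trace (D c))"
      by (rule one_form_on_subset[OF one_form_on_christoffel_trace[OF chart_param(6)[OF c(1)] D_field[OF c(1)]] r(2)])
    \<comment> \<open>The trace of \<open>D\<close> vanishes in affine charts but is only closed
      here; restricting the chart to a ball provides a primitive.\<close>
    have "\<exists>F. \<forall>x\<in>?W. (F has_derivative christoffel_trace (D c) x) (at x)"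
    proof -
      have "dirD (\<lambda>y. christoffel_trace (D c) y v) x u = dirD (\<lambda>y. christoffel_trace (D c) y u) x v"
        if "x \<in> ?W" for x u v
        using that r(2)
        by (intro christoffel_trace_closed[OF chart_param(6)[OF c(1)] _ D_field[OF c(1)]] D_flat[OF c(1)]) auto
      then show ?thesis
        using poincare_lemma_ball[of "coord c p" r "christoffel_trace (D c)"] \<tau>
        unfolding one_form_on_def by metis
    qed
    then obtain F where F: "\<And>x. x \<in> ?W \<Longrightarrow> (F has_derivative christoffel_trace (D c) x) (at x)" by blast
    have Fs: "smooth_on ?W F"
      by (rule smooth_onI_has_derivative[OF open_ball F]) (use \<tau> in \<open>auto simp: one_form_on_def\<close>)
    \<comment> \<open>The function 1/\<psi> satisfies dh = h a, so its power d + 1 supplies the term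
      (d + 1) a by which tr G exceeds tr D.\<close>
    define h where "h y = inverse ((\<psi> \<circ> param c) y)" for y
    have s: "smooth_on ?W (\<psi> \<circ> param c)" by (rule smooth_on_subset[OF a(4)[OF c(1)] r(2)])
    have hs: "smooth_on ?W h"
      unfolding h_def by (intro smooth_on_inverse open_ball s) (simp add: \<psi>)
    have dh: "dirD h x u = h x * a c x u" if x: "x \<in> ?W" for x u
    proof -
      have "dirD h x u = - (inverse ((\<psi> \<circ> param c) x) * dirD (\<psi> \<circ> param c) x u * inverse ((\<psi> \<circ> param c) x))"
        unfolding h_def
        by (intro dirD_eqI Deriv.has_derivative_inverse smooth_on_has_derivative[OF s x]) (simp add: \<psi>)
      then show ?thesis by (simp add: h_def a_def)
    qed
    define \<rho> where "\<rho> y = exp (F y) * h y ^ ?n" for y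
    have "dirD \<rho> x u = \<rho> x * christoffel_trace (G c) x u" if x: "x \<in> ?W" for x u
    proof -
      have xi: "x \<in> img c" using x r(2) by auto
      have hd: "(h has_derivative dirD h x) (at x)" by (rule smooth_on_has_derivative[OF hs x])
      have "dirD \<rho> x u = exp (F x) * (real ?n * dirD h x u * h x ^ (?n - 1))
          + exp (F x) * christoffel_trace (D c) x u * h x ^ ?n"
        unfolding \<rho>_def
        by (intro dirD_eqI[OF has_derivative_eq_rhs[OF has_derivative_mult[OF has_derivative_exp[OF F[OF x]]
              has_derivative_power[OF hd]]]]) (simp add: algebra_simps)
      also have "\<dots> = \<rho> x * (christoffel_trace (D c) x u + (real CARD('n) + 1) * a c x u)"
        by (simp add: dh[OF x] \<rho>_def algebra_simps)
      also have "christoffel_trace (D c) x u + (real CARD('n) + 1) * a c x u = christoffel_trace (G c) x u"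
        using a(1)[OF c(1)] xi
        by (intro christoffel_trace_projective_change[symmetric] Ga[OF c(1) xi]) (auto simp: one_form_on_def)
      finally show ?thesis .
    qed
    moreover have "smooth_on ?W \<rho>"
      unfolding \<rho>_def by (intro smooth_on_mult smooth_on_exp smooth_on_power open_ball Fs hs)
    moreover have "\<rho> x \<noteq> 0" for x by (simp add: \<rho>_def h_def \<psi>)
    ultimately show "\<exists>c\<in>A. \<exists>W \<rho>. p \<in> dom_of c \<and> open W \<and> coord c p \<in> W \<and> W \<subseteq> img c \<and>
        smooth_on W \<rho> \<and> (\<forall>x\<in>W. \<rho> x \<noteq> 0 \<and> (\<forall>u. dirD \<rho> x u = \<rho> x * christoffel_trace (G c) x u))"
      using r by (intro bexI[OF _ c(1)] exI[of _ ?W] exI[of _ \<rho>]) (simp add: c)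
  qed
  moreover have "infinitesimally_conformal A g G"
    unfolding infinitesimally_conformal_def holonomy_generator_def
  proof (intro ballI allI)
    fix c x u v assume c: "c \<in> A" and x: "x \<in> img c"
    show "infinitesimal_similarity (g c x) (\<lambda>w. - curvature G c x u v w)"
      unfolding curv[OF c x]
      by (rule proportional_imp_similarity[OF g_bilinear[OF c x] g_sym[OF c x]]) (rule refl)
  qed
  moreover have "\<exists>u v w. curvature G c x u v w \<noteq> 0" if c: "c \<in> A" and x: "x \<in> img c" for c x
  proof -
    let ?l = "- inverse (\<psi> (param c x))"
    \<comment> \<open>With v independent of u and g(u, w) nonzero, the coefficient - g(u, w) /
      \<psi> of v in R(u, v) w keeps the curvature from vanishing.\<close>
    obtain v where v: "\<And>s t. s *\<^sub>R (axis undefined 1 :: real ^ 'n) + t *\<^sub>R v = 0 \<Longrightarrow> t = 0"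
      using exists_independent_vector[OF dim] by blast
    define u :: "real ^ 'n" where "u = axis undefined 1"
    have "u \<noteq> 0" by (simp add: u_def)
    then obtain w where w: "g c x u w \<noteq> 0" using g_nonzero[OF c x] by blast
    have "curvature G c x u v w \<noteq> 0"
    proof
      assume "curvature G c x u v w = 0"
      then have "(- (?l * g c x v w)) *\<^sub>R u + (?l * g c x u w) *\<^sub>R v = 0"
        by (simp add: curv[OF c x] algebra_simps)
      then have "?l * g c x u w = 0" using v unfolding u_def by blast
      then show False using w \<psi> by simp
    qed
    then show ?thesis by blast
  qed
  ultimately show ?thesis
    unfolding hybrid_connection_def using G by blast
qed

text \<open>Since a is a multiple of the differential of a global function by a global function, it
  is a tensor; the inhomogeneous part of the transformation law is carried by
  \<open>D\<close>.\<close>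

theorem logarithmic_connection_exists:
  assumes \<psi>: "\<And>p. \<psi> p \<noteq> 0" and pot: "hessian_potential_on A D g UNIV \<psi>"
  shows "\<exists>G. affine_connection A G \<and> logarithmic_potential A D G \<psi>"
proof -
  define a :: "('m, 'n) chart \<Rightarrow> real ^ 'n \<Rightarrow> real ^ 'n \<Rightarrow> real"
    where "a c y u = - inverse ((\<psi> \<circ> param c) y) * dirD (\<psi> \<circ> param c) y u" for c y u
  define G where "G c x u v = D c x u v + (a c x u *\<^sub>R v + a c x v *\<^sub>R u)" for c x u v
  have a: "one_form_on (img c) (a c)" if "c \<in> A" for c
    using potential_difference_form(1)[OF \<psi> pot that] unfolding a_def[abs_def] .
  have "logarithmic_potential A D G \<psi>"
    unfolding logarithmic_potential_iff
    by (simp add: G_def a_def differential_def scaleR_add_right divide_inverse)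
  moreover have "affine_connection A G"
    unfolding affine_connection_def Let_def
  proof (intro conjI ballI allI)
    fix c assume c: "c \<in> A"
    show "bilinear (G c x)" if x: "x \<in> img c" for x
    proof -
      have b: "bilinear (D c x)" using D_field[OF c] x by (simp add: bilinear_field_on_def)
      have l: "linear (a c x)" using a[OF c] x by (simp add: one_form_on_def)
      show ?thesis
        unfolding bilinear_def
        by (intro conjI allI linearI)
          (simp_all add: G_def bilinear_ladd[OF b] bilinear_radd[OF b] bilinear_lmul[OF b] bilinear_rmul[OF b]
            linear_add[OF l] linear_cmul[OF l] algebra_simps)
    qed
    show "smooth_on (img c) (\<lambda>x. G c x u v)" for u v
      unfolding G_def using a[OF c] D_field[OF c]
      by (intro smooth_on_add smooth_on_scaleR smooth_on_const chart_param(6)[OF c])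
        (auto simp: one_form_on_def bilinear_field_on_def)
  next
    fix c c' x u v assume c: "c \<in> A" "c' \<in> A" and x: "x \<in> overlap c c'"
    have sf: "smooth_fun_on A UNIV \<psi>" using pot by (simp add: hessian_potential_on_def)
    have al: "a c x u = a c' (transition c c' x) (dirD (transition c c') x u)" for u
      by (simp add: a_def transition_overlap(1)[OF c x] differential_transform[OF sf c x] del: o_apply)
        (simp add: transition_overlap(1)[OF c x])
    note lin = transition_derivative_linear[OF c x]
    show "dirD (\<lambda>y. dirD (transition c c') y v) x u
        + G c' (transition c c' x) (dirD (transition c c') x u) (dirD (transition c c') x v)
      = dirD (transition c c') x (G c x u v)"
      using connection_law[OF D_affine c x, of v u]
      by (simp add: G_def al[symmetric] linear_add[OF lin] linear_cmul[OF lin] add.assoc[symmetric])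
  qed
  ultimately show ?thesis by blast
qed

end

text \<open>A logarithmic potential fixes \<open>G\<close> only on charts of the atlas and inside
  their images, so the converse speaks of every such \<open>G\<close>; the separate existence claim
  keeps it from being vacuous.\<close>

theorem theorem1p7:
  fixes A :: "('m::{t2_space,second_countable_topology}, 'n::finite) chart set"
    and D :: "('m, 'n) connection"
    and g :: "('m, 'n) bilinear_field"
  assumes "hessian_manifold A D g"
  shows "(\<forall>G. hybrid_connection A D g G \<longrightarrow>
            (\<exists>\<psi>. (\<forall>p. \<psi> p \<noteq> 0) \<and> hessian_potential_on A D g UNIV \<psi> \<and>
                 logarithmic_potential A D G \<psi>)) \<and>
         (\<forall>\<psi>. (\<forall>p. \<psi> p \<noteq> 0) \<and> hessian_potential_on A D g UNIV \<psi> \<longrightarrow>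
            (\<exists>G. affine_connection A G \<and> logarithmic_potential A D G \<psi>) \<and>
            (\<forall>G. affine_connection A G \<and> logarithmic_potential A D G \<psi> \<longrightarrow>
                 hybrid_connection A D g G))"
proof -
  interpret hessian_mfd A D g by unfold_locales (rule assms)
  show ?thesis
    using hybrid_imp_potential logarithmic_connection_exists potential_imp_hybrid by blast
qed

end
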